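(* Let $X$ be a proper geodesically complete $CAT(-1)$-space and let $\Gamma$ be a discrete one-ended group of isometries of $X$ with compact quotient $Y=X/\Gamma$. Then the geodesic flow on $Y$ (that is, the flow $\mathbb{R}\times GY\to GY$) is topologically mixing.
   Context: A $CAT(-1)$-space is a geodesic metric space in which every geodesic triangle is at least as thin as its comparison triangle in the hyperbolic plane $\mathbb{H}^2$. A metric space is proper if its closed balls are compact, and geodesically complete if each geodesic segment is the restriction of a geodesic defined on the whole real line. A discrete group $\Gamma$ of isometries of $X$ is one acting properly discontinuously on $X$: for every compact $K\subset X$ the set $\{\gamma\in\Gamma : \gamma K\cap K\ne\emptyset\}$ is finite. $GX$ is the space of all geodesics, i.e. isometric maps $g:\mathbb{R}\to X$, with the topology of uniform convergence on compact sets. $\Gamma$ acts on $GX$ by composition, and $GY:=GX/\Gamma$ with the quotient topology; $p:GX\to GY$ is the projection. The geodesic flow on $GX$ is $(t\cdot g)(s)=g(s+t)$, and the geodesic flow on $GY$ is $t\cdot g=p(t\cdot\overline g)$ for any lift $\overline g\in GX$ of $g\in GY$. The geodesic flow on $GY$ is topologically mixing if for any nonempty open sets $\mathcal{O},\mathcal{U}\subset GY$ there is $t_0>0$ such that $t\cdot\mathcal{O}\cap\mathcal{U}\neq\emptyset$ for all $|t|\ge t_0$. *)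

theory Defs
  imports "HOL-Analysis.Analysis" "HOL-Algebra.Group_Action" "HOL-Algebra.Generated_Groups"
begin

section \<open>Geodesics and CAT(-1)-spaces\<close>

definition geodesic_segment ::
  "'a set \<Rightarrow> ('a \<Rightarrow> 'a \<Rightarrow> real) \<Rightarrow> (real \<Rightarrow> 'a) \<Rightarrow> 'a \<Rightarrow> 'a \<Rightarrow> bool" where
  "geodesic_segment M d c x y \<longleftrightarrow>
     c \<in> {0..d x y} \<rightarrow> M \<and> c 0 = x \<and> c (d x y) = y \<and>
     (\<forall>s\<in>{0..d x y}. \<forall>t\<in>{0..d x y}. d (c s) (c t) = \<bar>s - t\<bar>)"

definition geodesic_lines :: "'a set \<Rightarrow> ('a \<Rightarrow> 'a \<Rightarrow> real) \<Rightarrow> (real \<Rightarrow> 'a) set" where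
  "geodesic_lines M d = {g. range g \<subseteq> M \<and> (\<forall>s t. d (g s) (g t) = \<bar>s - t\<bar>)}"

definition geodesic_space :: "'a set \<Rightarrow> ('a \<Rightarrow> 'a \<Rightarrow> real) \<Rightarrow> bool" where
  "geodesic_space M d \<longleftrightarrow>
     Metric_space M d \<and> (\<forall>x\<in>M. \<forall>y\<in>M. \<exists>c. geodesic_segment M d c x y)"

definition geodesically_complete :: "'a set \<Rightarrow> ('a \<Rightarrow> 'a \<Rightarrow> real) \<Rightarrow> bool" where
  "geodesically_complete M d \<longleftrightarrow>
     (\<forall>x\<in>M. \<forall>y\<in>M. \<forall>c. geodesic_segment M d c x y \<longrightarrow>
        (\<exists>g\<in>geodesic_lines M d. \<forall>s\<in>{0..d x y}. g s = c s))"

text \<open>The hyperbolic plane, in the upper half-plane model (curvature -1).\<close>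

definition hyp_plane :: "complex set" where
  "hyp_plane = {z. Im z > 0}"

definition hyp_dist :: "complex \<Rightarrow> complex \<Rightarrow> real" where
  "hyp_dist z w = arcosh (1 + (cmod (z - w))\<^sup>2 / (2 * Im z * Im w))"

text \<open>The vertices are \<open>v 0\<close>, \<open>v 1\<close>, \<open>v 2\<close>, and \<open>c i\<close> is the side from \<open>v i\<close> to the
  cyclically next vertex.\<close>

definition geodesic_triangle ::
  "'a set \<Rightarrow> ('a \<Rightarrow> 'a \<Rightarrow> real) \<Rightarrow> (nat \<Rightarrow> 'a) \<Rightarrow> (nat \<Rightarrow> real \<Rightarrow> 'a) \<Rightarrow> bool" where
  "geodesic_triangle M d v c \<longleftrightarrow>
     (\<forall>i<3. v i \<in> M \<and> geodesic_segment M d (c i) (v i) (v (Suc i mod 3)))"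

text \<open>A point \<open>c i s\<close> of the triangle has \<open>c' i s\<close> as its comparison point.  Comparison
  triangles exist and are unique up to isometries of the hyperbolic plane.\<close>

definition comparison_triangle ::
  "('a \<Rightarrow> 'a \<Rightarrow> real) \<Rightarrow> (nat \<Rightarrow> 'a) \<Rightarrow> (nat \<Rightarrow> complex) \<Rightarrow> (nat \<Rightarrow> real \<Rightarrow> complex) \<Rightarrow> bool" where
  "comparison_triangle d v v' c' \<longleftrightarrow>
     geodesic_triangle hyp_plane hyp_dist v' c' \<and>
     (\<forall>i<3. \<forall>j<3. hyp_dist (v' i) (v' j) = d (v i) (v j))"

definition CAT_minus_one :: "'a set \<Rightarrow> ('a \<Rightarrow> 'a \<Rightarrow> real) \<Rightarrow> bool" where
  "CAT_minus_one M d \<longleftrightarrow> geodesic_space M d \<and>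
     (\<forall>v c v' c'. geodesic_triangle M d v c \<and> comparison_triangle d v v' c' \<longrightarrow>
        (\<forall>i<3. \<forall>j<3. \<forall>s\<in>{0..d (v i) (v (Suc i mod 3))}. \<forall>t\<in>{0..d (v j) (v (Suc j mod 3))}.
           d (c i s) (c j t) \<le> hyp_dist (c' i s) (c' j t)))"


section \<open>Discrete groups of isometries\<close>

definition isometry_group :: "('a::metric_space \<Rightarrow> 'a) monoid" where
  "isometry_group =
     \<lparr>carrier = {f. surj f \<and> (\<forall>x y. dist (f x) (f y) = dist x y)}, mult = (\<circ>), one = id\<rparr>"

lemma group_isometry_group: "group (isometry_group :: ('a::metric_space \<Rightarrow> 'a) monoid)"
proof (rule groupI)
  fix f :: "'a \<Rightarrow> 'a" assume "f \<in> carrier isometry_group"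
  then have f: "surj f" "\<And>x y. dist (f x) (f y) = dist x y"
    by (auto simp: isometry_group_def)
  have inj: "inj f" by (rule injI) (metis f(2) dist_eq_0_iff)
  then have "surj (inv_into UNIV f)" "inv_into UNIV f \<circ> f = id"
    by (simp_all add: inj_imp_surj_inv)
  moreover have "dist (inv_into UNIV f x) (inv_into UNIV f y) = dist x y" for x y
    by (metis f surj_f_inv_f)
  ultimately show "\<exists>g\<in>carrier isometry_group. g \<otimes>\<^bsub>isometry_group\<^esub> f = \<one>\<^bsub>isometry_group\<^esub>"
    by (intro bexI[of _ "inv_into UNIV f"]) (simp_all add: isometry_group_def)
next
  fix f g :: "'a \<Rightarrow> 'a"
  assume "f \<in> carrier isometry_group" "g \<in> carrier isometry_group"
  then show "f \<otimes>\<^bsub>isometry_group\<^esub> g \<in> carrier isometry_group"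
    using comp_surj[of g f] by (simp add: isometry_group_def)
qed (simp_all add: isometry_group_def o_assoc)

definition properly_discontinuous :: "('a::metric_space \<Rightarrow> 'a) set \<Rightarrow> bool" where
  "properly_discontinuous \<Gamma> \<longleftrightarrow>
     (\<forall>K. compact K \<longrightarrow> finite {\<gamma>\<in>\<Gamma>. \<gamma> ` K \<inter> K \<noteq> {}})"

definition discrete_isometry_group :: "('a::metric_space \<Rightarrow> 'a) set \<Rightarrow> bool" where
  "discrete_isometry_group \<Gamma> \<longleftrightarrow> subgroup \<Gamma> isometry_group \<and> properly_discontinuous \<Gamma>"


section \<open>Ends of groups\<close>

definition cayley_edges :: "('a, 'b) monoid_scheme \<Rightarrow> 'a set \<Rightarrow> ('a \<times> 'a) set" where
  "cayley_edges G S = {(g, h). g \<in> carrier G \<and> h \<in> carrier G \<and>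
     (\<exists>s\<in>S. h = g \<otimes>\<^bsub>G\<^esub> s \<or> g = h \<otimes>\<^bsub>G\<^esub> s)}"

definition cayley_components :: "('a, 'b) monoid_scheme \<Rightarrow> 'a set \<Rightarrow> 'a set \<Rightarrow> 'a set set" where
  "cayley_components G S F =
     (carrier G - F) // ((cayley_edges G S \<inter> (carrier G - F) \<times> (carrier G - F))\<^sup>*)"

text \<open>The space of ends of the Cayley graph is the inverse limit, over the finite vertex sets
  \<open>F\<close>, of the sets of infinite components of the complement of \<open>F\<close>.\<close>

definition ends :: "('a, 'b) monoid_scheme \<Rightarrow> 'a set \<Rightarrow> ('a set \<Rightarrow> 'a set) set" where
  "ends G S = {e \<in> extensional {F. finite F \<and> F \<subseteq> carrier G}.
     (\<forall>F. finite F \<and> F \<subseteq> carrier G \<longrightarrow> e F \<in> cayley_components G S F \<and> infinite (e F)) \<and>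
     (\<forall>F F'. finite F' \<and> F' \<subseteq> carrier G \<and> F \<subseteq> F' \<longrightarrow> e F' \<subseteq> e F)}"

text \<open>The number of ends does not depend on the choice of the finite generating set.\<close>

definition one_ended :: "('a, 'b) monoid_scheme \<Rightarrow> bool" where
  "one_ended G \<longleftrightarrow>
     (\<exists>S. finite S \<and> S \<subseteq> carrier G \<and> generate G S = carrier G \<and> card (ends G S) = 1)"


section \<open>Quotients by the group\<close>

definition quotient_topology :: "'a topology \<Rightarrow> ('a \<Rightarrow> 'b) \<Rightarrow> 'b topology" where
  "quotient_topology X f =
     topology (\<lambda>U. U \<subseteq> f ` topspace X \<and> openin X {x \<in> topspace X. f x \<in> U})"

lemma openin_quotient_topology:
  "openin (quotient_topology X f) U \<longleftrightarrow>
     U \<subseteq> f ` topspace X \<and> openin X {x \<in> topspace X. f x \<in> U}"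
proof -
  have "istopology (\<lambda>U. U \<subseteq> f ` topspace X \<and> openin X {x \<in> topspace X. f x \<in> U})"
    unfolding istopology_def
  proof (intro conjI allI impI)
    fix S T
    assume "S \<subseteq> f ` topspace X \<and> openin X {x \<in> topspace X. f x \<in> S}"
      and "T \<subseteq> f ` topspace X \<and> openin X {x \<in> topspace X. f x \<in> T}"
    moreover have "{x \<in> topspace X. f x \<in> S \<inter> T} =
        {x \<in> topspace X. f x \<in> S} \<inter> {x \<in> topspace X. f x \<in> T}" by auto
    ultimately show "S \<inter> T \<subseteq> f ` topspace X" "openin X {x \<in> topspace X. f x \<in> S \<inter> T}"
      by (auto simp: openin_Int)
  next
    fix \<K>
    assume K: "\<forall>U\<in>\<K>. U \<subseteq> f ` topspace X \<and> openin X {x \<in> topspace X. f x \<in> U}"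
    have "{x \<in> topspace X. f x \<in> \<Union>\<K>} = (\<Union>U\<in>\<K>. {x \<in> topspace X. f x \<in> U})" by auto
    with K show "\<Union>\<K> \<subseteq> f ` topspace X" "openin X {x \<in> topspace X. f x \<in> \<Union>\<K>}"
      by (auto intro!: openin_Union)
  qed
  then show ?thesis
    by (simp add: quotient_topology_def topology_inverse')
qed

lemma quotient_map_quotient_topology: "quotient_map X (quotient_topology X f) f"
proof -
  have "{x \<in> topspace X. f x \<in> f ` topspace X} = topspace X" by auto
  then have "topspace (quotient_topology X f) = f ` topspace X"
    by (metis openin_quotient_topology openin_subset openin_topspace subset_antisym subset_refl)
  then show ?thesis
    by (simp add: quotient_map_def openin_quotient_topology)
qed

definition proj_Y :: "('a::metric_space \<Rightarrow> 'a) set \<Rightarrow> 'a \<Rightarrow> 'a set" where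
  "proj_Y \<Gamma> x = orbit (isometry_group\<lparr>carrier := \<Gamma>\<rparr>) (\<lambda>\<gamma>. \<gamma>) x"

definition quotient_space :: "('a::metric_space \<Rightarrow> 'a) set \<Rightarrow> 'a set topology" where
  "quotient_space \<Gamma> = quotient_topology euclidean (proj_Y \<Gamma>)"

definition proj_GY ::
  "('a::metric_space \<Rightarrow> 'a) set \<Rightarrow> (real \<Rightarrow> 'a) \<Rightarrow> (real \<Rightarrow> 'a) set" where
  "proj_GY \<Gamma> g = orbit (isometry_group\<lparr>carrier := \<Gamma>\<rparr>) (\<lambda>\<gamma> g. \<gamma> \<circ> g) g"


section \<open>The geodesic flow\<close>

abbreviation GX :: "(real \<Rightarrow> 'a::metric_space) set" where
  "GX \<equiv> geodesic_lines UNIV dist"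

text \<open>The topology of uniform convergence on compact sets: the sets
  \<open>{h \<in> GX. \<forall>t\<in>K. dist (h t) (g t) < \<epsilon>}\<close> with \<open>K\<close> compact and \<open>\<epsilon> > 0\<close> form a neighbourhood
  base of \<open>g\<close>.\<close>

definition GX_topology :: "(real \<Rightarrow> 'a::metric_space) topology" where
  "GX_topology = topology (\<lambda>U. U \<subseteq> GX \<and>
     (\<forall>g\<in>U. \<exists>K \<epsilon>. compact K \<and> \<epsilon> > 0 \<and> {h \<in> GX. \<forall>t\<in>K. dist (h t) (g t) < \<epsilon>} \<subseteq> U))"

lemma openin_GX_topology:
  fixes U :: "(real \<Rightarrow> 'a::metric_space) set"
  shows "openin GX_topology U \<longleftrightarrow> U \<subseteq> GX \<and>
     (\<forall>g\<in>U. \<exists>K \<epsilon>. compact K \<and> \<epsilon> > 0 \<and> {h \<in> GX. \<forall>t\<in>K. dist (h t) (g t) < \<epsilon>} \<subseteq> U)"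
proof -
  have "istopology (\<lambda>U :: (real \<Rightarrow> 'a) set. U \<subseteq> GX \<and>
     (\<forall>g\<in>U. \<exists>K \<epsilon>. compact K \<and> \<epsilon> > 0 \<and> {h \<in> GX. \<forall>t\<in>K. dist (h t) (g t) < \<epsilon>} \<subseteq> U))"
    (is "istopology (\<lambda>U. U \<subseteq> _ \<and> ?N U)")
    unfolding istopology_def
  proof (intro conjI allI impI)
    fix S T assume S: "S \<subseteq> GX \<and> ?N S" and T: "T \<subseteq> GX \<and> ?N T"
    show "S \<inter> T \<subseteq> GX" using S by blast
    show "?N (S \<inter> T)"
    proof
      fix g assume g: "g \<in> S \<inter> T"
      obtain K \<epsilon> where 1: "compact K" "\<epsilon> > 0" "{h \<in> GX. \<forall>t\<in>K. dist (h t) (g t) < \<epsilon>} \<subseteq> S"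
        using bspec[OF conjunct2[OF S] IntD1[OF g]] by blast
      obtain L \<delta> where 2: "compact L" "\<delta> > 0" "{h \<in> GX. \<forall>t\<in>L. dist (h t) (g t) < \<delta>} \<subseteq> T"
        using bspec[OF conjunct2[OF T] IntD2[OF g]] by blast
      have "compact (K \<union> L)" "min \<epsilon> \<delta> > 0"
        "{h \<in> GX. \<forall>t\<in>K \<union> L. dist (h t) (g t) < min \<epsilon> \<delta>} \<subseteq> S \<inter> T"
        using 1 2 by (simp_all add: compact_Un subset_iff)
      then show "\<exists>K \<epsilon>. compact K \<and> \<epsilon> > 0 \<and>
          {h \<in> GX. \<forall>t\<in>K. dist (h t) (g t) < \<epsilon>} \<subseteq> S \<inter> T" by blast
    qed
  next
    fix \<K> assume K: "\<forall>U\<in>\<K>. U \<subseteq> GX \<and> ?N U"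
    then show "\<Union>\<K> \<subseteq> GX" by blast
    show "?N (\<Union>\<K>)"
    proof
      fix g assume "g \<in> \<Union>\<K>"
      then obtain U where U: "U \<in> \<K>" "g \<in> U" by blast
      obtain K \<epsilon> where "compact K" "\<epsilon> > 0" "{h \<in> GX. \<forall>t\<in>K. dist (h t) (g t) < \<epsilon>} \<subseteq> U"
        using bspec[OF conjunct2[OF bspec[OF K U(1)]] U(2)] by blast
      then show "\<exists>K \<epsilon>. compact K \<and> \<epsilon> > 0 \<and>
          {h \<in> GX. \<forall>t\<in>K. dist (h t) (g t) < \<epsilon>} \<subseteq> \<Union>\<K>"
        using Union_upper[OF U(1)] by (meson subset_trans)
    qed
  qed
  then show ?thesis
    unfolding GX_topology_def by (subst topology_inverse') auto
qed

definition GY_topology :: "('a::metric_space \<Rightarrow> 'a) set \<Rightarrow> (real \<Rightarrow> 'a) set topology" where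
  "GY_topology \<Gamma> = quotient_topology GX_topology (proj_GY \<Gamma>)"

definition GX_flow :: "real \<Rightarrow> (real \<Rightarrow> 'a) \<Rightarrow> real \<Rightarrow> 'a" where
  "GX_flow t g = (\<lambda>s. g (s + t))"

definition GY_flow ::
  "('a::metric_space \<Rightarrow> 'a) set \<Rightarrow> real \<Rightarrow> (real \<Rightarrow> 'a) set \<Rightarrow> (real \<Rightarrow> 'a) set" where
  "GY_flow \<Gamma> t y = proj_GY \<Gamma> (GX_flow t (SOME g. g \<in> GX \<and> proj_GY \<Gamma> g = y))"

lemma GY_flow_proj:
  assumes "subgroup \<Gamma> isometry_group" "g \<in> GX"
  shows "GY_flow \<Gamma> t (proj_GY \<Gamma> g) = proj_GY \<Gamma> (GX_flow t g)"
proof -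
  define h where "h = (SOME h. h \<in> GX \<and> proj_GY \<Gamma> h = proj_GY \<Gamma> g)"
  have h: "proj_GY \<Gamma> h = proj_GY \<Gamma> g"
    unfolding h_def using someI[of "\<lambda>h. h \<in> GX \<and> proj_GY \<Gamma> h = proj_GY \<Gamma> g" g] assms(2) by blast
  have proj: "proj_GY \<Gamma> k = (\<lambda>\<gamma>. \<gamma> \<circ> k) ` \<Gamma>" for k
    by (auto simp: proj_GY_def orbit_def)
  have flow: "proj_GY \<Gamma> (GX_flow t k) = GX_flow t ` proj_GY \<Gamma> k" for k
    by (auto simp: proj GX_flow_def image_image o_def)
  show ?thesis
    unfolding GY_flow_def h_def[symmetric] flow h ..
qed

definition topologically_mixing :: "'b topology \<Rightarrow> (real \<Rightarrow> 'b \<Rightarrow> 'b) \<Rightarrow> bool" where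
  "topologically_mixing T \<phi> \<longleftrightarrow>
     (\<forall>O' U. openin T O' \<and> openin T U \<and> O' \<noteq> {} \<and> U \<noteq> {} \<longrightarrow>
        (\<exists>t\<^sub>0>0. \<forall>t. \<bar>t\<bar> \<ge> t\<^sub>0 \<longrightarrow> \<phi> t ` O' \<inter> U \<noteq> {}))"

end

theory Submission
  imports Defs
begin

text \<open>
Write \<open>A\<^sub>n = a\<^sup>n x\<close> for the orbit of a point \<open>x\<close> on the axis of an element \<open>a\<close> of \<open>\<Gamma>\<close> with translation
length \<open>l\<close>.  A geodesic that starts along a line \<open>g\<close> and ends along a translate \<open>\<gamma> h\<close> can be made to
follow translates of the axis in between, that is, to run through a word
\<open>\<gamma> = w\<^sub>0 a\<^sup>n\<^sup>0 u\<^sub>1 a\<^sup>n\<^sup>1 u\<^sub>2 \<dots> u\<^sub>k a\<^sup>n\<^sup>k w\<^sub>1\<close>.  If the exponents are large, its length is, up to a small error,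
\<open>l \<Sum>n\<^sub>i + \<Sum>\<tau>(u\<^sub>i) + const\<close>, where \<open>\<tau>(u) = lim d(A\<^sub>-\<^sub>p, u A\<^sub>p) - 2 l p\<close> is the time of the homoclinic
excursion \<open>u\<close> (lemma \<open>transit\<close>).  The flow is mixing as soon as the possible lengths, with \<open>g\<close> and \<open>h\<close>
fixed, become \<open>\<epsilon>\<close>-dense near infinity, for every \<open>\<epsilon>\<close>.

Varying the last exponent moves the length by steps of \<open>l\<close>.  The gaps of length \<open>l\<close> are filled by
exchanging excursions: if \<open>\<delta> = \<tau>(u\<^sub>1) + \<tau>(u\<^sub>2) - \<tau>(u\<^sub>3) - \<tau>(u\<^sub>4)\<close> lies between \<open>0\<close> and \<open>\<epsilon>\<close>, then using the
pair \<open>u\<^sub>1, u\<^sub>2\<close> in \<open>j\<close> of \<open>k\<close> places and \<open>u\<^sub>3, u\<^sub>4\<close> in the others changes the length by \<open>j \<delta>\<close>, and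
\<open>k \<delta> \<ge> l\<close> for a suitable \<open>k\<close> (lemma \<open>transit_times_dense\<close>).

This is where the single end of \<open>\<Gamma>\<close> enters.  Let \<open>v\<close> move the repelling end \<open>a\<^sup>-\<close> of the axis, and let
\<open>\<phi>(z)\<close> be the difference of the Busemann functions of \<open>a\<^sup>-\<close> and \<open>v a\<^sup>-\<close>.  For an excursion \<open>y\<close> the number
\<open>\<tau>(y) - \<tau>(v\<^sup>-\<^sup>1 y)\<close> is the limit of \<open>\<phi>\<close> along \<open>y A\<^sub>p\<close>, so \<open>\<delta>\<close> becomes a difference of two values of \<open>\<phi>\<close> at
infinity, the logarithm of a cross-ratio.  Since \<open>\<Gamma>\<close> has one end, \<open>a\<^sup>-\<close> and \<open>v a\<^sup>-\<close> can be joined outside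
every ball, and along such a path the continuous function \<open>\<phi>\<close> takes every prescribed real value \<open>c\<close>
at a point \<open>z\<close> arbitrarily far away.  Some translate \<open>y a\<^sup>+\<close> of the attracting end lies behind \<open>z\<close>, as
seen from \<open>x\<close>, and \<open>\<phi>\<close> hardly changes behind \<open>z\<close> (lemma \<open>cross_ratio_attained\<close>).  Hence arbitrarily
small positive \<open>\<delta>\<close> occur.

All estimates come from one consequence of the curvature condition: in terms of the Gromov product
\<open>(y|z)\<^sub>p = (d(p,y) + d(p,z) - d(y,z)) / 2\<close>,
\<open>exp(-(x|z)\<^sub>p) \<le> exp(-(x|y)\<^sub>p) + 3 exp(-(y|z)\<^sub>p)\<close> (lemma \<open>CAT_gromov_product\<close>).  The coefficient \<open>1\<close> makes
errors exponentially small, and not only bounded as in a general hyperbolic space.  Points at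
infinity are represented throughout by sequences such as \<open>n \<mapsto> y A\<^sub>n\<close>, and two ends are distinct when
the Gromov products of the two sequences are bounded.
\<close>

section \<open>Comparison triangles in the hyperbolic plane\<close>

lemma cosh_hyp_dist:
  assumes "z \<in> hyp_plane" "w \<in> hyp_plane"
  shows "cosh (hyp_dist z w) = 1 + (cmod (z - w))\<^sup>2 / (2 * Im z * Im w)"
proof -
  have "(cmod (z - w))\<^sup>2 / (2 * Im z * Im w) \<ge> 0"
    using assms by (simp add: hyp_plane_def)
  then show ?thesis
    unfolding hyp_dist_def by (intro cosh_arcosh_real) simp
qed

lemma hyp_dist_eqI:
  assumes "z \<in> hyp_plane" "w \<in> hyp_plane" "0 \<le> r"
    and "1 + (cmod (z - w))\<^sup>2 / (2 * Im z * Im w) = cosh r"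
  shows "hyp_dist z w = r"
  using assms arcosh_cosh_real unfolding hyp_dist_def by metis

lemma hyp_vertical_line:
  "hyp_dist (Complex u (exp s)) (Complex u (exp t)) = \<bar>s - t\<bar>"
proof (rule hyp_dist_eqI)
  have "(cmod (Complex u (exp s) - Complex u (exp t)))\<^sup>2 = (exp s - exp t)\<^sup>2"
    by (simp add: cmod_power2)
  moreover have "1 + (exp s - exp t)\<^sup>2 / (2 * exp s * exp t) = cosh (s - t)"
    by (simp add: cosh_field_def exp_diff field_simps power2_eq_square)
  ultimately show "1 + (cmod (Complex u (exp s) - Complex u (exp t)))\<^sup>2 /
      (2 * Im (Complex u (exp s)) * Im (Complex u (exp t))) = cosh \<bar>s - t\<bar>" by simp
qed (auto simp: hyp_plane_def)

text \<open>Half-circles centred on the real axis, parametrised by arc length: with \<open>1 / cosh\<^sup>2 = 1 - tanh\<^sup>2\<close> the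
formula for \<open>cosh\<close> of the distance collapses to the addition theorem.\<close>

lemma hyp_half_circle:
  assumes r: "r > 0"
  shows "hyp_dist (Complex (c + r * tanh s) (r / cosh s)) (Complex (c + r * tanh t) (r / cosh t)) = \<bar>s - t\<bar>"
proof (rule hyp_dist_eqI)
  let ?z = "Complex (c + r * tanh s) (r / cosh s)" and ?w = "Complex (c + r * tanh t) (r / cosh t)"
  have sq: "tanh x ^ 2 = 1 - (1 / cosh x)\<^sup>2" for x :: real
    using cosh_square_eq[of x] by (simp add: tanh_def power_divide diff_divide_distrib sinh_square_eq)
  have "(cmod (?z - ?w))\<^sup>2 = r\<^sup>2 * ((tanh s - tanh t)\<^sup>2 + (1 / cosh s - 1 / cosh t)\<^sup>2)"
    unfolding cmod_power2 by (simp add: algebra_simps power2_eq_square)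
  also have "(tanh s - tanh t)\<^sup>2 + (1 / cosh s - 1 / cosh t)\<^sup>2
      = 2 - 2 * tanh s * tanh t - 2 / (cosh s * cosh t)"
    using sq[of s] sq[of t] by (simp add: power2_diff algebra_simps)
  also have "\<dots> = 2 * (cosh (s - t) - 1) / (cosh s * cosh t)"
    by (simp add: cosh_diff tanh_def field_simps)
  finally have "(cmod (?z - ?w))\<^sup>2 = r\<^sup>2 * (2 * (cosh (s - t) - 1) / (cosh s * cosh t))" .
  then show "1 + (cmod (?z - ?w))\<^sup>2 / (2 * Im ?z * Im ?w) = cosh \<bar>s - t\<bar>"
    using r by (simp add: field_simps power2_eq_square)
qed (use r in \<open>auto simp: hyp_plane_def\<close>)

lemma hyp_plane_line_through:
  assumes "z \<in> hyp_plane" "w \<in> hyp_plane"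
  obtains \<sigma> p q where "\<And>t. \<sigma> t \<in> hyp_plane" "\<And>s t :: real. hyp_dist (\<sigma> s) (\<sigma> t) = \<bar>s - t\<bar>"
    "\<sigma> p = z" "\<sigma> q = w"
proof (cases "Re z = Re w")
  case True
  have "Complex (Re z) (exp (ln (Im z))) = z" "Complex (Re z) (exp (ln (Im w))) = w"
    using assms True by (auto simp: hyp_plane_def complex_eq_iff)
  then show ?thesis
    using that[of "\<lambda>t. Complex (Re z) (exp t)"] hyp_vertical_line
    by (auto simp: hyp_plane_def)
next
  case False
  \<comment> \<open>The centre of the half-circle orthogonal to the real axis is equidistant from both points.\<close>
  define c where "c = ((cmod w)\<^sup>2 - (cmod z)\<^sup>2) / (2 * (Re w - Re z))"
  define r where "r = sqrt ((Re z - c)\<^sup>2 + (Im z)\<^sup>2)"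
  have eq: "(Re z - c)\<^sup>2 + (Im z)\<^sup>2 = (Re w - c)\<^sup>2 + (Im w)\<^sup>2"
  proof -
    have "c * (2 * (Re w - Re z)) = (cmod w)\<^sup>2 - (cmod z)\<^sup>2"
      unfolding c_def using False by (subst nonzero_eq_divide_eq[symmetric]) simp_all
    then show ?thesis
      by (simp add: cmod_power2 power2_diff algebra_simps)
  qed
  have Im: "Im z > 0" "Im w > 0" using assms by (auto simp: hyp_plane_def)
  have r: "r > 0" unfolding r_def using Im by (auto intro!: add_nonneg_pos)
  have param: "Complex (c + r * tanh (arsinh ((Re x - c) / Im x))) (r / cosh (arsinh ((Re x - c) / Im x))) = x"
    if "Im x > 0" "r = sqrt ((Re x - c)\<^sup>2 + (Im x)\<^sup>2)" for x
  proof -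
    have "sqrt (((Re x - c) / Im x)\<^sup>2 + 1) = sqrt (((Re x - c)\<^sup>2 + (Im x)\<^sup>2) / (Im x)\<^sup>2)"
      using that(1) by (simp add: field_simps)
    also have "\<dots> = r / Im x" using that by (simp add: real_sqrt_divide)
    finally have "cosh (arsinh ((Re x - c) / Im x)) = r / Im x" by (simp add: cosh_arsinh_real)
    then show ?thesis
      using that(1) r by (simp add: tanh_def complex_eq_iff)
  qed
  show ?thesis
  proof (rule that[of "\<lambda>t. Complex (c + r * tanh t) (r / cosh t)"])
    show "Complex (c + r * tanh t) (r / cosh t) \<in> hyp_plane" for t
      using r by (simp add: hyp_plane_def)
    show "hyp_dist (Complex (c + r * tanh s) (r / cosh s)) (Complex (c + r * tanh t) (r / cosh t)) = \<bar>s - t\<bar>"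
      for s t by (rule hyp_half_circle[OF r])
    show "Complex (c + r * tanh (arsinh ((Re z - c) / Im z))) (r / cosh (arsinh ((Re z - c) / Im z))) = z"
      by (rule param[OF Im(1) r_def])
    show "Complex (c + r * tanh (arsinh ((Re w - c) / Im w))) (r / cosh (arsinh ((Re w - c) / Im w))) = w"
      by (rule param[OF Im(2)]) (simp add: r_def eq)
  qed
qed

lemma hyp_plane_geodesic:
  assumes "z \<in> hyp_plane" "w \<in> hyp_plane"
  shows "\<exists>c. geodesic_segment hyp_plane hyp_dist c z w"
proof -
  obtain \<sigma> p q where \<sigma>: "\<And>t. \<sigma> t \<in> hyp_plane" "\<And>s t :: real. hyp_dist (\<sigma> s) (\<sigma> t) = \<bar>s - t\<bar>"
    "\<sigma> p = z" "\<sigma> q = w"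
    using hyp_plane_line_through[OF assms] by metis
  have d: "hyp_dist z w = \<bar>p - q\<bar>" using \<sigma> by metis
  show ?thesis
  proof (cases "p \<le> q")
    case True
    then show ?thesis
      by (intro exI[of _ "\<lambda>s. \<sigma> (p + s)"]) (auto simp: geodesic_segment_def d \<sigma>)
  next
    case False
    then show ?thesis
      by (intro exI[of _ "\<lambda>s. \<sigma> (p - s)"]) (auto simp: geodesic_segment_def d \<sigma>)
  qed
qed

text \<open>With the first side on the imaginary axis, the third vertex \<open>q = u + i y\<close> has
\<open>cosh d(i e\<^sup>t, q) = (u\<^sup>2 + y\<^sup>2 + e\<^sup>2\<^sup>t) / (2 y e\<^sup>t)\<close>.  The two prescribed distances are equations for \<open>y\<close>
and \<open>u\<^sup>2\<close>; the solution has \<open>u\<^sup>2 \<ge> 0\<close> exactly when \<open>e\<^sup>-\<^sup>b \<le> y \<le> e\<^sup>b\<close>, and these two bounds are the triangle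
inequalities.\<close>

lemma hyp_plane_triangle_exists:
  assumes a: "a > 0" and tri: "b \<le> a + e" "e \<le> a + b" "a \<le> b + e" and nn: "b \<ge> 0" "e \<ge> 0"
  obtains q where "q \<in> hyp_plane" "hyp_dist \<i> q = b" "hyp_dist (Complex 0 (exp a)) q = e"
proof -
  define D where "D = exp a * cosh e - cosh b"
  define y where "y = (exp (2 * a) - 1) / (2 * D)"
  have "cosh b \<le> cosh (a + e)"
    using tri nn a by (subst cosh_real_nonneg_le_iff) auto
  also have "\<dots> < exp a * cosh e"
    using a by (simp add: cosh_add cosh_plus_sinh[symmetric] algebra_simps sinh_less_cosh_real)
  finally have D: "D > 0" by (simp add: D_def)
  have e2a: "exp (2 * a) > 1" using a by simp
  have y: "y > 0" using D e2a by (simp add: y_def)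
  have yD: "2 * y * D = exp (2 * a) - 1" using D by (simp add: y_def)
  have ex: "exp a * exp (- a) = 1" "exp b * exp (- b) = 1" by (simp_all add: exp_minus)
  have ch: "2 * cosh t = exp t + exp (- t)" for t :: real by (simp add: cosh_field_def)
  have c1: "exp (a + b) * (2 * cosh (a - b)) = exp (2 * a) + exp (2 * b)"
    unfolding ch by (simp add: distrib_left exp_add[symmetric])
  have c2: "exp (a - b) * (2 * cosh (a + b)) = exp (2 * a) + exp (- 2 * b)"
    unfolding ch by (simp add: distrib_left exp_add[symmetric])
  have dEb: "2 * exp b * D = exp (a + b) * (2 * cosh e) - exp (2 * b) - 1"
  proof -
    have "2 * exp b * D = exp (a + b) * (2 * cosh e) - exp b * (2 * cosh b)"
      by (simp add: D_def algebra_simps exp_add)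
    also have "exp b * (2 * cosh b) = exp (2 * b) + 1"
      unfolding ch by (simp add: distrib_left exp_add[symmetric])
    finally show ?thesis by simp
  qed
  have dEm: "2 * exp (- b) * D = exp (a - b) * (2 * cosh e) - exp (- 2 * b) - 1"
  proof -
    have "2 * exp (- b) * D = exp (a - b) * (2 * cosh e) - exp (- b) * (2 * cosh b)"
      by (simp add: D_def algebra_simps exp_diff exp_minus divide_inverse)
    also have "exp (- b) * (2 * cosh b) = exp (- 2 * b) + 1"
      unfolding ch by (simp add: distrib_left exp_add[symmetric])
    finally show ?thesis by simp
  qed
  have "cosh (a - b) \<le> cosh e"
    using cosh_real_nonneg_le_iff[of "\<bar>a - b\<bar>" e] tri nn by auto
  then have "exp (a + b) * (2 * cosh (a - b)) \<le> exp (a + b) * (2 * cosh e)" by simp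
  then have "2 * y * D \<le> 2 * exp b * D" using c1 dEb yD by linarith
  then have y1: "y \<le> exp b" using D by simp
  have "cosh e \<le> cosh (a + b)"
    using tri nn a by (subst cosh_real_nonneg_le_iff) auto
  then have "exp (a - b) * (2 * cosh e) \<le> exp (a - b) * (2 * cosh (a + b))" by simp
  then have "2 * y * D \<ge> 2 * exp (- b) * D" using c2 dEm yD by linarith
  then have y2: "y \<ge> exp (- b)" using D by simp
  have "(y - exp b) * (y - exp (- b)) \<le> 0" using y1 y2 by (simp add: mult_nonpos_nonneg)
  then have u: "2 * y * cosh b - y\<^sup>2 - 1 \<ge> 0"
    by (simp add: cosh_field_def algebra_simps power2_eq_square exp_minus_inverse exp_minus)
  define q where "q = Complex (sqrt (2 * y * cosh b - y\<^sup>2 - 1)) y"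
  have i: "\<i> \<in> hyp_plane" and w: "Complex 0 (exp a) \<in> hyp_plane" and q: "q \<in> hyp_plane"
    using y by (auto simp: hyp_plane_def q_def)
  have n1: "(cmod (\<i> - q))\<^sup>2 = 2 * y * cosh b - 2 * y"
    using u by (simp add: cmod_power2 q_def power2_diff)
  have d1: "hyp_dist \<i> q = b"
    by (rule hyp_dist_eqI[OF i q nn(1)]) (unfold n1, use y in \<open>simp add: q_def field_simps\<close>)
  have yD': "y * exp a * cosh e * 2 - 2 * y * cosh b = exp (2 * a) - 1"
    using yD by (simp add: D_def algebra_simps)
  have n2: "(cmod (Complex 0 (exp a) - q))\<^sup>2 = 2 * y * exp a * cosh e - 2 * exp a * y"
  proof -
    have "(cmod (Complex 0 (exp a) - q))\<^sup>2 = 2 * y * cosh b - y\<^sup>2 - 1 + (exp a - y)\<^sup>2"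
      using u by (simp add: cmod_power2 q_def)
    also have "\<dots> = 2 * y * cosh b - 1 + exp (2 * a) - 2 * exp a * y"
      by (simp add: power2_diff exp_double)
    finally show ?thesis using yD' by (simp add: mult_ac)
  qed
  have d2: "hyp_dist (Complex 0 (exp a)) q = e"
    by (rule hyp_dist_eqI[OF w q nn(2)]) (unfold n2, use y in \<open>simp add: q_def field_simps\<close>)
  show ?thesis using that q d1 d2 by blast
qed

lemma hyp_dist_commute: "hyp_dist z w = hyp_dist w z"
  by (simp add: hyp_dist_def norm_minus_commute mult.commute mult.left_commute)

lemma hyp_dist_self: "hyp_dist z z = 0"
  by (simp add: hyp_dist_def)

text \<open>The function \<open>s \<mapsto> cosh d(i e\<^sup>s, q)\<close> is a combination of \<open>e\<^sup>s\<close> and \<open>e\<^sup>-\<^sup>s\<close>, hence is determined by its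
values at \<open>0\<close> and \<open>a\<close>.\<close>

lemma hyp_stewart:
  assumes "q \<in> hyp_plane"
  shows "sinh a * cosh (hyp_dist (Complex 0 (exp s)) q)
    = sinh (a - s) * cosh (hyp_dist \<i> q) + sinh s * cosh (hyp_dist (Complex 0 (exp a)) q)"
proof -
  have y: "Im q > 0" using assms by (simp add: hyp_plane_def)
  define A B where "A = ((Re q)\<^sup>2 + (Im q)\<^sup>2) / (2 * Im q)" and "B = 1 / (2 * Im q)"
  have f: "cosh (hyp_dist (Complex 0 (exp t)) q) = A * exp (- t) + B * exp t" for t
  proof -
    have "cosh (hyp_dist (Complex 0 (exp t)) q) = 1 + ((Re q)\<^sup>2 + (exp t - Im q)\<^sup>2) / (2 * exp t * Im q)"
      using assms by (subst cosh_hyp_dist) (auto simp: hyp_plane_def cmod_power2)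
    also have "\<dots> = A * exp (- t) + B * exp t"
      using y by (simp add: A_def B_def exp_minus field_simps power2_eq_square)
    finally show ?thesis .
  qed
  have "\<i> = Complex 0 (exp 0)" by (simp add: complex_eq_iff)
  then have f0: "cosh (hyp_dist \<i> q) = A + B" using f[of 0] by simp
  have "sinh a * (A * exp (- s) + B * exp s) = sinh (a - s) * (A + B) + sinh s * (A * exp (- a) + B * exp a)"
    by (simp add: sinh_field_def exp_diff exp_minus field_simps)
  then show ?thesis by (simp add: f f0)
qed

section \<open>Strong hyperbolicity of CAT(-1)-spaces\<close>

text \<open>The comparison of a vertex with the points of the opposite side.  This is the only form in which the
curvature condition is used.\<close>

lemma CAT_stewart:
  fixes x w q :: "'a::metric_space"
  assumes cat: "CAT_minus_one (UNIV :: 'a set) dist"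
    and c: "geodesic_segment UNIV dist c x w" and s: "0 \<le> s" "s \<le> dist x w"
  shows "sinh (dist x w) * cosh (dist q (c s))
    \<le> sinh (dist x w - s) * cosh (dist q x) + sinh s * cosh (dist q w)"
proof (cases "dist x w = 0")
  case True
  then show ?thesis using s by simp
next
  case False
  let ?a = "dist x w"
  have a: "?a > 0" using False by simp
  obtain q' where q': "q' \<in> hyp_plane" "hyp_dist \<i> q' = dist q x" "hyp_dist (Complex 0 (exp ?a)) q' = dist q w"
    by (rule hyp_plane_triangle_exists[OF a, of "dist q x" "dist q w"])
      (metis dist_commute dist_triangle add.commute zero_le_dist)+
  obtain c1 where c1: "geodesic_segment UNIV dist c1 w q"
    using cat unfolding CAT_minus_one_def geodesic_space_def by blast
  obtain c2 where c2: "geodesic_segment UNIV dist c2 q x"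
    using cat unfolding CAT_minus_one_def geodesic_space_def by blast
  have i: "\<i> \<in> hyp_plane" and wp: "Complex 0 (exp ?a) \<in> hyp_plane" by (auto simp: hyp_plane_def)
  have i0: "\<i> = Complex 0 (exp 0)" by (simp add: complex_eq_iff)
  have d01: "hyp_dist \<i> (Complex 0 (exp ?a)) = ?a"
    unfolding i0 using hyp_vertical_line[of 0 0 ?a] a by simp
  obtain e1 where e1: "geodesic_segment hyp_plane hyp_dist e1 (Complex 0 (exp ?a)) q'"
    using hyp_plane_geodesic[OF wp q'(1)] by blast
  obtain e2 where e2: "geodesic_segment hyp_plane hyp_dist e2 q' \<i>"
    using hyp_plane_geodesic[OF q'(1) i] by blast
  have e0: "geodesic_segment hyp_plane hyp_dist (\<lambda>t. Complex 0 (exp t)) \<i> (Complex 0 (exp ?a))"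
    unfolding geodesic_segment_def d01 by (auto simp: hyp_vertical_line hyp_plane_def complex_eq_iff)
  define v cc v' cc' where "v = (\<lambda>i::nat. if i = 0 then x else if i = 1 then w else q)"
    and "cc = (\<lambda>i::nat. if i = 0 then c else if i = 1 then c1 else c2)"
    and "v' = (\<lambda>i::nat. if i = 0 then \<i> else if i = 1 then Complex 0 (exp ?a) else q')"
    and "cc' = (\<lambda>i::nat. if i = 0 then (\<lambda>t. Complex 0 (exp t)) else if i = 1 then e1 else e2)"
  have less3: "(\<forall>i<3. P i) \<longleftrightarrow> P 0 \<and> P (1::nat) \<and> P 2" for P
    by (auto simp: numeral_3_eq_3 less_Suc_eq numeral_2_eq_2)
  have T: "geodesic_triangle UNIV dist v cc"
    unfolding geodesic_triangle_def less3 by (simp add: v_def cc_def c c1 c2)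
  have "geodesic_triangle hyp_plane hyp_dist v' cc'"
    unfolding geodesic_triangle_def less3 using i wp q' by (simp add: v'_def cc'_def e0 e1 e2)
  then have T': "comparison_triangle dist v v' cc'"
    unfolding comparison_triangle_def less3
    using d01 q' i wp by (simp add: v_def v'_def hyp_dist_self hyp_dist_commute dist_commute)
  have "\<forall>i<3. \<forall>j<3. \<forall>s\<in>{0..dist (v i) (v (Suc i mod 3))}. \<forall>t\<in>{0..dist (v j) (v (Suc j mod 3))}.
           dist (cc i s) (cc j t) \<le> hyp_dist (cc' i s) (cc' j t)"
    using cat T T' unfolding CAT_minus_one_def by blast
  from this[THEN spec[of _ 0]] have "\<forall>t\<in>{0..dist (v 2) (v (Suc 2 mod 3))}.
     dist (cc 0 s) (cc 2 t) \<le> hyp_dist (cc' 0 s) (cc' 2 t)"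
    using s by (force simp: v_def)
  moreover have "0 \<in> {0..dist (v 2) (v (Suc 2 mod 3))}" by simp
  ultimately have "dist (cc 0 s) (cc 2 0) \<le> hyp_dist (cc' 0 s) (cc' 2 0)" by blast
  moreover have "cc 2 0 = q" using c2 by (simp add: cc_def geodesic_segment_def)
  moreover have "cc' 2 0 = q'" using e2 by (simp add: cc'_def geodesic_segment_def)
  ultimately have "dist q (c s) \<le> hyp_dist (Complex 0 (exp s)) q'"
    by (simp add: cc_def cc'_def dist_commute)
  then have "cosh (dist q (c s)) \<le> cosh (hyp_dist (Complex 0 (exp s)) q')"
    by (meson cosh_real_nonneg_le_iff dual_order.trans zero_le_dist)
  then have "sinh ?a * cosh (dist q (c s)) \<le> sinh ?a * cosh (hyp_dist (Complex 0 (exp s)) q')"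
    using a by simp
  then show ?thesis
    using hyp_stewart[OF q'(1), of ?a s] q' by simp
qed

text \<open>A weighted form of Ptolemy's inequality.  For a point \<open>m\<close> at distance \<open>s\<close> from \<open>x\<close> on the segment from
\<open>x\<close> to \<open>w\<close>, the comparison inequality bounds \<open>exp d(y,m)\<close> and \<open>exp d(z,m)\<close>, and
\<open>d(y,z) \<le> d(y,m) + d(m,z)\<close> gives
\<open>exp (d(x,w) + d(y,z)) \<le> 4 (A + L B) (C + D / L)\<close> with \<open>L = exp (2 s - d(x,w))\<close>.  The right-hand side is
smallest for \<open>L\<^sup>2 = A D / (B C)\<close>, where it is the square of the claimed bound, and the triangle
inequality puts the corresponding \<open>s\<close> on the segment.\<close>

lemma CAT_four_point_cosh:
  fixes x y z w :: "'a::metric_space"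
  assumes cat: "CAT_minus_one (UNIV :: 'a set) dist"
  shows "exp ((dist x w + dist y z) / 2)
    \<le> sqrt (2 * cosh (dist x y) * (2 * cosh (dist z w))) + sqrt (2 * cosh (dist x z) * (2 * cosh (dist y w)))"
proof -
  let ?a = "dist x w"
  obtain c where c: "geodesic_segment UNIV dist c x w"
    using cat unfolding CAT_minus_one_def geodesic_space_def by blast
  define A B C D where "A = cosh (dist x y)" and "B = cosh (dist y w)"
    and "C = cosh (dist z w)" and "D = cosh (dist x z)"
  have pos: "A > 0" "B > 0" "C > 0" "D > 0" by (simp_all add: A_def B_def C_def D_def)
  have cosh_shift: "cosh (dist p q) \<le> exp (dist q r) * cosh (dist p r)" for p q r :: 'a
  proof -
    have "cosh (dist p q) \<le> cosh (dist q r + dist p r)"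
      by (subst cosh_real_nonneg_le_iff) (auto simp: dist_triangle2 add.commute)
    also have "\<dots> \<le> exp (dist q r) * cosh (dist p r)"
      by (simp add: cosh_add cosh_plus_sinh[symmetric] distrib_right mult_left_mono sinh_le_cosh_real)
    finally show ?thesis .
  qed
  define \<mu> where "\<mu> = (A * D) / (B * C)"
  have \<mu>: "\<mu> > 0" using pos by (simp add: \<mu>_def)
  have "A * D \<le> (exp ?a * B) * (exp ?a * C)"
    using cosh_shift[of y x w] cosh_shift[of z x w] pos
    by (intro mult_mono) (auto simp: A_def B_def C_def D_def dist_commute)
  then have \<mu>1: "\<mu> \<le> exp (2 * ?a)"
    using pos by (simp add: \<mu>_def field_simps exp_double power2_eq_square)
  have "B * C \<le> (exp ?a * A) * (exp ?a * D)"
    using cosh_shift[of y w x] cosh_shift[of z w x] pos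
    by (intro mult_mono) (auto simp: A_def B_def C_def D_def dist_commute)
  then have \<mu>2: "\<mu> \<ge> exp (- 2 * ?a)"
    using pos by (simp add: \<mu>_def field_simps exp_double power2_eq_square exp_minus)
  \<comment> \<open>The point of the segment that balances the two products below.\<close>
  define s where "s = ?a / 2 + ln \<mu> / 4"
  have "ln \<mu> \<le> 2 * ?a" using \<mu> \<mu>1 by (metis ln_exp ln_le_cancel_iff exp_gt_zero)
  moreover have "ln \<mu> \<ge> - 2 * ?a" using \<mu> \<mu>2 by (metis ln_exp ln_le_cancel_iff exp_gt_zero)
  ultimately have s: "0 \<le> s" "s \<le> ?a" by (auto simp: s_def)
  define L where "L = exp (2 * s - ?a)"
  have L0: "L > 0" by (simp add: L_def)
  have "L\<^sup>2 = exp (ln \<mu>)"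
    unfolding L_def s_def by (simp flip: exp_double)
  then have L2: "L\<^sup>2 = \<mu>" using \<mu> by simp
  have half: "exp (dist p (c s)) \<le> 2 * (exp (- s) * cosh (dist p x) + exp (s - ?a) * cosh (dist p w))" for p
  proof (cases "?a = 0")
    case True
    then have "s = 0" using s by simp
    then have "c s = x" using c by (simp add: geodesic_segment_def)
    have "exp (dist p x) \<le> 2 * cosh (dist p x)" by (simp add: cosh_field_def)
    also have "\<dots> \<le> 2 * (exp (- s) * cosh (dist p x) + exp (s - ?a) * cosh (dist p w))"
      by (simp add: True \<open>s = 0\<close>)
    finally show ?thesis by (simp only: \<open>c s = x\<close>)
  next
    case False
    then have a: "?a > 0" by simp
    have r: "sinh t \<le> exp (t - ?a) * sinh ?a" if "t \<le> ?a" for t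
    proof -
      have "exp (t - ?a) * (exp ?a - exp (- ?a)) = exp t - exp (t - 2 * ?a)"
        by (simp add: right_diff_distrib exp_add[symmetric])
      moreover have "exp (t - 2 * ?a) \<le> exp (- t)" using that by simp
      ultimately show ?thesis by (simp add: sinh_field_def)
    qed
    have "sinh ?a * cosh (dist p (c s)) \<le> sinh (?a - s) * cosh (dist p x) + sinh s * cosh (dist p w)"
      by (rule CAT_stewart[OF cat c s])
    also have "\<dots> \<le> (exp (- s) * sinh ?a) * cosh (dist p x) + (exp (s - ?a) * sinh ?a) * cosh (dist p w)"
      using r[of "?a - s"] r[of s] s by (intro add_mono mult_right_mono) auto
    also have "\<dots> = sinh ?a * (exp (- s) * cosh (dist p x) + exp (s - ?a) * cosh (dist p w))"
      by (simp add: algebra_simps)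
    finally have "cosh (dist p (c s)) \<le> exp (- s) * cosh (dist p x) + exp (s - ?a) * cosh (dist p w)"
      using a by simp
    then have "2 * cosh (dist p (c s)) \<le> 2 * (exp (- s) * cosh (dist p x) + exp (s - ?a) * cosh (dist p w))"
      by (rule mult_left_mono) simp
    moreover have "exp (dist p (c s)) \<le> 2 * cosh (dist p (c s))" by (simp add: cosh_field_def)
    ultimately show ?thesis by (rule order_trans[rotated])
  qed
  have geo: "L * (B * C) + A * D / L = 2 * sqrt (A * C * (B * D))"
  proof -
    have "L = sqrt \<mu>" using L2 L0 by (metis abs_of_pos real_sqrt_abs)
    have AD: "A * D = L\<^sup>2 * (B * C)" using pos by (simp add: L2 \<mu>_def)
    have "A * C * (B * D) = (A * D) * (B * C)" by simp
    also have "\<dots> = (L * (B * C))\<^sup>2" unfolding AD by (simp add: power2_eq_square)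
    finally have "sqrt (A * C * (B * D)) = L * (B * C)" using L0 pos by simp
    moreover have "A * D / L = L * (B * C)" unfolding AD using L0 by (simp add: power2_eq_square)
    ultimately show ?thesis by simp
  qed
  have "exp (?a + dist y z) \<le> exp (?a + (dist y (c s) + dist z (c s)))"
    by (simp add: dist_triangle2)
  also have "\<dots> = exp ((s + dist y (c s)) + ((?a - s) + dist z (c s)))"
    by (rule arg_cong[of _ _ exp]) simp
  also have "\<dots> = (exp s * exp (dist y (c s))) * (exp (?a - s) * exp (dist z (c s)))"
    by (simp only: exp_add)
  also have "\<dots> \<le> (exp s * (2 * (exp (- s) * A + exp (s - ?a) * B)))
      * (exp (?a - s) * (2 * (exp (- s) * D + exp (s - ?a) * C)))"
    using half[of y] half[of z]
    by (intro mult_mono) (auto simp: A_def B_def C_def D_def dist_commute intro!: mult_nonneg_nonneg add_nonneg_nonneg)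
  also have "exp s * (2 * (exp (- s) * A + exp (s - ?a) * B)) = 2 * (A + L * B)"
  proof -
    have "exp s * exp (- s) = 1" "exp s * exp (s - ?a) = L" by (simp_all add: L_def exp_add[symmetric])
    moreover have "exp s * (2 * (exp (- s) * A + exp (s - ?a) * B))
        = 2 * ((exp s * exp (- s)) * A + (exp s * exp (s - ?a)) * B)" by (simp only: algebra_simps)
    ultimately show ?thesis by simp
  qed
  also have "exp (?a - s) * (2 * (exp (- s) * D + exp (s - ?a) * C)) = 2 * (C + D / L)"
  proof -
    have "1 / L = exp (- (2 * s - ?a))" unfolding L_def exp_minus by (simp add: inverse_eq_divide)
    then have "exp (?a - s) * exp (- s) = 1 / L" "exp (?a - s) * exp (s - ?a) = 1"
      by (simp_all add: exp_add[symmetric])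
    moreover have "exp (?a - s) * (2 * (exp (- s) * D + exp (s - ?a) * C))
        = 2 * ((exp (?a - s) * exp (- s)) * D + (exp (?a - s) * exp (s - ?a)) * C)" by (simp only: algebra_simps)
    ultimately show ?thesis by (simp add: add.commute)
  qed
  also have "2 * (A + L * B) * (2 * (C + D / L)) = 4 * (A * C + B * D + L * (B * C) + A * D / L)"
    using L0 by (simp add: field_simps)
  also have "\<dots> = 4 * (A * C + B * D + 2 * sqrt (A * C * (B * D)))"
    using geo by simp
  also have "\<dots> = (sqrt (2 * A * (2 * C)) + sqrt (2 * D * (2 * B)))\<^sup>2"
  proof -
    have "sqrt (2 * A * (2 * C)) = 2 * sqrt (A * C)" "sqrt (2 * D * (2 * B)) = 2 * sqrt (B * D)"
      by (simp_all add: real_sqrt_mult mult_ac)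
    moreover have "sqrt (A * C * (B * D)) = sqrt (A * C) * sqrt (B * D)" by (simp add: real_sqrt_mult)
    ultimately show ?thesis using pos by (simp add: power2_sum power_mult_distrib)
  qed
  finally have "exp (?a + dist y z) \<le> (sqrt (2 * A * (2 * C)) + sqrt (2 * D * (2 * B)))\<^sup>2" .
  moreover have "exp (?a + dist y z) = (exp ((?a + dist y z) / 2))\<^sup>2" by (simp flip: exp_double)
  ultimately have "exp ((?a + dist y z) / 2) \<le> sqrt (2 * A * (2 * C)) + sqrt (2 * D * (2 * B))"
    using pos by (intro power2_le_imp_le[of "exp ((?a + dist y z) / 2)"]) auto
  then show ?thesis by (simp add: A_def B_def C_def D_def)
qed

text \<open>Replacing \<open>2 cosh\<close> by \<open>exp\<close> in the preceding inequality costs a factor \<open>1 + exp (-2 d)\<close>, and the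
triangle inequality absorbs the resulting extra terms into the second summand.\<close>

lemma CAT_strongly_hyperbolic:
  fixes x y z w :: "'a::metric_space"
  assumes cat: "CAT_minus_one (UNIV :: 'a set) dist"
  shows "exp ((dist x w + dist y z) / 2)
    \<le> exp ((dist x y + dist z w) / 2) + 3 * exp ((dist x z + dist y w) / 2)"
proof -
  let ?e1 = "exp ((dist x y + dist z w) / 2)" and ?e2 = "exp ((dist x z + dist y w) / 2)"
  have ch: "2 * cosh t = exp t * (1 + exp (- 2 * t))" for t :: real
    by (simp add: cosh_field_def distrib_left exp_add[symmetric])
  have sq: "sqrt (exp t) = exp (t / 2)" for t :: real
    by (rule real_sqrt_unique) (simp_all flip: exp_double)
  have key: "sqrt (2 * cosh s * (2 * cosh t)) \<le> exp ((s + t) / 2) * (1 + (exp (- 2 * s) + exp (- 2 * t)) / 2)"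
    for s t :: real
  proof -
    have "sqrt (2 * cosh s * (2 * cosh t)) = sqrt (exp (s + t) * ((1 + exp (- 2 * s)) * (1 + exp (- 2 * t))))"
      by (simp only: ch[of s] ch[of t] exp_add) (simp only: mult_ac)
    also have "\<dots> = exp ((s + t) / 2) * sqrt ((1 + exp (- 2 * s)) * (1 + exp (- 2 * t)))"
      by (simp add: real_sqrt_mult sq)
    also have "sqrt ((1 + exp (- 2 * s)) * (1 + exp (- 2 * t))) \<le> ((1 + exp (- 2 * s)) + (1 + exp (- 2 * t))) / 2"
      by (rule arith_geo_mean_sqrt) (auto intro: add_nonneg_nonneg)
    finally show ?thesis by (simp add: add_divide_distrib mult_left_mono)
  qed
  have "exp ((dist x w + dist y z) / 2)
      \<le> sqrt (2 * cosh (dist x y) * (2 * cosh (dist z w))) + sqrt (2 * cosh (dist x z) * (2 * cosh (dist y w)))"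
    by (rule CAT_four_point_cosh[OF cat])
  moreover have "sqrt (2 * cosh (dist x y) * (2 * cosh (dist z w))) \<le> ?e1 + ?e2"
  proof -
    have "dist z w \<le> dist x z + dist x y + dist y w"
      using dist_triangle[of z w x] dist_triangle[of x w y] by (simp add: dist_commute)
    then have "(dist x y + dist z w) / 2 - 2 * dist x y \<le> (dist x z + dist y w) / 2"
      using zero_le_dist[of x y] by argo
    then have e1: "exp ((dist x y + dist z w) / 2 - 2 * dist x y) \<le> ?e2" by simp
    have "dist x y \<le> dist x z + dist z w + dist y w"
      using dist_triangle[of x y z] dist_triangle[of z y w] by (simp add: dist_commute)
    then have "(dist x y + dist z w) / 2 - 2 * dist z w \<le> (dist x z + dist y w) / 2"
      using zero_le_dist[of z w] by argo
    then have e2: "exp ((dist x y + dist z w) / 2 - 2 * dist z w) \<le> ?e2" by simp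
    note key[of "dist x y" "dist z w"]
    also have "?e1 * (1 + (exp (- 2 * dist x y) + exp (- 2 * dist z w)) / 2)
      = ?e1 + (exp ((dist x y + dist z w) / 2 - 2 * dist x y) + exp ((dist x y + dist z w) / 2 - 2 * dist z w)) / 2"
      by (simp add: distrib_left exp_add[symmetric] add_divide_distrib)
    also have "\<dots> \<le> ?e1 + ?e2" using e1 e2 by argo
    finally show ?thesis .
  qed
  moreover have "sqrt (2 * cosh (dist x z) * (2 * cosh (dist y w))) \<le> 2 * ?e2"
  proof -
    have "exp (- 2 * dist x z) \<le> 1" "exp (- 2 * dist y w) \<le> 1" by simp_all
    then have "1 + (exp (- 2 * dist x z) + exp (- 2 * dist y w)) / 2 \<le> 2" by argo
    then have "?e2 * (1 + (exp (- 2 * dist x z) + exp (- 2 * dist y w)) / 2) \<le> ?e2 * 2"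
      by (intro mult_left_mono) auto
    with key[of "dist x z" "dist y w"] have "sqrt (2 * cosh (dist x z) * (2 * cosh (dist y w))) \<le> ?e2 * 2"
      by (rule order_trans)
    then show ?thesis by simp
  qed
  ultimately show ?thesis by linarith
qed

definition gromov_product :: "'a::metric_space \<Rightarrow> 'a \<Rightarrow> 'a \<Rightarrow> real" where
  "gromov_product o' x y = (dist o' x + dist o' y - dist x y) / 2"

lemma gromov_product_commute: "gromov_product p x y = gromov_product p y x"
  by (simp add: gromov_product_def dist_commute)

lemma gromov_product_nonneg: "gromov_product p x y \<ge> 0"
  unfolding gromov_product_def using dist_triangle[of x y p] by (simp add: dist_commute)

lemma gromov_product_le_dist: "gromov_product p x y \<le> dist p x"
  unfolding gromov_product_def using dist_triangle[of p y x] by (simp add: dist_commute)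

lemma gromov_product_swap: "gromov_product p x y = dist p x - gromov_product x p y"
  by (simp add: gromov_product_def dist_commute field_simps)

lemma gromov_product_base_change: "gromov_product p x y \<le> gromov_product q x y + dist p q"
  unfolding gromov_product_def using dist_triangle[of p x q] dist_triangle[of p y q]
  by (simp add: field_simps)

lemma gromov_product_perturb: "gromov_product p x y \<le> gromov_product p x' y + dist x x'"
  unfolding gromov_product_def using dist_triangle[of p x x'] dist_triangle[of x' y x]
  by (simp add: field_simps dist_commute)

lemma CAT_gromov_product:
  fixes x y z :: "'a::metric_space"
  assumes cat: "CAT_minus_one (UNIV :: 'a set) dist"
  shows "exp (- gromov_product p x z) \<le> exp (- gromov_product p x y) + 3 * exp (- gromov_product p y z)"
proof -
  let ?S = "(dist p x + dist p y + dist p z) / 2"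
  have *: "exp ((dist y p + dist x z) / 2) = exp ?S * exp (- gromov_product p x z)"
    "exp ((dist y x + dist z p) / 2) = exp ?S * exp (- gromov_product p x y)"
    "exp ((dist y z + dist x p) / 2) = exp ?S * exp (- gromov_product p y z)"
    by (simp_all add: exp_add[symmetric] gromov_product_def dist_commute field_simps)
  have "exp ?S * exp (- gromov_product p x z)
      \<le> exp ?S * (exp (- gromov_product p x y) + 3 * exp (- gromov_product p y z))"
    using CAT_strongly_hyperbolic[OF cat, of y p x z] unfolding * by (simp add: distrib_left mult_ac)
  then show ?thesis by simp
qed

section \<open>Cocompact discrete groups of isometries\<close>

locale geometric_action =
  fixes \<Gamma> :: "('a::metric_space \<Rightarrow> 'a) set"
  assumes cat: "CAT_minus_one (UNIV :: 'a set) dist"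
    and proper: "\<And>(x::'a) r. compact (cball x r)"
    and complete: "geodesically_complete (UNIV :: 'a set) dist"
    and discrete: "discrete_isometry_group \<Gamma>"
    and cocompact: "compact_space (quotient_space \<Gamma>)"
begin

abbreviation gp :: "'a \<Rightarrow> 'a \<Rightarrow> 'a \<Rightarrow> real" where "gp \<equiv> gromov_product"

abbreviation G :: "('a \<Rightarrow> 'a) monoid" where "G \<equiv> isometry_group\<lparr>carrier := \<Gamma>\<rparr>"

abbreviation iv :: "('a \<Rightarrow> 'a) \<Rightarrow> 'a \<Rightarrow> 'a" where "iv \<equiv> inv_into UNIV"

lemma subgroup_\<Gamma>: "subgroup \<Gamma> isometry_group"
  using discrete by (simp add: discrete_isometry_group_def)

lemma group_G: "group G"
  by (rule subgroup.subgroup_is_group[OF subgroup_\<Gamma> group_isometry_group])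

lemma isometry: "\<gamma> \<in> \<Gamma> \<Longrightarrow> dist (\<gamma> x) (\<gamma> y) = dist x y"
  using subgroup.subset[OF subgroup_\<Gamma>] by (auto simp: isometry_group_def)

lemma gp_isometry: "\<gamma> \<in> \<Gamma> \<Longrightarrow> gp (\<gamma> p) (\<gamma> x) (\<gamma> y) = gp p x y"
  by (simp add: gromov_product_def isometry)

lemma id_mem: "id \<in> \<Gamma>"
  using subgroup.one_closed[OF subgroup_\<Gamma>] by (simp add: isometry_group_def)

lemma comp_mem: "\<gamma> \<in> \<Gamma> \<Longrightarrow> \<delta> \<in> \<Gamma> \<Longrightarrow> \<gamma> \<circ> \<delta> \<in> \<Gamma>"
  using subgroup.m_closed[OF subgroup_\<Gamma>] by (auto simp: isometry_group_def)

lemma bij_mem: assumes "\<gamma> \<in> \<Gamma>" shows "bij \<gamma>"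
proof -
  have "inj \<gamma>" by (rule injI) (metis assms isometry dist_eq_0_iff)
  moreover have "surj \<gamma>" using subgroup.subset[OF subgroup_\<Gamma>] assms by (auto simp: isometry_group_def)
  ultimately show ?thesis by (simp add: bij_def)
qed

lemma inv_apply [simp]: "\<gamma> \<in> \<Gamma> \<Longrightarrow> iv \<gamma> (\<gamma> x) = x" "\<gamma> \<in> \<Gamma> \<Longrightarrow> \<gamma> (iv \<gamma> x) = x"
  using bij_mem by (auto simp: bij_is_inj surj_f_inv_f bij_is_surj)

lemma inv_mem: assumes "\<gamma> \<in> \<Gamma>" shows "iv \<gamma> \<in> \<Gamma>"
proof -
  let ?i = "inv\<^bsub>isometry_group\<^esub> \<gamma>"
  have c: "\<gamma> \<in> carrier isometry_group" using subgroup.subset[OF subgroup_\<Gamma>] assms by blast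
  have "?i \<otimes>\<^bsub>isometry_group\<^esub> \<gamma> = \<one>\<^bsub>isometry_group\<^esub>" by (rule group.l_inv[OF group_isometry_group c])
  then have "?i \<circ> \<gamma> = id" by (simp add: isometry_group_def)
  then have "?i y = iv \<gamma> y" for y
    using assms by (metis comp_apply id_apply inv_apply(2))
  then have "?i = iv \<gamma>" by blast
  then show ?thesis using subgroup.m_inv_closed[OF subgroup_\<Gamma> assms] by simp
qed

lemma iv_comp: "\<gamma> \<in> \<Gamma> \<Longrightarrow> \<delta> \<in> \<Gamma> \<Longrightarrow> iv (\<gamma> \<circ> \<delta>) = iv \<delta> \<circ> iv \<gamma>"
  using bij_mem by (simp add: o_inv_distrib)

lemma gp_exp: "exp (- gp p x z) \<le> exp (- gp p x y) + 3 * exp (- gp p y z)"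
  by (rule CAT_gromov_product[OF cat])

lemma gp_min: "min (gp p x y) (gp p y z) - ln 4 \<le> gp p x z"
proof -
  define m where "m = min (gp p x y) (gp p y z)"
  have "exp (- gp p x y) \<le> exp (- m)" "exp (- gp p y z) \<le> exp (- m)" by (auto simp: m_def)
  then have "exp (- gp p x z) \<le> 4 * exp (- m)" using gp_exp[of p x z y] by linarith
  also have "\<dots> = exp (ln 4 - m)" by (simp add: exp_diff exp_minus divide_inverse)
  finally show ?thesis unfolding m_def[symmetric] by simp
qed

text \<open>If \<open>z\<close> and \<open>y\<close> are in the same direction and \<open>x\<close> is in another direction than \<open>y\<close>, then \<open>x\<close> and \<open>z\<close> are in
different directions.\<close>

lemma gp_near:
  assumes "gp p x y \<le> C" "gp p z y \<ge> C + ln 6"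
  shows "gp p x z \<le> C + ln 2"
proof -
  have "3 * exp (- gp p z y) \<le> 3 * exp (- (C + ln 6))" using assms by simp
  also have "\<dots> = exp (- C) / 2" by (simp add: exp_diff)
  finally have "exp (- C) \<le> exp (- gp p x z) + exp (- C) / 2"
    using gp_exp[of p x y z] assms(1) by (smt (verit) exp_le_cancel_iff)
  then have "exp (- C) / 2 \<le> exp (- gp p x z)" by argo
  moreover have "exp (- C) / 2 = exp (- (C + ln 2))" by (simp add: exp_diff)
  ultimately have "exp (- (C + ln 2)) \<le> exp (- gp p x z)" by simp
  then show ?thesis by simp
qed

lemma finite_displacement: "finite {\<gamma>\<in>\<Gamma>. dist x (\<gamma> x) \<le> r}"
proof -
  have "finite {\<gamma>\<in>\<Gamma>. \<gamma> ` cball x r \<inter> cball x r \<noteq> {}}"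
    using discrete proper by (simp add: discrete_isometry_group_def properly_discontinuous_def)
  moreover have "\<gamma> x \<in> \<gamma> ` cball x r \<inter> cball x r" if "dist x (\<gamma> x) \<le> r" for \<gamma>
    using that zero_le_dist[of x "\<gamma> x"] by (intro IntI imageI) (auto simp del: zero_le_dist)
  then have "{\<gamma>\<in>\<Gamma>. dist x (\<gamma> x) \<le> r} \<subseteq> {\<gamma>\<in>\<Gamma>. \<gamma> ` cball x r \<inter> cball x r \<noteq> {}}" by blast
  ultimately show ?thesis by (rule finite_subset[rotated])
qed

lemma proj_Y_eq: "proj_Y \<Gamma> x = (\<lambda>\<gamma>. \<gamma> x) ` \<Gamma>"
  by (auto simp: proj_Y_def orbit_def)

text \<open>The images of the balls \<open>ball x n\<close> form an increasing open cover of the compact quotient.\<close>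

lemma orbit_cobounded: "\<exists>D\<ge>0. \<forall>z. \<exists>\<gamma>\<in>\<Gamma>. dist (\<gamma> x) z \<le> D"
proof -
  let ?U = "\<lambda>n::nat. proj_Y \<Gamma> ` ball x (real n)"
  have top: "topspace (quotient_space \<Gamma>) = range (proj_Y \<Gamma>)"
    using quotient_map_quotient_topology[of euclidean "proj_Y \<Gamma>"]
    by (auto simp: quotient_map_def quotient_space_def)
  have pre: "{y. proj_Y \<Gamma> y \<in> ?U n} = (\<Union>\<gamma>\<in>\<Gamma>. ball (\<gamma> x) (real n))" for n
  proof (intro equalityI subsetI)
    fix y assume "y \<in> {y. proj_Y \<Gamma> y \<in> ?U n}"
    then obtain z where z: "z \<in> ball x (real n)" "proj_Y \<Gamma> y = proj_Y \<Gamma> z" by blast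
    have "id y \<in> proj_Y \<Gamma> y" unfolding proj_Y_eq by (rule image_eqI[OF _ id_mem]) simp
    then have "y \<in> proj_Y \<Gamma> z" using z(2) by simp
    then obtain \<gamma> where \<gamma>: "\<gamma> \<in> \<Gamma>" "y = \<gamma> z" unfolding proj_Y_eq by auto
    then show "y \<in> (\<Union>\<gamma>\<in>\<Gamma>. ball (\<gamma> x) (real n))" using z(1) isometry[of \<gamma> x z] by (auto intro!: bexI[of _ \<gamma>])
  next
    fix y assume "y \<in> (\<Union>\<gamma>\<in>\<Gamma>. ball (\<gamma> x) (real n))"
    then obtain \<gamma> where \<gamma>: "\<gamma> \<in> \<Gamma>" "dist (\<gamma> x) y < real n" by auto
    then have "dist x (iv \<gamma> y) < real n" using isometry[OF \<gamma>(1), of x "iv \<gamma> y"] by simp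
    moreover have "proj_Y \<Gamma> (iv \<gamma> y) = proj_Y \<Gamma> y"
    proof -
      have "\<delta> (iv \<gamma> y) \<in> proj_Y \<Gamma> y" if "\<delta> \<in> \<Gamma>" for \<delta>
        unfolding proj_Y_eq by (rule image_eqI[OF _ comp_mem[OF that inv_mem[OF \<gamma>(1)]]]) simp
      moreover have "\<delta> y \<in> proj_Y \<Gamma> (iv \<gamma> y)" if "\<delta> \<in> \<Gamma>" for \<delta>
        unfolding proj_Y_eq by (rule image_eqI[OF _ comp_mem[OF that \<gamma>(1)]]) (simp add: \<gamma>(1))
      ultimately show ?thesis unfolding proj_Y_eq by blast
    qed
    ultimately have "proj_Y \<Gamma> y \<in> ?U n" by (intro image_eqI[of _ _ "iv \<gamma> y"]) auto
    then show "y \<in> {y. proj_Y \<Gamma> y \<in> ?U n}" by blast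
  qed
  have op: "openin (quotient_space \<Gamma>) (?U n)" for n
    unfolding quotient_space_def openin_quotient_topology using pre[of n] by auto
  have cover: "topspace (quotient_space \<Gamma>) \<subseteq> \<Union>(range ?U)"
  proof
    fix u assume "u \<in> topspace (quotient_space \<Gamma>)"
    then obtain y where y: "u = proj_Y \<Gamma> y" unfolding top by blast
    obtain n :: nat where "dist x y < real n" using reals_Archimedean2 by blast
    then have "u \<in> ?U n" unfolding y by simp
    then show "u \<in> \<Union>(range ?U)" by blast
  qed
  have "\<exists>F. finite F \<and> F \<subseteq> range ?U \<and> topspace (quotient_space \<Gamma>) \<subseteq> \<Union>F"
    by (rule cocompact[unfolded compact_space_alt, rule_format, of "range ?U"]) (use op cover in \<open>auto simp only:\<close>)
  then obtain F where F: "finite F" "F \<subseteq> range ?U" "topspace (quotient_space \<Gamma>) \<subseteq> \<Union>F"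
    by (elim exE conjE)
  obtain I where I: "finite I" "F = ?U ` I" using finite_subset_image[OF F(1,2)] by (elim exE conjE)
  define N where "N = Max (insert 0 I)"
  have "\<exists>\<gamma>\<in>\<Gamma>. dist (\<gamma> x) z \<le> real N" for z
  proof -
    have "proj_Y \<Gamma> z \<in> \<Union>F" by (rule subsetD[OF F(3)]) (simp add: top)
    then obtain n where n: "n \<in> I" "proj_Y \<Gamma> z \<in> ?U n" unfolding I(2) by (elim UnionE imageE) simp
    have "z \<in> {y. proj_Y \<Gamma> y \<in> ?U n}" using n(2) by simp
    then have "z \<in> (\<Union>\<gamma>\<in>\<Gamma>. ball (\<gamma> x) (real n))" unfolding pre .
    moreover have "n \<le> N" using n(1) I(1) by (simp add: N_def)
    ultimately obtain \<gamma> where "\<gamma> \<in> \<Gamma>" "dist (\<gamma> x) z < real n" "real n \<le> real N" by auto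
    then show ?thesis by (intro bexI[of _ \<gamma>]) linarith+
  qed
  then show ?thesis by (intro exI[of _ "real N"]) auto
qed

lemma line_through: "\<exists>g\<in>GX. g 0 = (x::'a)"
proof -
  have "geodesic_segment UNIV dist (\<lambda>_. x) x x" by (simp add: geodesic_segment_def)
  then show ?thesis using complete unfolding geodesically_complete_def by fastforce
qed

lemma GX_dist: "g \<in> GX \<Longrightarrow> dist (g s) (g t) = \<bar>s - t\<bar>"
  by (simp add: geodesic_lines_def)

section \<open>Existence of an axis\<close>

text \<open>If \<open>\<gamma>\<close> fixes \<open>p\<close>, both \<open>\<gamma> x\<close> and \<open>\<gamma>\<^sup>-\<^sup>1 x\<close> are as far from \<open>p\<close> as \<open>x\<close>, so both leave \<open>x\<close> in
the direction of \<open>p\<close>.\<close>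

lemma gp_fixed_point:
  assumes \<gamma>: "\<gamma> \<in> \<Gamma>" and p: "\<gamma> p = p"
  shows "dist x (\<gamma> x) / 2 - ln 4 \<le> gp x (\<gamma> x) (iv \<gamma> x)"
proof -
  have "dist p (\<gamma> x) = dist p x" using isometry[OF \<gamma>, of p x] p by simp
  moreover have "dist p (iv \<gamma> x) = dist p x" using isometry[OF \<gamma>, of p "iv \<gamma> x"] p \<gamma> by simp
  moreover have "dist x (iv \<gamma> x) = dist x (\<gamma> x)"
    using isometry[OF \<gamma>, of x "iv \<gamma> x"] \<gamma> by (simp add: dist_commute)
  ultimately have "gp x (\<gamma> x) p = dist x (\<gamma> x) / 2" "gp x p (iv \<gamma> x) = dist x (\<gamma> x) / 2"
    by (simp_all add: gromov_product_def dist_commute)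
  then show ?thesis using gp_min[of x "\<gamma> x" p "iv \<gamma> x"] by simp
qed

text \<open>Let \<open>\<alpha>\<close> and \<open>\<beta>\<close> move \<open>x\<close> far in two opposite directions of a line.  If \<open>\<alpha>\<close> and \<open>\<beta>\<close> both have fixed
points, then \<open>\<alpha>\<^sup>-\<^sup>1 x\<close> and \<open>\<beta>\<^sup>-\<^sup>1 x\<close> lie in the directions of \<open>\<alpha> x\<close> and \<open>\<beta> x\<close>.  So \<open>\<alpha> \<beta> x\<close> lies in
the direction of \<open>\<alpha> x\<close>, and \<open>(\<alpha> \<beta>)\<^sup>-\<^sup>1 x\<close> in the opposite direction of \<open>\<beta> x\<close>; hence \<open>\<alpha> \<beta>\<close> has no fixed
point.\<close>

lemma fixed_point_free_element: "\<exists>\<gamma>\<in>\<Gamma>. \<forall>p. \<gamma> p \<noteq> p"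
proof (rule ccontr)
  assume "\<not> ?thesis"
  then have hfix: "\<exists>p. \<gamma> p = p" if "\<gamma> \<in> \<Gamma>" for \<gamma> using that by blast
  obtain g x where g: "g \<in> GX" "g 0 = (x::'a)" using line_through by blast
  obtain D where D: "D \<ge> 0" "\<And>z. \<exists>\<gamma>\<in>\<Gamma>. dist (\<gamma> x) z \<le> D" using orbit_cobounded by blast
  define L where "L = ln (4::real)"
  have L: "L \<ge> 0" by (simp add: L_def)
  define T where "T = 20 * D + 20 * L + 1"
  obtain \<alpha> where \<alpha>: "\<alpha> \<in> \<Gamma>" "dist (\<alpha> x) (g T) \<le> D" using D(2) by blast
  obtain \<beta> where \<beta>: "\<beta> \<in> \<Gamma>" "dist (\<beta> x) (g (- T)) \<le> D" using D(2) by blast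
  have T0: "T \<ge> 0" using D L by (simp add: T_def)
  have gT: "dist x (g T) = T" "dist x (g (- T)) = T" "dist (g T) (g (- T)) = 2 * T"
    using GX_dist[OF g(1)] T0 unfolding g(2)[symmetric] by auto
  define a b where "a = dist x (\<alpha> x)" and "b = dist x (\<beta> x)"
  have a: "T - D \<le> a" "a \<le> T + D"
    using gT(1) \<alpha>(2) dist_triangle[of x "g T" "\<alpha> x"] dist_triangle[of x "\<alpha> x" "g T"]
    by (auto simp: a_def dist_commute)
  have b: "T - D \<le> b" "b \<le> T + D"
    using gT(2) \<beta>(2) dist_triangle[of x "g (- T)" "\<beta> x"] dist_triangle[of x "\<beta> x" "g (- T)"]
    by (auto simp: b_def dist_commute)
  have ab: "gp x (\<alpha> x) (\<beta> x) \<le> 2 * D"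
  proof -
    have "gp x (\<alpha> x) (\<beta> x) \<le> gp x (g T) (\<beta> x) + D"
      using gromov_product_perturb[of x "\<alpha> x" "\<beta> x" "g T"] \<alpha>(2) by linarith
    also have "gp x (g T) (\<beta> x) \<le> gp x (g T) (g (- T)) + D"
      using gromov_product_perturb[of x "\<beta> x" "g T" "g (- T)"] \<beta>(2)
      by (simp add: gromov_product_commute)
    also have "gp x (g T) (g (- T)) = 0" by (simp add: gromov_product_def gT)
    finally show ?thesis by simp
  qed
  have fa: "a / 2 - L \<le> gp x (\<alpha> x) (iv \<alpha> x)"
    using gp_fixed_point[OF \<alpha>(1)] hfix[OF \<alpha>(1)] unfolding a_def L_def by blast
  have fb: "b / 2 - L \<le> gp x (\<beta> x) (iv \<beta> x)"
    using gp_fixed_point[OF \<beta>(1)] hfix[OF \<beta>(1)] unfolding b_def L_def by blast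
  have c: "gp x (iv \<alpha> x) (\<beta> x) \<le> 2 * D + L"
    using gp_min[of x "\<alpha> x" "iv \<alpha> x" "\<beta> x"] fa ab a D L unfolding L_def[symmetric] T_def by linarith
  define e where "e = dist x (\<alpha> (\<beta> x))"
  have iax: "dist x (iv \<alpha> x) = a"
    using isometry[OF \<alpha>(1), of x "iv \<alpha> x"] \<alpha>(1) by (simp add: a_def dist_commute)
  have ibx: "dist x (iv \<beta> x) = b"
    using isometry[OF \<beta>(1), of x "iv \<beta> x"] \<beta>(1) by (simp add: b_def dist_commute)
  have e_eq: "e = dist (iv \<alpha> x) (\<beta> x)"
    using isometry[OF \<alpha>(1), of "iv \<alpha> x" "\<beta> x"] \<alpha>(1) by (simp add: e_def)
  have e: "e \<ge> a + b - 4 * D - 2 * L"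
    using c unfolding gromov_product_def e_eq iax b_def[symmetric] by argo
  let ?i = "iv \<beta> (iv \<alpha> x)"
  have inv_ab: "iv (\<alpha> \<circ> \<beta>) x = ?i"
    by (simp add: iv_comp \<alpha>(1) \<beta>(1))
  have ex: "dist x ?i = e"
    using isometry[OF \<beta>(1), of x ?i] \<beta>(1) by (simp add: e_eq dist_commute)
  have "\<alpha> \<circ> \<beta> \<in> \<Gamma>" using \<alpha>(1) \<beta>(1) by (rule comp_mem)
  then obtain p where "(\<alpha> \<circ> \<beta>) p = p" using hfix by blast
  from gp_fixed_point[OF \<open>\<alpha> \<circ> \<beta> \<in> \<Gamma>\<close> this]
  have "e / 2 - L \<le> gp x ((\<alpha> \<circ> \<beta>) x) (iv (\<alpha> \<circ> \<beta>) x)" unfolding e_def L_def comp_apply .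
  then have fe: "e / 2 - L \<le> gp x (\<alpha> (\<beta> x)) ?i" unfolding inv_ab by simp
  have "dist (\<alpha> x) (\<alpha> (\<beta> x)) = b" using isometry[OF \<alpha>(1)] by (simp add: b_def)
  then have h1: "gp x (\<alpha> x) (\<alpha> (\<beta> x)) = (a + e - b) / 2"
    by (simp add: gromov_product_def a_def e_def)
  have "dist ?i (iv \<beta> x) = a"
    using isometry[OF inv_mem[OF \<beta>(1)], of "iv \<alpha> x" x] iax by (simp add: dist_commute)
  then have h2: "gp x ?i (iv \<beta> x) = (e + b - a) / 2"
    by (simp add: gromov_product_def ex ibx)
  have gpL: "M - L \<le> gp x p r" if "M \<le> gp x p q" "M \<le> gp x q r" for M p q r
  proof -
    have "M \<le> min (gp x p q) (gp x q r)" using that by simp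
    then show ?thesis using gp_min[of x p q r] unfolding L_def by argo
  qed
  have eT: "e \<ge> 2 * T - 6 * D - 2 * L" using e a(1) b(1) by linarith
  have "T - 4 * D - 2 * L \<le> gp x (\<alpha> x) (\<alpha> (\<beta> x))" unfolding h1 using eT a b D(1) L by (simp add: field_simps)
  moreover have "T - 4 * D - 2 * L \<le> gp x (\<alpha> (\<beta> x)) ?i" using fe eT D(1) L by linarith
  ultimately have "T - 4 * D - 2 * L - L \<le> gp x (\<alpha> x) ?i" by (rule gpL)
  moreover have "T - 4 * D - 2 * L - L \<le> gp x ?i (iv \<beta> x)" unfolding h2 using eT a b D(1) L by (simp add: field_simps)
  ultimately have "T - 4 * D - 2 * L - L - L \<le> gp x (\<alpha> x) (iv \<beta> x)" by (rule gpL)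
  then have "3 * D + 2 * L + 1 / 4 \<le> gp x (\<alpha> x) (iv \<beta> x)" using D(1) L unfolding T_def by linarith
  moreover have "3 * D + 2 * L + 1 / 4 \<le> gp x (iv \<beta> x) (\<beta> x)"
    using fb b(1) D(1) L unfolding T_def gromov_product_commute[of x "iv \<beta> x"] by linarith
  ultimately have "3 * D + 2 * L + 1 / 4 - L \<le> gp x (\<alpha> x) (\<beta> x)" by (rule gpL)
  then show False using ab D(1) L by linarith
qed

text \<open>Every point can be moved into a fixed ball at the price of a conjugation, and only finitely many
conjugates of a fixed-point-free element have a small displacement in that ball.  So the infimum of the
displacement is a minimum over finitely many continuous functions on a compact set.\<close>

lemma minimal_displacement_element:
  "\<exists>a\<in>\<Gamma>. \<exists>x. dist x (a x) > 0 \<and> (\<forall>y. dist x (a x) \<le> dist y (a y))"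
proof -
  obtain a where a: "a \<in> \<Gamma>" "\<And>p. a p \<noteq> p" using fixed_point_free_element by blast
  define x0 :: 'a where "x0 = undefined"
  obtain D where D: "D \<ge> 0" "\<And>z. \<exists>\<gamma>\<in>\<Gamma>. dist (\<gamma> x0) z \<le> D" using orbit_cobounded by blast
  define r where "r = dist x0 (a x0)"
  define Conj where "Conj = {\<gamma> \<circ> a \<circ> iv \<gamma> | \<gamma>. \<gamma> \<in> \<Gamma>}"
  define F where "F = {b \<in> Conj. \<exists>y\<in>cball x0 D. dist y (b y) \<le> r}"
  have conjI: "\<gamma> \<circ> b \<circ> iv \<gamma> \<in> Conj" if \<gamma>: "\<gamma> \<in> \<Gamma>" and b: "b \<in> Conj" for \<gamma> b
  proof -
    obtain \<delta> where \<delta>: "\<delta> \<in> \<Gamma>" "b = \<delta> \<circ> a \<circ> iv \<delta>" using b unfolding Conj_def by blast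
    have "iv (\<gamma> \<circ> \<delta>) = iv \<delta> \<circ> iv \<gamma>" by (rule iv_comp[OF \<gamma> \<delta>(1)])
    then have "\<gamma> \<circ> b \<circ> iv \<gamma> = (\<gamma> \<circ> \<delta>) \<circ> a \<circ> iv (\<gamma> \<circ> \<delta>)" by (simp add: \<delta>(2) o_assoc)
    then show ?thesis unfolding Conj_def using comp_mem[OF \<gamma> \<delta>(1)] by blast
  qed
  have conj_mem: "b \<in> \<Gamma>" if "b \<in> Conj" for b
    using that a(1) by (auto simp: Conj_def intro!: comp_mem inv_mem)
  have conj_free: "b p \<noteq> p" if bC: "b \<in> Conj" for b p
  proof -
    obtain \<delta> where \<delta>: "\<delta> \<in> \<Gamma>" "b = \<delta> \<circ> a \<circ> iv \<delta>" using bC unfolding Conj_def by blast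
    then have "iv \<delta> (b p) = a (iv \<delta> p)" by simp
    then show ?thesis using a(2)[of "iv \<delta> p"] by auto
  qed
  have "finite {\<gamma>\<in>\<Gamma>. \<gamma> ` cball x0 (D + r) \<inter> cball x0 (D + r) \<noteq> {}}"
    using discrete proper by (simp add: discrete_isometry_group_def properly_discontinuous_def)
  moreover have "F \<subseteq> {\<gamma>\<in>\<Gamma>. \<gamma> ` cball x0 (D + r) \<inter> cball x0 (D + r) \<noteq> {}}"
  proof
    fix b assume "b \<in> F"
    then obtain y where y: "b \<in> Conj" "dist x0 y \<le> D" "dist y (b y) \<le> r" by (auto simp: F_def)
    have "0 \<le> r" using y(3) zero_le_dist order_trans by blast
    then have "y \<in> cball x0 (D + r)" "b y \<in> cball x0 (D + r)"
      using y dist_triangle[of x0 "b y" y] by auto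
    then show "b \<in> {\<gamma>\<in>\<Gamma>. \<gamma> ` cball x0 (D + r) \<inter> cball x0 (D + r) \<noteq> {}}"
      using conj_mem[OF y(1)] by blast
  qed
  ultimately have finF: "finite F" by (rule finite_subset[rotated])
  have "id \<circ> a \<circ> iv id \<in> Conj" unfolding Conj_def using id_mem by blast
  then have "a \<in> F" using D(1) by (auto simp: F_def r_def)
  have "\<exists>y\<in>cball x0 D. \<forall>z\<in>cball x0 D. dist y (b y) \<le> dist z (b z)" if "b \<in> F" for b
  proof (rule continuous_attains_inf)
    have "b \<in> \<Gamma>" using that conj_mem by (auto simp: F_def)
    then have "continuous_on UNIV b"
      unfolding continuous_on_iff using isometry by metis
    then show "continuous_on (cball x0 D) (\<lambda>y. dist y (b y))"
      by (intro continuous_intros) (auto intro: continuous_on_subset)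
  qed (use proper D in auto)
  then obtain Y where Y: "\<And>b. b \<in> F \<Longrightarrow> Y b \<in> cball x0 D"
    "\<And>b z. b \<in> F \<Longrightarrow> z \<in> cball x0 D \<Longrightarrow> dist (Y b) (b (Y b)) \<le> dist z (b z)"
    by metis
  define f where "f = (\<lambda>b. dist (Y b) (b (Y b)))"
  define b where "b = arg_min_on f F"
  have ne: "F \<noteq> {}" using \<open>a \<in> F\<close> by blast
  have b: "b \<in> F" unfolding b_def by (rule arg_min_if_finite(1)[OF finF ne])
  have b_least: "dist (Y b) (b (Y b)) \<le> dist (Y b') (b' (Y b'))" if "b' \<in> F" for b'
    using arg_min_least[OF finF ne that, of f] unfolding b_def[symmetric] by (simp add: f_def)
  have min: "dist (Y b) (b (Y b)) \<le> dist y (b y)" for y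
  proof -
    obtain \<gamma> where \<gamma>: "\<gamma> \<in> \<Gamma>" "dist (\<gamma> x0) y \<le> D" using D(2) by blast
    define b' where "b' = iv \<gamma> \<circ> b \<circ> iv (iv \<gamma>)"
    have b': "b' \<in> Conj" unfolding b'_def by (rule conjI) (use inv_mem[OF \<gamma>(1)] b F_def in auto)
    have "iv (iv \<gamma>) = \<gamma>" using bij_mem[OF \<gamma>(1)] by (rule inv_inv_eq)
    then have d: "dist (iv \<gamma> y) (b' (iv \<gamma> y)) = dist y (b y)"
      using \<gamma>(1) by (simp add: b'_def isometry[OF inv_mem])
    have in_ball: "iv \<gamma> y \<in> cball x0 D"
      using \<gamma> isometry[OF \<gamma>(1), of x0 "iv \<gamma> y"] by simp
    show ?thesis
    proof (cases "b' \<in> F")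
      case True
      then show ?thesis using b_least[OF True] Y(2)[OF True in_ball] d by linarith
    next
      case False
      then have "\<not> dist (iv \<gamma> y) (b' (iv \<gamma> y)) \<le> r" using b' in_ball unfolding F_def by blast
      then have "r < dist y (b y)" unfolding d by simp
      moreover have "dist (Y b) (b (Y b)) \<le> r"
        using b_least[OF \<open>a \<in> F\<close>] Y(2)[OF \<open>a \<in> F\<close>, of x0] D(1) by (simp add: r_def)
      ultimately show ?thesis by linarith
    qed
  qed
  have "b \<in> Conj" using b by (simp add: F_def)
  then show ?thesis using min conj_mem conj_free[of b "Y b"] by (intro bexI[of _ b] exI[of _ "Y b"]) auto
qed

text \<open>Three consecutive points at mutual distances \<open>t\<close>, \<open>t\<close>, \<open>2 t\<close> are collinear; overlapping
  collinear triples force the whole sequence to lie on a geodesic, because \<open>cosh\<close> of the distance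
  to the first point grows at least as fast along it as in the model case.\<close>

lemma local_geodesic_sequence:
  assumes t: "t > 0" and 1: "\<And>k. dist (h k) (h (Suc k)) = t" and 2: "\<And>k. dist (h k) (h (Suc (Suc k))) = 2 * t"
  shows "dist (h 0 :: 'a) (h k) = real k * t"
proof (induction k rule: less_induct)
  case (less k)
  consider "k = 0" | "k = 1" | m where "k = Suc (Suc m)" by (metis One_nat_def not0_implies_Suc)
  then show ?case
  proof cases
    case (3 m)
    obtain c where c: "geodesic_segment UNIV dist c (h m) (h k)"
      using cat unfolding CAT_minus_one_def geodesic_space_def by blast
    have d: "dist (h m) (h k) = 2 * t" using 2 3 by simp
    have ct: "c 0 = h m" "c (2 * t) = h k" "\<And>p q. p \<in> {0..2 * t} \<Longrightarrow> q \<in> {0..2 * t} \<Longrightarrow> dist (c p) (c q) = \<bar>p - q\<bar>"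
      using c unfolding geodesic_segment_def d by auto
    have st: "sinh (2 * t) * cosh (dist q (c t)) \<le> sinh t * (cosh (dist q (h m)) + cosh (dist q (h k)))" for q
      using CAT_stewart[OF cat c, of t q] t by (simp add: d algebra_simps)
    have s2: "sinh (2 * t) = sinh t * (2 * cosh t)" by (simp add: sinh_double)
    have st': "2 * cosh t * cosh (dist q (c t)) \<le> cosh (dist q (h m)) + cosh (dist q (h k))" for q
      using st[of q] t by (simp add: s2 mult.assoc)
    have "dist (h (Suc m)) (h m) = t" "dist (h (Suc m)) (h k) = t" using 1 3 by (simp_all add: dist_commute)
    then have "2 * cosh t * cosh (dist (h (Suc m)) (c t)) \<le> 2 * cosh t"
      using st'[of "h (Suc m)"] by simp
    then have "cosh (dist (h (Suc m)) (c t)) \<le> 1" by simp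
    then have "cosh (dist (h (Suc m)) (c t)) = 1" using cosh_real_ge_1 by (metis order_antisym)
    then have mid: "c t = h (Suc m)" by simp
    have IH: "dist (h 0) (h m) = real m * t" "dist (h 0) (h (Suc m)) = real (Suc m) * t"
      using less 3 by auto
    have "cosh (real m * t) + cosh (real k * t) = 2 * cosh t * cosh (real (Suc m) * t)"
    proof -
      have "real m * t = real (Suc m) * t - t" "real k * t = real (Suc m) * t + t"
        using 3 by (simp_all add: algebra_simps)
      then show ?thesis by (simp only: cosh_add cosh_diff) simp
    qed
    then have "cosh (real k * t) \<le> cosh (dist (h 0) (h k))"
      using st'[of "h 0"] unfolding mid IH by argo
    then have "real k * t \<le> dist (h 0) (h k)"
      using t by (subst (asm) cosh_real_nonneg_le_iff) auto
    moreover have "dist (h 0) (h k) \<le> dist (h 0) (h (Suc m)) + dist (h (Suc m)) (h k)" by (rule dist_triangle)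
    then have "dist (h 0) (h k) \<le> real k * t" using IH(2) 1[of "Suc m"] 3 by (simp add: algebra_simps)
    ultimately show ?thesis by simp
  qed (use 1 in auto)
qed

text \<open>The midpoint \<open>m\<close> of \<open>x\<close> and \<open>a x\<close> is also moved by at least \<open>d(x, a x)\<close>, so \<open>m\<close>, \<open>a x\<close>, \<open>a m\<close> are
collinear.  Hence the sequence \<open>x\<close>, \<open>m\<close>, \<open>a x\<close>, \<open>a m\<close>, \<dots> consists of overlapping collinear triples.\<close>

lemma axis_of_minimal_displacement:
  assumes a: "a \<in> \<Gamma>" and pos: "dist x (a x) > 0" and min: "\<And>y. dist x (a x) \<le> dist y (a y)"
  shows "dist x ((a ^^ n) x) = real n * dist x (a x)"
proof -
  define l where "l = dist x (a x)"
  obtain c where c: "geodesic_segment UNIV dist c x (a x)"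
    using cat unfolding CAT_minus_one_def geodesic_space_def by blast
  have cp: "c 0 = x" "c l = a x" "\<And>p q. p \<in> {0..l} \<Longrightarrow> q \<in> {0..l} \<Longrightarrow> dist (c p) (c q) = \<bar>p - q\<bar>"
    using c unfolding geodesic_segment_def l_def by auto
  define m where "m = c (l / 2)"
  have l: "l > 0" using pos by (simp add: l_def)
  have m: "dist x m = l / 2" "dist m (a x) = l / 2"
    using cp(3)[of 0 "l / 2"] cp(3)[of "l / 2" l] l unfolding cp(1,2) m_def by auto
  have "dist (a x) (a m) = l / 2" using m isometry[OF a] by simp
  then have am: "dist m (a m) = l"
    using min[of m] dist_triangle[of m "a m" "a x"] m unfolding l_def[symmetric] by simp
  have pow: "a ^^ k \<in> \<Gamma>" for k
    by (induction k) (use id_mem comp_mem[OF a] in \<open>auto simp: id_def comp_def\<close>)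
  define h where "h = (\<lambda>k. (a ^^ (k div 2)) (if even k then x else m))"
  have h_even: "h (2 * k) = (a ^^ k) x" and h_odd: "h (Suc (2 * k)) = (a ^^ k) m" for k
    by (simp_all add: h_def)
  have sh: "dist ((a ^^ k) p) ((a ^^ k) q) = dist p q" for k p q by (rule isometry[OF pow])
  have S: "(a ^^ Suc k) p = (a ^^ k) (a p)" for k p by (simp add: funpow_swap1)
  have 1: "dist (h k) (h (Suc k)) = l / 2" and 2: "dist (h k) (h (Suc (Suc k))) = 2 * (l / 2)" for k
  proof -
    obtain j where "k = 2 * j \<or> k = Suc (2 * j)" by (metis oddE evenE Suc_eq_plus1)
    then have "dist (h k) (h (Suc k)) = l / 2 \<and> dist (h k) (h (Suc (Suc k))) = 2 * (l / 2)"
    proof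
      assume k: "k = 2 * j"
      have "h k = (a ^^ j) x" "h (Suc k) = (a ^^ j) m" "h (Suc (Suc k)) = (a ^^ j) (a x)"
        using h_even[of j] h_odd[of j] h_even[of "Suc j"] S[of j x] unfolding k by simp_all
      then show ?thesis using m by (simp add: sh l_def)
    next
      assume k: "k = Suc (2 * j)"
      have "h k = (a ^^ j) m" "h (Suc k) = (a ^^ j) (a x)" "h (Suc (Suc k)) = (a ^^ j) (a m)"
        using h_even[of "Suc j"] h_odd[of j] h_odd[of "Suc j"] S[of j x] S[of j m] unfolding k by simp_all
      then show ?thesis using m am by (simp add: sh)
    qed
    then show "dist (h k) (h (Suc k)) = l / 2" "dist (h k) (h (Suc (Suc k))) = 2 * (l / 2)" by auto
  qed
  have "dist (h 0) (h (2 * n)) = real (2 * n) * (l / 2)"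
    by (rule local_geodesic_sequence) (use l 1 2 in auto)
  then show ?thesis using h_even[of 0] h_even[of n] by (simp add: l_def)
qed

theorem axis_exists:
  "\<exists>\<alpha> x l. l > 0 \<and> (\<forall>n::int. \<alpha> n \<in> \<Gamma>) \<and> (\<forall>m n. \<alpha> (m + n) = \<alpha> m \<circ> \<alpha> n) \<and>
     (\<forall>m n. dist (\<alpha> m x) (\<alpha> n x) = l * \<bar>of_int (m - n)\<bar>)"
proof -
  obtain a x where a: "a \<in> \<Gamma>" and pos: "dist x (a x) > 0" and min: "\<And>y. dist x (a x) \<le> dist y (a y)"
    using minimal_displacement_element by blast
  define \<alpha> where "\<alpha> = (\<lambda>n::int. a [^]\<^bsub>G\<^esub> n)"
  have carr: "a \<in> carrier G" using a by simp
  have mem: "\<alpha> n \<in> \<Gamma>" for n using group.int_pow_closed[OF group_G carr] by (simp add: \<alpha>_def)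
  have mult: "p \<otimes>\<^bsub>isometry_group\<^esub> q = p \<circ> q" for p q :: "'a \<Rightarrow> 'a" by (simp add: isometry_group_def)
  have one: "\<one>\<^bsub>G\<^esub> = id" by (simp add: isometry_group_def)
  have add: "\<alpha> (m + n) = \<alpha> m \<circ> \<alpha> n" for m n
    using group.int_pow_mult[OF group_G carr] by (simp add: \<alpha>_def mult)
  have nat: "\<alpha> (int n) = a ^^ n" for n
  proof (induction n)
    case 0 show ?case by (simp add: \<alpha>_def one)
  next
    case (Suc n)
    have "\<alpha> (int (Suc n)) = \<alpha> 1 \<circ> \<alpha> (int n)" using add[of 1 "int n"] by simp
    moreover have "\<alpha> 1 = a" using group.int_pow_1[OF group_G carr] by (simp add: \<alpha>_def)
    ultimately show ?case using Suc by simp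
  qed
  have le: "dist (\<alpha> m x) (\<alpha> n x) = dist x (a x) * of_int (n - m)" if "m \<le> n" for m n
  proof -
    have "\<alpha> n x = \<alpha> m (\<alpha> (int (nat (n - m))) x)" using add[of m "n - m"] that by simp
    then have "dist (\<alpha> m x) (\<alpha> n x) = dist x (\<alpha> (int (nat (n - m))) x)"
      using isometry[OF mem[of m]] by metis
    then show ?thesis
      unfolding nat using axis_of_minimal_displacement[OF a pos min, of "nat (n - m)"] that by simp
  qed
  have "dist (\<alpha> m x) (\<alpha> n x) = dist x (a x) * \<bar>of_int (m - n)\<bar>" for m n
    using le[of m n] le[of n m] by (cases "m \<le> n") (auto simp: dist_commute)
  then show ?thesis using pos mem add by blast
qed

end

section \<open>Sequences and ends of a Cayley graph\<close>

text \<open>The edge relation whose reflexive transitive closure has the components of the complement of \<open>F\<close> as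
its classes.\<close>

definition cayley_edges_off :: "('a, 'b) monoid_scheme \<Rightarrow> 'a set \<Rightarrow> 'a set \<Rightarrow> ('a \<times> 'a) set" where
  "cayley_edges_off G S F = cayley_edges G S \<inter> (carrier G - F) \<times> (carrier G - F)"

lemma sym_cayley_edges_off: "sym ((cayley_edges_off G S F)\<^sup>*)"
  by (rule sym_rtrancl) (auto simp: sym_def cayley_edges_off_def cayley_edges_def)

text \<open>Left translation maps a fixed path from \<open>\<one>\<close> to \<open>h\<close> to a path from \<open>g\<close> to \<open>g h\<close>; the finite set \<open>H\<close> collects
the vertices of the fixed path.\<close>

lemma cayley_path_off:
  assumes "group G" and S: "S \<subseteq> carrier G" and h: "h \<in> generate G S"
  shows "\<exists>H. finite H \<and> H \<subseteq> carrier G \<and> (\<forall>g\<in>carrier G. \<forall>F. (\<forall>k\<in>H. g \<otimes>\<^bsub>G\<^esub> k \<notin> F) \<longrightarrow>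
      (g, g \<otimes>\<^bsub>G\<^esub> h) \<in> (cayley_edges_off G S F)\<^sup>*)"
proof -
  interpret group G by fact
  let ?P = "\<lambda>h H. \<forall>g\<in>carrier G. \<forall>F. (\<forall>k\<in>H. g \<otimes>\<^bsub>G\<^esub> k \<notin> F) \<longrightarrow>
      (g, g \<otimes>\<^bsub>G\<^esub> h) \<in> (cayley_edges_off G S F)\<^sup>*"
  from h show ?thesis
  proof (induction rule: generate.induct)
    case one
    then show ?case by (intro exI[of _ "{}"]) simp
  next
    case (incl s)
    then have s: "s \<in> carrier G" using S by blast
    have "?P s {\<one>\<^bsub>G\<^esub>, s}"
    proof (intro ballI allI impI)
      fix g F assume g: "g \<in> carrier G" and F: "\<forall>k\<in>{\<one>\<^bsub>G\<^esub>, s}. g \<otimes>\<^bsub>G\<^esub> k \<notin> F"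
      then have "(g, g \<otimes>\<^bsub>G\<^esub> s) \<in> cayley_edges_off G S F"
        using s incl by (auto simp: cayley_edges_off_def cayley_edges_def)
      then show "(g, g \<otimes>\<^bsub>G\<^esub> s) \<in> (cayley_edges_off G S F)\<^sup>*" by blast
    qed
    then show ?case using s by (intro exI[of _ "{\<one>\<^bsub>G\<^esub>, s}"]) simp
  next
    case (inv s)
    then have s: "s \<in> carrier G" using S by blast
    have "?P (inv\<^bsub>G\<^esub> s) {\<one>\<^bsub>G\<^esub>, inv\<^bsub>G\<^esub> s}"
    proof (intro ballI allI impI)
      fix g F assume g: "g \<in> carrier G" and F: "\<forall>k\<in>{\<one>\<^bsub>G\<^esub>, inv\<^bsub>G\<^esub> s}. g \<otimes>\<^bsub>G\<^esub> k \<notin> F"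
      have "g = (g \<otimes>\<^bsub>G\<^esub> inv\<^bsub>G\<^esub> s) \<otimes>\<^bsub>G\<^esub> s" using g s by (simp add: m_assoc)
      then have "\<exists>s'\<in>S. g = (g \<otimes>\<^bsub>G\<^esub> inv\<^bsub>G\<^esub> s) \<otimes>\<^bsub>G\<^esub> s'" using inv by blast
      then have "(g, g \<otimes>\<^bsub>G\<^esub> inv\<^bsub>G\<^esub> s) \<in> cayley_edges_off G S F"
        using s g F by (simp add: cayley_edges_off_def cayley_edges_def) blast
      then show "(g, g \<otimes>\<^bsub>G\<^esub> inv\<^bsub>G\<^esub> s) \<in> (cayley_edges_off G S F)\<^sup>*" by blast
    qed
    then show ?case using s by (intro exI[of _ "{\<one>\<^bsub>G\<^esub>, inv\<^bsub>G\<^esub> s}"]) simp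
  next
    case (eng h1 h2)
    then obtain H1 H2 where H: "finite H1" "H1 \<subseteq> carrier G" "?P h1 H1" "finite H2" "H2 \<subseteq> carrier G" "?P h2 H2"
      by blast
    have h: "h1 \<in> carrier G" "h2 \<in> carrier G" using eng generate_in_carrier[OF S] by auto
    have "?P (h1 \<otimes>\<^bsub>G\<^esub> h2) (H1 \<union> (\<lambda>k. h1 \<otimes>\<^bsub>G\<^esub> k) ` H2)"
    proof (intro ballI allI impI)
      fix g F assume g: "g \<in> carrier G" and F: "\<forall>k\<in>H1 \<union> (\<lambda>k. h1 \<otimes>\<^bsub>G\<^esub> k) ` H2. g \<otimes>\<^bsub>G\<^esub> k \<notin> F"
      have "(g, g \<otimes>\<^bsub>G\<^esub> h1) \<in> (cayley_edges_off G S F)\<^sup>*" using H(3) g F by simp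
      also have "(g \<otimes>\<^bsub>G\<^esub> h1, (g \<otimes>\<^bsub>G\<^esub> h1) \<otimes>\<^bsub>G\<^esub> h2) \<in> (cayley_edges_off G S F)\<^sup>*"
      proof -
        have "(g \<otimes>\<^bsub>G\<^esub> h1) \<otimes>\<^bsub>G\<^esub> k \<notin> F" if "k \<in> H2" for k
        proof -
          have "(g \<otimes>\<^bsub>G\<^esub> h1) \<otimes>\<^bsub>G\<^esub> k = g \<otimes>\<^bsub>G\<^esub> (h1 \<otimes>\<^bsub>G\<^esub> k)" using H(5) that g h by (auto simp: m_assoc)
          then show ?thesis using F that by simp
        qed
        then show ?thesis using H(6) g h by simp
      qed
      finally show "(g, g \<otimes>\<^bsub>G\<^esub> (h1 \<otimes>\<^bsub>G\<^esub> h2)) \<in> (cayley_edges_off G S F)\<^sup>*" using g h by (simp add: m_assoc)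
    qed
    then show ?case using H h by (intro exI[of _ "H1 \<union> (\<lambda>k. h1 \<otimes>\<^bsub>G\<^esub> k) ` H2"]) auto
  qed
qed

text \<open>The end to which a sequence converges: for each finite \<open>F\<close>, the component that contains almost all of
its terms.\<close>

definition end_of_sequence :: "('a, 'b) monoid_scheme \<Rightarrow> 'a set \<Rightarrow> (nat \<Rightarrow> 'a) \<Rightarrow> 'a set \<Rightarrow> 'a set" where
  "end_of_sequence G S s = (\<lambda>F\<in>{F. finite F \<and> F \<subseteq> carrier G}.
     {g \<in> carrier G - F. \<exists>N. \<forall>n\<ge>N. (s n, g) \<in> (cayley_edges_off G S F)\<^sup>*})"

text \<open>Consecutive terms are joined by translates of one finite path, and since the sequence is injective,
almost all of these translates avoid \<open>F\<close>.\<close>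

lemma tail_in_one_component:
  assumes "group G" and S: "S \<subseteq> carrier G" "generate G S = carrier G"
    and s: "\<And>n. s n \<in> carrier G" "inj s" and h: "h \<in> carrier G" "\<And>n. s (Suc n) = s n \<otimes>\<^bsub>G\<^esub> h"
    and F: "finite F"
  shows "\<exists>N. (\<forall>n\<ge>N. s n \<in> carrier G - F) \<and> (\<forall>n\<ge>N. (s N, s n) \<in> (cayley_edges_off G S F)\<^sup>*)"
proof -
  interpret group G by fact
  have "h \<in> generate G S" using h(1) S(2) by simp
  then obtain H where H: "finite H" "H \<subseteq> carrier G" "\<And>g F. g \<in> carrier G \<Longrightarrow> (\<forall>k\<in>H. g \<otimes>\<^bsub>G\<^esub> k \<notin> F) \<Longrightarrow>
      (g, g \<otimes>\<^bsub>G\<^esub> h) \<in> (cayley_edges_off G S F)\<^sup>*"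
    using cayley_path_off[OF assms(1) S(1)] by meson
  have "finite {n. s n \<otimes>\<^bsub>G\<^esub> k \<in> F}" if "k \<in> carrier G" for k
  proof -
    have "inj (\<lambda>n. s n \<otimes>\<^bsub>G\<^esub> k)" using s that by (auto simp: inj_def)
    from finite_vimageI[OF F this] show ?thesis by (simp add: vimage_def)
  qed
  then have "finite (\<Union>k\<in>insert \<one>\<^bsub>G\<^esub> H. {n. s n \<otimes>\<^bsub>G\<^esub> k \<in> F})"
    using H(1,2) by (intro finite_UN_I) auto
  then obtain N where "\<And>n. n \<in> (\<Union>k\<in>insert \<one>\<^bsub>G\<^esub> H. {n. s n \<otimes>\<^bsub>G\<^esub> k \<in> F}) \<Longrightarrow> n < N"
    by (meson finite_nat_set_iff_bounded)
  then have N: "s n \<otimes>\<^bsub>G\<^esub> k \<notin> F" if "n \<ge> N" "k \<in> insert \<one>\<^bsub>G\<^esub> H" for n k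
    using that by (metis (mono_tags, lifting) UN_I leD mem_Collect_eq)
  have out: "s n \<in> carrier G - F" if "n \<ge> N" for n using N[OF that, of "\<one>\<^bsub>G\<^esub>"] s(1)[of n] by simp
  have "(s N, s n) \<in> (cayley_edges_off G S F)\<^sup>*" if "n \<ge> N" for n
    using that
  proof (induction n rule: dec_induct)
    case (step n)
    have "(s n, s (Suc n)) \<in> (cayley_edges_off G S F)\<^sup>*"
      unfolding h(2) using H(3)[OF s(1)] N[OF step(1)] by blast
    then show ?case using step.IH by (rule rtrancl_trans[rotated])
  qed simp
  then show ?thesis using out by blast
qed

lemma end_of_sequence_in_ends:
  assumes "group G" and S: "S \<subseteq> carrier G" "generate G S = carrier G"
    and s: "\<And>n. s n \<in> carrier G" "inj s" and h: "h \<in> carrier G" "\<And>n. s (Suc n) = s n \<otimes>\<^bsub>G\<^esub> h"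
  shows "end_of_sequence G S s \<in> ends G S"
proof -
  let ?e = "end_of_sequence G S s"
  have "?e F \<in> cayley_components G S F \<and> infinite (?e F)" if F: "finite F" "F \<subseteq> carrier G" for F
  proof -
    obtain N where N: "\<And>n. n \<ge> N \<Longrightarrow> s n \<in> carrier G - F"
      "\<And>n. n \<ge> N \<Longrightarrow> (s N, s n) \<in> (cayley_edges_off G S F)\<^sup>*"
      using tail_in_one_component[OF assms F(1)] by blast
    have e: "?e F = {g \<in> carrier G - F. \<exists>N. \<forall>n\<ge>N. (s n, g) \<in> (cayley_edges_off G S F)\<^sup>*}"
      using F by (simp add: end_of_sequence_def)
    have stay: "g \<in> carrier G - F" if "(s N, g) \<in> (cayley_edges_off G S F)\<^sup>*" for g
      using that by (induction rule: rtrancl_induct) (use N(1)[of N] in \<open>auto simp: cayley_edges_off_def\<close>)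
    have eq: "?e F = (cayley_edges_off G S F)\<^sup>* `` {s N}"
    proof (intro equalityI subsetI)
      fix g assume "g \<in> ?e F"
      then obtain M where M: "\<And>n. n \<ge> M \<Longrightarrow> (s n, g) \<in> (cayley_edges_off G S F)\<^sup>*" unfolding e by blast
      have "(s N, s (max M N)) \<in> (cayley_edges_off G S F)\<^sup>*" using N(2) by simp
      also have "(s (max M N), g) \<in> (cayley_edges_off G S F)\<^sup>*" using M by simp
      finally show "g \<in> (cayley_edges_off G S F)\<^sup>* `` {s N}" by simp
    next
      fix g assume "g \<in> (cayley_edges_off G S F)\<^sup>* `` {s N}"
      then have g: "(s N, g) \<in> (cayley_edges_off G S F)\<^sup>*" by simp
      have "(s n, g) \<in> (cayley_edges_off G S F)\<^sup>*" if "n \<ge> N" for n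
        using symD[OF sym_cayley_edges_off N(2)[OF that]] g by (rule rtrancl_trans)
      then show "g \<in> ?e F" unfolding e using stay[OF g] by blast
    qed
    have "?e F \<in> cayley_components G S F"
      unfolding eq cayley_components_def cayley_edges_off_def by (rule quotientI) (use N(1)[of N] in simp)
    moreover have "s ` {N..} \<subseteq> ?e F" unfolding eq using N(2) by auto
    then have "infinite (?e F)"
      using finite_subset finite_imageD[OF _ inj_on_subset[OF s(2) subset_UNIV], of "{N..}"] infinite_Ici by blast
    ultimately show ?thesis by blast
  qed
  moreover have "?e F' \<subseteq> ?e F" if F': "finite F'" "F' \<subseteq> carrier G" "F \<subseteq> F'" for F F'
  proof -
    have F: "finite F" "F \<subseteq> carrier G" using F' finite_subset by blast+
    have "cayley_edges_off G S F' \<subseteq> cayley_edges_off G S F" using F'(3) by (auto simp: cayley_edges_off_def)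
    then have "(cayley_edges_off G S F')\<^sup>* \<subseteq> (cayley_edges_off G S F)\<^sup>*" by (rule rtrancl_mono)
    then show ?thesis using F F' unfolding end_of_sequence_def by auto blast
  qed
  moreover have "?e \<in> extensional {F. finite F \<and> F \<subseteq> carrier G}" by (simp add: end_of_sequence_def)
  ultimately show ?thesis unfolding ends_def by blast
qed

lemma one_end_connects:
  assumes "group G" and S: "S \<subseteq> carrier G" "generate G S = carrier G" "card (ends G S) = 1"
    and s: "\<And>n. s n \<in> carrier G" "inj s" and h: "h \<in> carrier G" "\<And>n. s (Suc n) = s n \<otimes>\<^bsub>G\<^esub> h"
    and t: "\<And>n. t n \<in> carrier G" "inj t" and k: "k \<in> carrier G" "\<And>n. t (Suc n) = t n \<otimes>\<^bsub>G\<^esub> k"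
    and F: "finite F" "F \<subseteq> carrier G"
  shows "\<exists>m\<ge>N. \<exists>n\<ge>N. (s m, t n) \<in> (cayley_edges_off G S F)\<^sup>*"
proof -
  have "end_of_sequence G S s = end_of_sequence G S t"
    using end_of_sequence_in_ends[OF assms(1) S(1,2) s h] end_of_sequence_in_ends[OF assms(1) S(1,2) t k] S(3)
    by (metis card_1_singletonE singletonD)
  then have eq: "end_of_sequence G S s F = end_of_sequence G S t F" by simp
  obtain M where M: "\<And>n. n \<ge> M \<Longrightarrow> t n \<in> carrier G - F"
      "\<And>n. n \<ge> M \<Longrightarrow> (t M, t n) \<in> (cayley_edges_off G S F)\<^sup>*"
    using tail_in_one_component[OF assms(1) S(1,2) t k F(1)] by blast
  let ?n = "max M N"
  have "(t n, t ?n) \<in> (cayley_edges_off G S F)\<^sup>*" if "n \<ge> M" for n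
    using symD[OF sym_cayley_edges_off M(2)[OF that]] M(2)[of ?n] by (meson max.cobounded1 rtrancl_trans)
  then have "t ?n \<in> end_of_sequence G S t F"
    using F M(1)[of ?n] by (auto simp: end_of_sequence_def)
  then have "t ?n \<in> end_of_sequence G S s F" using eq by simp
  then obtain K where K: "\<And>n. n \<ge> K \<Longrightarrow> (s n, t ?n) \<in> (cayley_edges_off G S F)\<^sup>*"
    using F by (auto simp: end_of_sequence_def)
  show ?thesis using K[of "max K N"] by (intro exI[of _ "max K N"] conjI exI[of _ ?n]) auto
qed

lemma rtrancl_crossing:
  assumes "(a, b) \<in> E\<^sup>*" "P a" "\<not> P b"
  shows "\<exists>c d. (c, d) \<in> E \<and> P c \<and> \<not> P d"
  using assms by (induction rule: rtrancl_induct) blast+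

context geometric_action
begin

text \<open>A discrete substitute for paths in the space: two sequences in \<open>\<Gamma>\<close> of the form \<open>n \<mapsto> s\<^sub>0 h\<^sup>n\<close>, on whose
orbit points a property eventually holds and eventually fails, are separated by a jump of length at
most \<open>D\<close> between two orbit points outside any given ball.\<close>

definition crossing_bound :: "'a \<Rightarrow> real \<Rightarrow> bool" where
  "crossing_bound x D \<longleftrightarrow> (\<forall>s t h k P R. (\<forall>n. s n \<in> \<Gamma>) \<and> (\<forall>n. t n \<in> \<Gamma>) \<and> inj s \<and> inj t \<and> h \<in> \<Gamma> \<and> k \<in> \<Gamma> \<and>
     (\<forall>n. s (Suc n) = s n \<circ> h) \<and> (\<forall>n. t (Suc n) = t n \<circ> k) \<and>
     (\<forall>\<^sub>F n in sequentially. P (s n x)) \<and> (\<forall>\<^sub>F n in sequentially. \<not> P (t n x)) \<longrightarrow>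
     (\<exists>\<gamma>\<in>\<Gamma>. \<exists>\<delta>\<in>\<Gamma>. P (\<gamma> x) \<and> \<not> P (\<delta> x) \<and> dist (\<gamma> x) (\<delta> x) \<le> D \<and> dist x (\<gamma> x) > R \<and> dist x (\<delta> x) > R))"

lemma crossing_boundD:
  assumes "crossing_bound x D" "\<And>n. s n \<in> \<Gamma>" "\<And>n. t n \<in> \<Gamma>" "inj s" "inj t" "h \<in> \<Gamma>" "k \<in> \<Gamma>"
    "\<And>n. s (Suc n) = s n \<circ> h" "\<And>n. t (Suc n) = t n \<circ> k"
    "\<forall>\<^sub>F n in sequentially. P (s n x)" "\<forall>\<^sub>F n in sequentially. \<not> P (t n x)"
  shows "\<exists>\<gamma>\<in>\<Gamma>. \<exists>\<delta>\<in>\<Gamma>. P (\<gamma> x) \<and> \<not> P (\<delta> x) \<and> dist (\<gamma> x) (\<delta> x) \<le> D \<and> dist x (\<gamma> x) > R \<and> dist x (\<delta> x) > R"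
  using assms(1)[unfolded crossing_bound_def, rule_format, of s t h k P R] assms(2-) by simp

text \<open>Both sequences converge to the unique end, so they are joined by a path in the Cayley graph that
avoids the finitely many elements with a small displacement of \<open>x\<close>.\<close>

lemma one_ended_crossing:
  assumes "one_ended G"
  shows "\<exists>D\<ge>0. crossing_bound x D"
proof -
  obtain S where S: "finite S" "S \<subseteq> carrier G" "generate G S = carrier G" "card (ends G S) = 1"
    using assms by (auto simp: one_ended_def)
  define D where "D = Max (insert 0 ((\<lambda>s. dist x (s x)) ` S))"
  have D: "dist x (s x) \<le> D" if "s \<in> S" for s using S(1) that by (auto simp: D_def)
  have D0: "D \<ge> 0" using S(1) by (simp add: D_def)
  have mult: "p \<otimes>\<^bsub>G\<^esub> q = p \<circ> q" for p q by (simp add: isometry_group_def)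
  have edge: "\<gamma> \<in> \<Gamma>" "\<delta> \<in> \<Gamma>" "dist (\<gamma> x) (\<delta> x) \<le> D" if e: "(\<gamma>, \<delta>) \<in> cayley_edges G S" for \<gamma> \<delta>
  proof -
    show \<gamma>: "\<gamma> \<in> \<Gamma>" and \<delta>: "\<delta> \<in> \<Gamma>" using e by (auto simp: cayley_edges_def)
    obtain s where "s \<in> S" "\<delta> = \<gamma> \<circ> s \<or> \<gamma> = \<delta> \<circ> s" using e unfolding cayley_edges_def mult by blast
    then show "dist (\<gamma> x) (\<delta> x) \<le> D"
      using D[of s] isometry[OF \<gamma>, of x "s x"] isometry[OF \<delta>, of x "s x"] by (auto simp: dist_commute)
  qed
  show ?thesis
  unfolding crossing_bound_def
  proof (intro exI[of _ D] conjI D0 allI impI, elim conjE)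
    fix s t :: "nat \<Rightarrow> 'a \<Rightarrow> 'a" and h k P R
    assume s: "\<forall>n. s n \<in> \<Gamma>" "inj s" "h \<in> \<Gamma>" "\<forall>n. s (Suc n) = s n \<circ> h"
      and t: "\<forall>n. t n \<in> \<Gamma>" "inj t" "k \<in> \<Gamma>" "\<forall>n. t (Suc n) = t n \<circ> k"
      and P: "\<forall>\<^sub>F n in sequentially. P (s n x)" "\<forall>\<^sub>F n in sequentially. \<not> P (t n x)"
    obtain N where N: "\<And>n. n \<ge> N \<Longrightarrow> P (s n x)" "\<And>n. n \<ge> N \<Longrightarrow> \<not> P (t n x)"
      using eventually_conj[OF P] by (auto simp: eventually_sequentially)
    define F where "F = {\<gamma>\<in>\<Gamma>. dist x (\<gamma> x) \<le> R}"
    have F: "finite F" "F \<subseteq> carrier G" using finite_displacement by (auto simp: F_def)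
    obtain m n where mn: "m \<ge> N" "n \<ge> N" "(s m, t n) \<in> (cayley_edges_off G S F)\<^sup>*"
      using one_end_connects[OF group_G S(2-4), of s h t k F N] s t F by (auto simp: isometry_group_def)
    obtain \<gamma> \<delta> where "(\<gamma>, \<delta>) \<in> cayley_edges_off G S F" "P (\<gamma> x)" "\<not> P (\<delta> x)"
      using rtrancl_crossing[OF mn(3), of "\<lambda>\<gamma>. P (\<gamma> x)"] N mn by blast
    moreover from this have "\<gamma> \<in> \<Gamma>" "\<delta> \<in> \<Gamma>" "dist (\<gamma> x) (\<delta> x) \<le> D" "\<gamma> \<notin> F" "\<delta> \<notin> F"
      using edge by (auto simp: cayley_edges_off_def)
    ultimately show "\<exists>\<gamma>\<in>\<Gamma>. \<exists>\<delta>\<in>\<Gamma>. P (\<gamma> x) \<and> \<not> P (\<delta> x) \<and> dist (\<gamma> x) (\<delta> x) \<le> D \<and> dist x (\<gamma> x) > R \<and> dist x (\<delta> x) > R"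
      by (intro bexI[of _ \<gamma>] bexI[of _ \<delta>]) (auto simp: F_def)
  qed
qed

end

section \<open>Busemann functions and the ends of an axis\<close>

text \<open>The elements \<open>\<alpha> n\<close> are the powers of a translation along an axis through \<open>x\<close>.  Indexing by integers makes the
statements about the repelling end instances of those about the attracting end, by \<open>axis_reverse\<close>.\<close>

locale axis = geometric_action \<Gamma> for \<Gamma> :: "('a::metric_space \<Rightarrow> 'a) set" +
  fixes \<alpha> :: "int \<Rightarrow> 'a \<Rightarrow> 'a" and x :: 'a and l :: real
  assumes l_pos: "l > 0" and \<alpha>_mem: "\<alpha> n \<in> \<Gamma>" and \<alpha>_add: "\<alpha> (m + n) = \<alpha> m \<circ> \<alpha> n"
    and axis_dist: "dist (\<alpha> m x) (\<alpha> n x) = l * \<bar>of_int (m - n)\<bar>"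
begin

abbreviation A :: "int \<Rightarrow> 'a" where "A n \<equiv> \<alpha> n x"

lemma \<alpha>_\<alpha>: "\<alpha> m (\<alpha> n p) = \<alpha> (m + n) p"
  by (simp add: \<alpha>_add)

lemma \<alpha>_0 [simp]: "\<alpha> 0 p = p"
proof -
  have "\<alpha> 0 (\<alpha> 0 p) = \<alpha> 0 p" by (simp add: \<alpha>_\<alpha>)
  then show ?thesis using inv_apply(1)[OF \<alpha>_mem] by metis
qed

lemma axis_reverse: "axis \<Gamma> (\<lambda>n. \<alpha> (- n)) x l"
proof unfold_locales
  show "\<alpha> (- (m + n)) = \<alpha> (- m) \<circ> \<alpha> (- n)" for m n using \<alpha>_add[of "- m" "- n"] by simp
  show "dist (A (- m)) (A (- n)) = l * \<bar>of_int (m - n)\<bar>" for m n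
    by (simp add: axis_dist abs_minus_commute)
qed (use l_pos \<alpha>_mem in auto)

lemma axis_dist_base: "dist x (A n) = l * \<bar>of_int n\<bar>"
  using axis_dist[of 0 n] by simp

lemma gp_axis_opposite: "m \<le> 0 \<Longrightarrow> 0 \<le> n \<Longrightarrow> gp x (A m) (A n) = 0"
  by (simp add: gromov_product_def axis_dist axis_dist_base algebra_simps)

lemma gp_axis_same: "0 \<le> m \<Longrightarrow> m \<le> n \<Longrightarrow> gp x (A m) (A n) = l * of_int m"
  by (simp add: gromov_product_def axis_dist axis_dist_base algebra_simps)

text \<open>The Busemann function of the attracting end \<open>lim \<alpha> n x\<close>, normalised to vanish at \<open>x\<close>.\<close>

definition busemann :: "'a \<Rightarrow> real" where
  "busemann z = lim (\<lambda>n::nat. dist (A (int n)) z - l * real n)"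

lemma busemann_decseq: "decseq (\<lambda>n::nat. dist (A (int n)) z - l * real n)"
proof (rule decseq_SucI)
  fix n :: nat
  have "dist (A (int (Suc n))) z \<le> dist (A (int (Suc n))) (A (int n)) + dist (A (int n)) z"
    by (rule dist_triangle)
  then show "dist (A (int (Suc n))) z - l * real (Suc n) \<le> dist (A (int n)) z - l * real n"
    by (simp add: axis_dist algebra_simps)
qed

lemma busemann_tendsto: "(\<lambda>n::nat. dist (A (int n)) z - l * real n) \<longlonglongrightarrow> busemann z"
proof -
  have lb: "\<And>n :: nat. dist (A (int n)) z - l * real n \<ge> - dist x z"
    using dist_triangle[of x "A (int n)" z for n] by (simp add: axis_dist_base dist_commute algebra_simps)
  obtain L where "(\<lambda>n::nat. dist (A (int n)) z - l * real n) \<longlonglongrightarrow> L"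
    by (rule decseq_convergent[OF busemann_decseq[of z], of "- dist x z"]) (use lb in auto)
  then have "convergent (\<lambda>n::nat. dist (A (int n)) z - l * real n)" by (rule convergentI)
  then show ?thesis unfolding busemann_def by (simp add: convergent_LIMSEQ_iff)
qed

lemma busemann_lipschitz: "busemann z \<le> busemann w + dist z w"
proof (rule LIMSEQ_le[OF busemann_tendsto])
  show "(\<lambda>n::nat. (dist (A (int n)) w - l * real n) + dist z w) \<longlonglongrightarrow> busemann w + dist z w"
    by (intro tendsto_intros busemann_tendsto)
  show "\<exists>N. \<forall>n\<ge>N. dist (A (int n)) z - l * real n \<le> (dist (A (int n)) w - l * real n) + dist z w"
    using dist_triangle[of "A (int n)" z w for n] by (auto simp: dist_commute algebra_simps)
qed

lemma gp_axis_tendsto: "(\<lambda>n::nat. gp x z (A (int n))) \<longlonglongrightarrow> (dist x z - busemann z) / 2"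
proof -
  have "(\<lambda>n::nat. (dist x z - (dist (A (int n)) z - l * real n)) / 2) \<longlonglongrightarrow> (dist x z - busemann z) / 2"
    by (intro tendsto_intros busemann_tendsto) simp
  moreover have "gp x z (A (int n)) = (dist x z - (dist (A (int n)) z - l * real n)) / 2" for n
    by (simp add: gromov_product_def axis_dist_base dist_commute)
  ultimately show ?thesis by (simp only:)
qed

lemma gp_axis_le_busemann: "gp x z (A (int n)) \<le> (dist x z - busemann z) / 2"
  using decseq_ge[OF busemann_decseq busemann_tendsto, of z n]
  by (simp add: gromov_product_def axis_dist_base dist_commute)

lemma busemann_axis: "busemann (A m) = - l * of_int m"
proof (rule LIMSEQ_unique[OF busemann_tendsto])
  have "\<forall>\<^sub>F n in sequentially. - l * of_int m = dist (A (int n)) (A m) - l * real n"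
    using eventually_ge_at_top[of "nat m"]
    by eventually_elim (auto simp: axis_dist algebra_simps)
  then show "(\<lambda>n. dist (A (int n)) (A m) - l * real n) \<longlonglongrightarrow> - l * of_int m"
    by (rule tendsto_eventually[OF eventually_mono]) simp
qed

text \<open>An element fixing one end of the axis fixes the other: conjugating it by powers of the
  translation yields elements of bounded displacement, of which there are finitely many, so it
  commutes with a power of the translation.\<close>

lemma end_moved_imp_opposite_end_moved:
  assumes y: "y \<in> \<Gamma>" and C: "\<And>m n :: nat. gp x (y (A (int m))) (A (int n)) \<le> C"
  shows "\<exists>C'. \<forall>m n :: nat. gp x (y (A (- int m))) (A (- int n)) \<le> C'"
proof (rule ccontr)
  assume "\<not> ?thesis"
  then have unb: "\<exists>m n :: nat. gp x (y (A (- int m))) (A (- int n)) > C'" for C'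
    by (meson not_le)
  define d where "d = dist x (y x)"
  define B where "B = d + 2 * ln (13 + 9 * exp d)"
  \<comment> \<open>The two rays towards the common end stay at bounded distance.\<close>
  have close: "dist (A (- int k)) (y (A (- int k))) \<le> B" for k :: nat
  proof -
    define r where "r = l * real k"
    have r: "r \<ge> 0" using l_pos by (simp add: r_def)
    have d0: "d \<ge> 0" by (simp add: d_def)
    obtain m n :: nat where mn: "gp x (y (A (- int m))) (A (- int n)) > r + d"
      using unb by blast
    have yd: "dist x (y z) \<ge> dist x z - d" "dist x (y z) \<le> dist x z + d" for z
      using dist_triangle[of "y x" "y z" x] dist_triangle[of x "y z" "y x"] isometry[OF y, of x z]
      by (auto simp: d_def dist_commute)
    have "r + d < dist x (A (- int n))"
      using mn gromov_product_le_dist[of x "A (- int n)" "y (A (- int m))"]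
      by (simp add: gromov_product_commute)
    then have n: "k \<le> n" using d0 l_pos by (auto simp: axis_dist_base r_def)
      (smt (verit) mult_less_cancel_left_pos of_nat_le_iff of_nat_less_iff)
    have "r + d < dist x (y (A (- int m)))"
      using mn gromov_product_le_dist[of x "y (A (- int m))" "A (- int n)"] by linarith
    then have "r < l * real m" using yd(2)[of "A (- int m)"] by (simp add: axis_dist_base)
    then have m: "k \<le> m" using l_pos by (simp add: r_def)
    have g1: "gp x (A (- int k)) (A (- int n)) = r"
      using axis.gp_axis_same[OF axis_reverse, of "int k" "int n"] n by (simp add: r_def)
    have "dist (y (A (- int m))) (y (A (- int k))) = l * (real m - real k)"
      using m by (simp add: isometry[OF y] axis_dist)
    then have g2: "gp x (y (A (- int m))) (y (A (- int k))) \<ge> r - d"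
      using yd(1)[of "A (- int m)"] yd(1)[of "A (- int k)"]
      unfolding gromov_product_def by (simp add: axis_dist_base r_def algebra_simps)
    have "exp (- gp x (A (- int n)) (y (A (- int k)))) \<le> exp (- gp x (y (A (- int m))) (A (- int n)))
        + 3 * exp (- gp x (y (A (- int m))) (y (A (- int k))))"
      using gp_exp[of x "A (- int n)" "y (A (- int k))" "y (A (- int m))"]
      by (simp add: gromov_product_commute)
    moreover have "exp (- gp x (y (A (- int m))) (A (- int n))) \<le> exp (- r)" using mn d0 by simp
    moreover have "exp (- gp x (y (A (- int m))) (y (A (- int k)))) \<le> exp (d - r)" using g2 by simp
    moreover have "exp (- gp x (A (- int k)) (y (A (- int k)))) \<le> exp (- r)
        + 3 * exp (- gp x (A (- int n)) (y (A (- int k))))"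
      using gp_exp[of x "A (- int k)" "y (A (- int k))" "A (- int n)"] g1 by simp
    moreover have "exp (- r) \<ge> 0" by simp
    ultimately have "exp (- gp x (A (- int k)) (y (A (- int k)))) \<le> 13 * exp (- r) + 9 * exp (d - r)" by argo
    also have "\<dots> \<le> exp (- r) * (13 + 9 * exp d)" by (simp add: algebra_simps exp_diff exp_minus divide_inverse)
    finally have X: "exp (- gp x (A (- int k)) (y (A (- int k)))) \<le> exp (- r) * (13 + 9 * exp d)" .
    have "13 + 9 * exp d > 0" by (simp add: add_pos_pos)
    then have "exp (- r) * (13 + 9 * exp d) = exp (ln (13 + 9 * exp d) - r)"
      by (simp add: exp_diff exp_minus divide_inverse)
    with X have "gp x (A (- int k)) (y (A (- int k))) \<ge> r - ln (13 + 9 * exp d)" by simp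
    moreover have "dist x (A (- int k)) = r" by (simp add: axis_dist_base r_def)
    ultimately show ?thesis
      using yd(2)[of "A (- int k)"] unfolding gromov_product_def B_def by (simp add: field_simps)
  qed
  have "(\<lambda>k::nat. \<alpha> (int k) \<circ> y \<circ> \<alpha> (- int k)) ` UNIV \<subseteq> {\<gamma>\<in>\<Gamma>. dist x (\<gamma> x) \<le> B}"
  proof safe
    fix k :: nat
    show "\<alpha> (int k) \<circ> y \<circ> \<alpha> (- int k) \<in> \<Gamma>" by (intro comp_mem \<alpha>_mem y)
    have "dist x (\<alpha> (int k) (y (A (- int k)))) = dist (\<alpha> (int k) (A (- int k))) (\<alpha> (int k) (y (A (- int k))))"
      by (simp add: \<alpha>_\<alpha>)
    also have "\<dots> \<le> B" unfolding isometry[OF \<alpha>_mem] by (rule close)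
    finally show "dist x ((\<alpha> (int k) \<circ> y \<circ> \<alpha> (- int k)) x) \<le> B" by simp
  qed
  then have "finite (range (\<lambda>k::nat. \<alpha> (int k) \<circ> y \<circ> \<alpha> (- int k)))"
    by (rule finite_subset) (rule finite_displacement)
  then have "\<not> inj (\<lambda>k::nat. \<alpha> (int k) \<circ> y \<circ> \<alpha> (- int k))"
    using finite_imageD infinite_UNIV_nat by blast
  then obtain k1 k2 :: nat where "k1 \<noteq> k2" "\<alpha> (int k1) \<circ> y \<circ> \<alpha> (- int k1) = \<alpha> (int k2) \<circ> y \<circ> \<alpha> (- int k2)"
    unfolding inj_def by blast
  then obtain k k' :: nat where kk: "k < k'" "\<alpha> (int k) \<circ> y \<circ> \<alpha> (- int k) = \<alpha> (int k') \<circ> y \<circ> \<alpha> (- int k')"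
    by (cases "k1 < k2") (auto simp: not_less dest: sym le_neq_trans)
  define j where "j = k' - k"
  have comm: "y (\<alpha> (int j) p) = \<alpha> (int j) (y p)" for p
  proof -
    have "\<alpha> (int k) (y (\<alpha> (- int k) (\<alpha> (int k') p))) = \<alpha> (int k') (y (\<alpha> (- int k') (\<alpha> (int k') p)))"
      using fun_cong[OF kk(2), of "\<alpha> (int k') p"] by simp
    then have "\<alpha> (int k) (y (\<alpha> (int j) p)) = \<alpha> (int k') (y p)"
      using kk(1) by (simp add: \<alpha>_\<alpha> j_def of_nat_diff)
    then have "\<alpha> (- int k) (\<alpha> (int k) (y (\<alpha> (int j) p))) = \<alpha> (- int k) (\<alpha> (int k') (y p))" by simp
    then show ?thesis using kk(1) by (simp add: \<alpha>_\<alpha> j_def of_nat_diff)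
  qed
  have comm': "y (A (int (i * j))) = \<alpha> (int (i * j)) (y x)" for i :: nat
  proof (induction i)
    case (Suc i)
    have "\<alpha> (int (Suc i * j)) z = \<alpha> (int j) (\<alpha> (int (i * j)) z)" for z by (simp add: \<alpha>_\<alpha> algebra_simps)
    then show ?case using Suc comm by simp
  qed simp
  \<comment> \<open>Now \<open>y\<close> displaces the points \<open>\<alpha> (i j) x\<close> by a constant, so it fixes the attracting end.\<close>
  have bound: "l * real (i * j) \<le> C + d" for i
  proof -
    let ?A = "A (int (i * j))"
    have "dist (y ?A) ?A = d"
      unfolding comm' isometry[OF \<alpha>_mem] by (simp add: d_def dist_commute)
    moreover have "dist x ?A \<le> dist x (y ?A) + dist (y ?A) ?A" by (rule dist_triangle)
    moreover have "2 * gp x (y ?A) ?A = dist x (y ?A) + dist x ?A - dist (y ?A) ?A"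
      by (simp add: gromov_product_def)
    moreover have "gp x (y ?A) ?A \<le> C" by (rule C)
    moreover have "dist x ?A = l * real (i * j)" by (simp add: axis_dist_base)
    ultimately show ?thesis by linarith
  qed
  obtain i :: nat where "real i > (C + d) / l" using reals_Archimedean2 by blast
  then have "l * real i > C + d" using l_pos by (simp add: field_simps)
  moreover have "i * 1 \<le> i * j" using kk(1) unfolding j_def by (intro mult_le_mono2) linarith
  then have "real i \<le> real (i * j)" by (simp only: of_nat_le_iff mult_1_right)
  then have "l * real i \<le> l * real (i * j)" using l_pos by simp
  ultimately show False using bound[of i] by linarith
qed

lemma inj_\<alpha>:
  assumes "s \<noteq> 0" shows "inj (\<lambda>n::nat. \<alpha> (s * int n))"
proof (rule injI)
  fix m n :: nat assume "\<alpha> (s * int m) = \<alpha> (s * int n)"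
  then have "l * \<bar>of_int (s * int m - s * int n)\<bar> = 0" using axis_dist[of "s * int m" "s * int n"] by simp
  then show "m = n" using l_pos assms by simp
qed

section \<open>Moving the ends of the axis\<close>

text \<open>On a path from one end of the axis to the other, far away from \<open>x\<close>, the difference of the two Busemann
functions changes its sign.  Where it is nearly zero, the Gromov products with the two ends are nearly
equal, and one of them is small because the ends are opposite; so both are small.\<close>

lemma exists_orbit_point_off_axis:
  assumes "one_ended G"
  shows "\<exists>C. \<forall>R. \<exists>y\<in>\<Gamma>. dist x (y x) > R \<and>
     (\<forall>n::nat. gp x (y x) (A (int n)) \<le> C \<and> gp x (y x) (A (- int n)) \<le> C)"
proof -
  interpret rev: axis \<Gamma> "\<lambda>n. \<alpha> (- n)" x l by (rule axis_reverse)
  obtain D where D: "D \<ge> 0" "crossing_bound x D" using one_ended_crossing[OF assms] by blast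
  define C where "C = ln 4 + D"
  have "\<exists>y\<in>\<Gamma>. dist x (y x) > R \<and>
     (\<forall>n::nat. gp x (y x) (A (int n)) \<le> C \<and> gp x (y x) (A (- int n)) \<le> C)" for R
  proof -
    let ?P = "\<lambda>z. rev.busemann z - busemann z \<le> 0"
    have "\<exists>\<gamma>\<in>\<Gamma>. \<exists>\<delta>\<in>\<Gamma>. ?P (\<gamma> x) \<and> \<not> ?P (\<delta> x) \<and> dist (\<gamma> x) (\<delta> x) \<le> D \<and> dist x (\<gamma> x) > R \<and> dist x (\<delta> x) > R"
    proof (rule crossing_boundD[OF D(2), of "\<lambda>n. \<alpha> (- int n)" "\<lambda>n. \<alpha> (int n)" "\<alpha> (- 1)" "\<alpha> 1" ?P])
      show "\<alpha> (- int (Suc n)) = \<alpha> (- int n) \<circ> \<alpha> (- 1)" "\<alpha> (int (Suc n)) = \<alpha> (int n) \<circ> \<alpha> 1" for n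
        using \<alpha>_add[of "- int n" "- 1"] \<alpha>_add[of "int n" 1] by (simp_all add: algebra_simps)
      show "inj (\<lambda>n::nat. \<alpha> (- int n))" "inj (\<lambda>n::nat. \<alpha> (int n))" using inj_\<alpha>[of "- 1"] inj_\<alpha>[of 1] by simp_all
      have "rev.busemann (A n) = l * of_int n" for n using rev.busemann_axis[of "- n"] by simp
      then have f: "rev.busemann (A n) - busemann (A n) = 2 * l * of_int n" for n
        by (simp add: busemann_axis)
      show "\<forall>\<^sub>F n in sequentially. ?P (A (- int n))" unfolding f using l_pos by simp
      show "\<forall>\<^sub>F n in sequentially. \<not> ?P (A (int n))"
        unfolding f using eventually_gt_at_top[of 0] by eventually_elim (use l_pos in \<open>simp add: not_le\<close>)
    qed (rule \<alpha>_mem)+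
    then obtain y z where y: "y \<in> \<Gamma>" "?P (y x)" "\<not> ?P z" "dist (y x) z \<le> D" "dist x (y x) > R" by blast
    have f: "\<bar>rev.busemann (y x) - busemann (y x)\<bar> \<le> 2 * D"
      using rev.busemann_lipschitz[of z "y x"] busemann_lipschitz[of "y x" z] y(2-4) by (simp add: dist_commute)
    have "min ((dist x (y x) - busemann (y x)) / 2) ((dist x (y x) - rev.busemann (y x)) / 2) - ln 4 \<le> 0"
    proof (rule LIMSEQ_le_const2)
      show "(\<lambda>n. min (gp x (y x) (A (int n))) (gp x (y x) (A (- int n))) - ln 4)
        \<longlonglongrightarrow> min ((dist x (y x) - busemann (y x)) / 2) ((dist x (y x) - rev.busemann (y x)) / 2) - ln 4"
        by (intro tendsto_intros tendsto_min gp_axis_tendsto rev.gp_axis_tendsto)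
      have "min (gp x (y x) (A (int n))) (gp x (y x) (A (- int n))) - ln 4 \<le> 0" for n
        using gp_min[of x "A (- int n)" "y x" "A (int n)"] gp_axis_opposite[of "- int n" "int n"]
        by (simp add: gromov_product_commute[of x "A (- int n)" "y x"] min.commute)
      then show "\<exists>N. \<forall>n\<ge>N. min (gp x (y x) (A (int n))) (gp x (y x) (A (- int n))) - ln 4 \<le> 0"
        by blast
    qed
    then have "(dist x (y x) - busemann (y x)) / 2 \<le> C" "(dist x (y x) - rev.busemann (y x)) / 2 \<le> C"
      using f D(1) unfolding C_def by (auto simp: min_def field_simps split: if_splits)
    then have "gp x (y x) (A (int n)) \<le> C \<and> gp x (y x) (A (- int n)) \<le> C" for n
      using order_trans[OF gp_axis_le_busemann] order_trans[OF rev.gp_axis_le_busemann] by blast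
    then show ?thesis using y(1,5) by blast
  qed
  then show ?thesis by blast
qed

text \<open>Take an orbit point \<open>y x\<close> in a direction away from both ends.  The two ends are opposite, so \<open>y\<^sup>-\<^sup>1 x\<close> is
away from one of them, and \<open>y\<close> maps that end into a neighbourhood of the direction of \<open>y x\<close>.  The other
end is then moved as well.\<close>

lemma both_ends_moved:
  assumes "one_ended G"
  shows "\<exists>v\<in>\<Gamma>. \<exists>C. \<forall>m n :: nat. gp x (v (A (int m))) (A (int n)) \<le> C \<and>
     gp x (v (A (- int m))) (A (- int n)) \<le> C"
proof -
  interpret rev: axis \<Gamma> "\<lambda>n. \<alpha> (- n)" x l by (rule axis_reverse)
  obtain C where C: "\<And>R. \<exists>y\<in>\<Gamma>. dist x (y x) > R \<and>
     (\<forall>n::nat. gp x (y x) (A (int n)) \<le> C \<and> gp x (y x) (A (- int n)) \<le> C)"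
    using exists_orbit_point_off_axis[OF assms] by blast
  obtain y where y: "y \<in> \<Gamma>" "dist x (y x) > C + ln 4 + ln 6"
    "\<And>n::nat. gp x (y x) (A (int n)) \<le> C" "\<And>n::nat. gp x (y x) (A (- int n)) \<le> C"
    using C by blast
  have key: "gp x (y p) q \<le> C + ln 2" if p: "gp x (iv y x) p \<le> ln 4" and q: "gp x (y x) q \<le> C" for p q
  proof -
    have "gp (y x) x (y p) = gp x (iv y x) p"
      using gp_isometry[OF y(1), of x "iv y x" p] y(1) by simp
    then have "gp x (y x) (y p) = dist x (y x) - gp x (iv y x) p" using gromov_product_swap[of x "y x" "y p"] by simp
    then have "C + ln 6 \<le> gp x (y p) (y x)" using p y(2) unfolding gromov_product_commute[of x "y p"] by linarith
    moreover have "gp x q (y x) \<le> C" using q unfolding gromov_product_commute[of x q] .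
    ultimately have "gp x q (y p) \<le> C + ln 2" by (rule gp_near[rotated])
    then show ?thesis unfolding gromov_product_commute[of x "y p"] .
  qed
  have dich: "(\<forall>m::nat. gp x (iv y x) (A (int m)) \<le> ln 4) \<or> (\<forall>m::nat. gp x (iv y x) (A (- int m)) \<le> ln 4)"
  proof (rule ccontr)
    assume "\<not> ?thesis"
    then obtain m n :: nat where mn: "gp x (iv y x) (A (int m)) > ln 4" "gp x (iv y x) (A (- int n)) > ln 4"
      by (auto simp: not_le)
    have "min (gp x (A (- int n)) (iv y x)) (gp x (iv y x) (A (int m))) - ln 4 \<le> 0"
      using gp_min[of x "A (- int n)" "iv y x" "A (int m)"] gp_axis_opposite[of "- int n" "int m"] by simp
    then show False using mn unfolding gromov_product_commute[of x "A (- int n)"] by linarith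
  qed
  then have "\<exists>C1 C2. \<forall>m n :: nat. gp x (y (A (int m))) (A (int n)) \<le> C1 \<and>
     gp x (y (A (- int m))) (A (- int n)) \<le> C2"
  proof
    assume "\<forall>m::nat. gp x (iv y x) (A (int m)) \<le> ln 4"
    then have *: "\<And>m n :: nat. gp x (y (A (int m))) (A (int n)) \<le> C + ln 2" using key y(3) by blast
    show ?thesis using end_moved_imp_opposite_end_moved[OF y(1) *] * by blast
  next
    assume "\<forall>m::nat. gp x (iv y x) (A (- int m)) \<le> ln 4"
    then have *: "\<And>m n :: nat. gp x (y (A (- int m))) (A (- int n)) \<le> C + ln 2" using key y(4) by blast
    show ?thesis using rev.end_moved_imp_opposite_end_moved[OF y(1) *] * unfolding minus_minus by blast
  qed
  then obtain C1 C2 where C12: "\<And>m n :: nat. gp x (y (A (int m))) (A (int n)) \<le> C1"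
     "\<And>m n :: nat. gp x (y (A (- int m))) (A (- int n)) \<le> C2" by blast
  show ?thesis
    by (intro bexI[OF _ y(1)] exI[of _ "max C1 C2"] allI conjI order_trans[OF C12(1)] order_trans[OF C12(2)]) auto
qed

text \<open>Seen from \<open>p\<close>, some translate of the attracting end lies behind the given point \<open>z\<close>.  If \<open>y x\<close> is an orbit
point near \<open>z\<close>, then \<open>y\<close> or \<open>y v\<close> has this property, because \<open>y\<^sup>-\<^sup>1 p\<close> cannot be in the direction of both
distinct ends \<open>a\<^sup>+\<close> and \<open>v a\<^sup>+\<close>.\<close>

lemma shadow:
  assumes v: "v \<in> \<Gamma>" "\<And>m n :: nat. gp x (v (A (int m))) (A (int n)) \<le> C"
  shows "\<exists>D. \<forall>p z. \<exists>w\<in>\<Gamma>. dist (w x) z \<le> D \<and> (\<forall>m::nat. gp z p (w (A (int m))) \<le> D)"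
proof -
  obtain D0 where D0: "D0 \<ge> 0" "\<And>z. \<exists>\<gamma>\<in>\<Gamma>. dist (\<gamma> x) z \<le> D0" using orbit_cobounded by blast
  define D where "D = max (D0 + dist x (v x)) (C + ln 6 + D0)"
  have D: "D0 + dist x (v x) \<le> D" "C + ln 6 + D0 \<le> D" by (simp_all add: D_def)
  have "\<exists>w\<in>\<Gamma>. dist (w x) z \<le> D \<and> (\<forall>m::nat. gp z p (w (A (int m))) \<le> D)" for p z
  proof -
    obtain y where y: "y \<in> \<Gamma>" "dist (y x) z \<le> D0" using D0(2) by blast
    have eq: "gp z p (y q) \<le> gp x (iv y p) q + D0" for q
    proof -
      have "gp z p (y q) \<le> gp (y x) p (y q) + dist z (y x)" by (rule gromov_product_base_change)
      moreover have "gp (y x) p (y q) = gp x (iv y p) q"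
        using gp_isometry[OF y(1), of x "iv y p" q] y(1) by simp
      ultimately show ?thesis using y(2) by (simp add: dist_commute)
    qed
    show ?thesis
    proof (cases "\<exists>n::nat. gp x (iv y p) (A (int n)) \<ge> C + ln 6")
      case True
      then obtain n :: nat where n: "gp x (iv y p) (A (int n)) \<ge> C + ln 6" by blast
      have bd: "gp x (iv y p) (v (A (int m))) \<le> C + ln 2" for m :: nat
        using gp_near[OF v(2)[of m n] n] unfolding gromov_product_commute[of x "iv y p"] .
      have "ln 2 \<le> ln (6::real)" by simp
      then have "gp z p ((y \<circ> v) (A (int m))) \<le> D" for m :: nat
        using eq[of "v (A (int m))"] bd[of m] D(2) unfolding comp_def by linarith
      moreover have "dist ((y \<circ> v) x) z \<le> D"
        using dist_triangle[of "y (v x)" z "y x"] y isometry[OF y(1), of "v x" x] D(1) by (simp add: dist_commute)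
      ultimately show ?thesis using comp_mem[OF y(1) v(1)] by blast
    next
      case False
      then have "gp x (iv y p) (A (int n)) \<le> C + ln 6" for n :: nat by (meson not_le less_imp_le)
      then have "gp z p (y (A (int m))) \<le> D" for m :: nat
        using eq[of "A (int m)"] D(2) by (meson add_right_mono order_trans)
      moreover have "dist (y x) z \<le> D" using y(2) zero_le_dist[of x "v x"] D(1) by linarith
      ultimately show ?thesis using y(1) by blast
    qed
  qed
  then show ?thesis by blast
qed

text \<open>The translates of the attracting end of the axis are dense at infinity.\<close>

lemma shadow_line:
  assumes v: "v \<in> \<Gamma>" "\<And>m n :: nat. gp x (v (A (int m))) (A (int n)) \<le> C"
    and g: "g \<in> GX" and R: "R \<ge> 0" and \<eta>: "\<eta> > 0"
  shows "\<exists>w\<in>\<Gamma>. \<forall>m::nat. gp (g R) (g (- R)) (w (A (int m))) \<le> \<eta>"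
proof -
  obtain D where D: "\<And>p z. \<exists>w\<in>\<Gamma>. dist (w x) z \<le> D \<and> (\<forall>m::nat. gp z p (w (A (int m))) \<le> D)"
    using shadow[OF v] by blast
  define q where "q = (1 - exp (- \<eta>)) / 3"
  have e1: "q > 0" using \<eta> by (simp add: q_def)
  define T where "T = max 0 (D - ln q)"
  have T: "T \<ge> 0" "T \<ge> D - ln q" by (auto simp: T_def)
  obtain w where w: "w \<in> \<Gamma>" "\<And>m::nat. gp (g (R + T)) (g R) (w (A (int m))) \<le> D" using D by blast
  have "gp (g R) (g (- R)) (w (A (int m))) \<le> \<eta>" for m :: nat
  proof -
    let ?q = "w (A (int m))"
    have "gp (g R) (g (- R)) (g (R + T)) = 0"
      using R T GX_dist[OF g] by (simp add: gromov_product_def)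
    then have "1 \<le> exp (- gp (g R) (g (- R)) ?q) + 3 * exp (- gp (g R) ?q (g (R + T)))"
      using gp_exp[of "g R" "g (- R)" "g (R + T)" ?q] by simp
    moreover have "gp (g R) (g (R + T)) ?q = T - gp (g (R + T)) (g R) ?q"
      using gromov_product_swap[of "g R" "g (R + T)" ?q] GX_dist[OF g, of R "R + T"] T by simp
    then have "gp (g R) ?q (g (R + T)) \<ge> - ln q"
      using w(2)[of m] T(2) unfolding gromov_product_commute[of "g R" ?q] by linarith
    then have "exp (- gp (g R) ?q (g (R + T))) \<le> q" using e1 by (metis exp_le_cancel_iff exp_ln minus_le_iff)
    then have "3 * exp (- gp (g R) ?q (g (R + T))) \<le> 1 - exp (- \<eta>)" by (simp add: q_def)
    ultimately have "exp (- \<eta>) \<le> exp (- gp (g R) (g (- R)) ?q)" by linarith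
    then show ?thesis by simp
  qed
  then show ?thesis using w(1) by blast
qed

end

context geometric_action
begin

section \<open>Nearly straight chains\<close>

text \<open>Points \<open>z\<close> and \<open>z'\<close> in almost the same direction have almost the same Gromov product with any point \<open>y\<close>
in a different direction.\<close>

lemma gp_stable:
  assumes a: "gp p y z \<le> C" and K: "gp p z z' \<ge> K" "3 * exp (- K) \<le> exp (- C) * (1 - exp (- \<theta>))"
  shows "\<bar>gp p y z - gp p y z'\<bar> \<le> \<theta>"
proof -
  define E where "E = exp (- gp p y z)"
  define E' where "E' = exp (- gp p y z')"
  have E: "E \<ge> exp (- C)" using a by (simp add: E_def)
  have E0: "E > 0" by (simp add: E_def)
  have "0 < exp (- C) * (1 - exp (- \<theta>))" using K(2) by (rule less_le_trans[rotated]) simp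
  then have \<theta>: "1 - exp (- \<theta>) > 0" by (simp add: zero_less_mult_iff)
  have "3 * exp (- gp p z z') \<le> 3 * exp (- K)" using K(1) by simp
  also have "\<dots> \<le> exp (- C) * (1 - exp (- \<theta>))" by (rule K(2))
  also have "\<dots> \<le> E * (1 - exp (- \<theta>))" using E \<theta> by (intro mult_right_mono) auto
  finally have s: "3 * exp (- gp p z z') \<le> E - E * exp (- \<theta>)" by (simp add: algebra_simps)
  have "E \<le> E' + 3 * exp (- gp p z z')"
    using gp_exp[of p y z z'] unfolding E_def E'_def gromov_product_commute[of p z' z] .
  then have "E * exp (- \<theta>) \<le> E'" using s by linarith
  then have 1: "gp p y z' \<le> gp p y z + \<theta>" by (simp add: E_def E'_def exp_add[symmetric])
  have "E' \<le> E + 3 * exp (- gp p z z')" using gp_exp[of p y z' z] unfolding E_def E'_def .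
  then have "E' \<le> E * (2 - exp (- \<theta>))" using s by (simp add: algebra_simps)
  also have "\<dots> \<le> E * exp \<theta>"
  proof -
    have "2 * 1 \<le> 2 * cosh \<theta>" by (intro mult_left_mono cosh_real_ge_1) simp
    then have "2 - exp (- \<theta>) \<le> exp \<theta>" by (simp add: cosh_field_def)
    then show ?thesis using E0 by simp
  qed
  finally have 2: "gp p y z \<le> gp p y z' + \<theta>" by (simp add: E_def E'_def exp_add[symmetric])
  from 1 2 show ?thesis by (simp add: abs_le_iff)
qed

lemma gp_stable_threshold:
  fixes C \<theta> :: real
  assumes "\<theta> > 0" shows "\<exists>K. 3 * exp (- K) \<le> exp (- C) * (1 - exp (- \<theta>))"
proof -
  define q where "q = exp (- C) * (1 - exp (- \<theta>)) / 3"
  have q: "q > 0" using assms by (simp add: q_def)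
  then show ?thesis by (intro exI[of _ "- ln q"]) (simp add: q_def)
qed

text \<open>A chain of long steps that turns by little at each vertex, relative to its two neighbours, also turns
by little relative to the starting point: seen from a vertex, the starting point is in almost the same
direction as the preceding vertex.  The bound does not deteriorate along the chain.\<close>

lemma chain_gp:
  assumes \<eta>: "\<eta> \<ge> 0" and R: "exp (- 2 * \<eta>) + 3 * exp (2 * \<eta> - R) \<le> exp (- \<eta>)"
    and turn: "\<And>i. Suc (Suc i) \<le> N \<Longrightarrow> gp (c (Suc i)) (c i) (c (Suc (Suc i))) \<le> \<eta>"
    and len: "\<And>i. Suc i \<le> N \<Longrightarrow> dist (c i) (c (Suc i)) \<ge> R"
  shows "Suc (Suc i) \<le> N \<Longrightarrow> gp (c (Suc i)) (c 0) (c (Suc (Suc i))) \<le> 2 * \<eta>"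
proof (induction i)
  case 0
  then show ?case using turn[of 0] \<eta> by simp
next
  case (Suc i)
  let ?p = "c (Suc (Suc i))" and ?q = "c (Suc i)" and ?r = "c (Suc (Suc (Suc i)))"
  have "gp ?q ?p (c 0) \<le> 2 * \<eta>" using Suc unfolding gromov_product_commute[of ?q ?p] by simp
  moreover have "dist ?p ?q \<ge> R" using len[of "Suc i"] Suc.prems by (simp add: dist_commute)
  ultimately have "gp ?p (c 0) ?q \<ge> R - 2 * \<eta>"
    using gromov_product_swap[of ?p ?q "c 0"] unfolding gromov_product_commute[of ?p "c 0"] by linarith
  then have "3 * exp (- gp ?p (c 0) ?q) \<le> 3 * exp (2 * \<eta> - R)" by simp
  moreover have "exp (- \<eta>) \<le> exp (- gp ?p ?r ?q)"
    using turn[of "Suc i"] Suc.prems unfolding gromov_product_commute[of ?p ?r] by simp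
  moreover have "exp (- gp ?p ?r ?q) \<le> exp (- gp ?p ?r (c 0)) + 3 * exp (- gp ?p (c 0) ?q)" by (rule gp_exp)
  ultimately have "exp (- 2 * \<eta>) \<le> exp (- gp ?p ?r (c 0))" using R by linarith
  then show ?case unfolding gromov_product_commute[of ?p "c 0"] by simp
qed

lemma chain_length:
  assumes \<eta>: "\<eta> \<ge> 0" and g: "\<And>i. Suc (Suc i) \<le> N \<Longrightarrow> gp (c (Suc i)) (c 0) (c (Suc (Suc i))) \<le> 2 * \<eta>"
  shows "\<bar>dist (c 0) (c N) - (\<Sum>i<N. dist (c i) (c (Suc i)))\<bar> \<le> 4 * \<eta> * real N"
proof -
  have "n \<le> N \<Longrightarrow> \<bar>dist (c 0) (c n) - (\<Sum>i<n. dist (c i) (c (Suc i)))\<bar> \<le> 4 * \<eta> * real n" for n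
  proof (induction n)
    case (Suc n)
    show ?case
    proof (cases n)
      case 0
      then show ?thesis using \<eta> by simp
    next
      case (Suc m)
      have "dist (c 0) (c (Suc n)) = dist (c 0) (c n) + dist (c n) (c (Suc n)) - 2 * gp (c n) (c 0) (c (Suc n))"
        by (simp add: gromov_product_def dist_commute field_simps)
      moreover have "gp (c n) (c 0) (c (Suc n)) \<le> 2 * \<eta>" using g[of m] Suc Suc.prems by simp
      moreover have "gp (c n) (c 0) (c (Suc n)) \<ge> 0" by (rule gromov_product_nonneg)
      moreover have "\<bar>dist (c 0) (c n) - (\<Sum>i<n. dist (c i) (c (Suc i)))\<bar> \<le> 4 * \<eta> * real n"
        using Suc.IH Suc.prems by simp
      ultimately show ?thesis by (simp add: algebra_simps)
    qed
  qed simp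
  then show ?thesis by blast
qed

text \<open>If the path from \<open>y\<close> to \<open>z\<close> passes near \<open>p\<close>, and the path from \<open>y\<close> to \<open>w\<close> passes near the far point \<open>z\<close>, then
the path from \<open>y\<close> to \<open>w\<close> passes near \<open>p\<close>.\<close>

lemma gp_transfer:
  assumes 1: "gp p y z \<le> \<eta>" "gp z y w \<le> \<eta>" and K: "3 * exp (- K) \<le> exp (- \<eta>) * (1 - exp (- \<theta>))"
    and d: "dist p z \<ge> K + \<eta> + dist p y"
  shows "gp p y w \<le> \<eta> + \<theta>"
proof -
  have "gp z p w \<le> gp z y w + dist p y" by (rule gromov_product_perturb)
  then have "gp p z w \<ge> K" using gromov_product_swap[of p z w] 1(2) d by linarith
  from gp_stable[OF 1(1) this K] show ?thesis using 1(1) by linarith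
qed

text \<open>A small Gromov product at \<open>q\<close> means that \<open>q\<close> lies almost on the segment.\<close>

lemma segment_near:
  assumes c: "geodesic_segment UNIV dist c p y" and q: "dist p q \<le> dist p y" and pos: "dist p y > 0"
    and gp: "gp q p y \<le> \<eta>"
  shows "cosh (dist q (c (dist p q))) \<le> exp (2 * \<eta>)"
proof -
  define a where "a = dist p y"
  define s where "s = dist p q"
  have s: "0 \<le> s" "s \<le> a" using q by (auto simp: a_def s_def)
  have qy: "dist q y \<le> (a - s) + 2 * \<eta>" using gp by (simp add: gromov_product_def a_def s_def dist_commute field_simps)
  have \<eta>: "\<eta> \<ge> 0" using gp gromov_product_nonneg[of q p y] by linarith
  have "cosh (dist q y) \<le> cosh ((a - s) + 2 * \<eta>)" using qy s \<eta> by (subst cosh_real_nonneg_le_iff) auto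
  also have "\<dots> \<le> exp (2 * \<eta>) * cosh (a - s)"
  proof -
    have "sinh (a - s) * sinh (2 * \<eta>) \<le> cosh (a - s) * sinh (2 * \<eta>)"
      using \<eta> by (intro mult_right_mono sinh_le_cosh_real) simp
    then show ?thesis unfolding cosh_add[of "a - s"] cosh_plus_sinh[symmetric] by (simp add: algebra_simps)
  qed
  finally have 2: "cosh (dist q y) \<le> exp (2 * \<eta>) * cosh (a - s)" .
  have 1: "cosh s \<le> exp (2 * \<eta>) * cosh s" using \<eta> by simp
  have "sinh a * cosh (dist q (c s)) \<le> sinh (a - s) * cosh (dist q p) + sinh s * cosh (dist q y)"
    unfolding a_def by (rule CAT_stewart[OF cat c]) (use s in \<open>auto simp: a_def\<close>)
  also have "\<dots> \<le> sinh (a - s) * (exp (2 * \<eta>) * cosh s) + sinh s * (exp (2 * \<eta>) * cosh (a - s))"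
    using 1 2 s by (intro add_mono mult_left_mono) (auto simp: s_def dist_commute)
  also have "\<dots> = exp (2 * \<eta>) * sinh ((a - s) + s)"
    unfolding sinh_add by (simp add: algebra_simps)
  also have "\<dots> = sinh a * exp (2 * \<eta>)" by simp
  finally show ?thesis using pos by (simp add: a_def s_def)
qed

end

context axis
begin

section \<open>Homoclinic excursions\<close>

text \<open>The element \<open>u\<close> describes a line from the repelling end of the axis to the image under \<open>u\<close> of the
attracting end; \<open>\<tau>\<close> is the time that it takes in excess of the time on the axis.  The limit exists
exactly when these two ends are distinct.\<close>

definition homoclinic :: "('a \<Rightarrow> 'a) \<Rightarrow> real \<Rightarrow> bool" where
  "homoclinic u \<tau> \<longleftrightarrow> u \<in> \<Gamma> \<and>
     (\<lambda>p::nat. dist (A (- int p)) (u (A (int p))) - 2 * l * real p) \<longlonglongrightarrow> \<tau>"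

lemma homoclinic_decseq:
  assumes u: "u \<in> \<Gamma>"
  shows "decseq (\<lambda>p::nat. dist (A (- int p)) (u (A (int p))) - 2 * l * real p)"
proof (rule decseq_SucI)
  fix p :: nat
  have "dist (A (- int (Suc p))) (u (A (int (Suc p)))) \<le> dist (A (- int (Suc p))) (A (- int p))
      + dist (A (- int p)) (u (A (int (Suc p))))" by (rule dist_triangle)
  also have "dist (A (- int p)) (u (A (int (Suc p)))) \<le> dist (A (- int p)) (u (A (int p)))
      + dist (u (A (int p))) (u (A (int (Suc p))))" by (rule dist_triangle)
  finally show "dist (A (- int (Suc p))) (u (A (int (Suc p)))) - 2 * l * real (Suc p)
      \<le> dist (A (- int p)) (u (A (int p))) - 2 * l * real p"
    by (simp add: isometry[OF u] axis_dist algebra_simps)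
qed

lemma dist_orbit_axis:
  assumes "u \<in> \<Gamma>"
  shows "dist x (u (A n)) \<le> l * \<bar>of_int n\<bar> + dist x (u x)" "dist x (u (A n)) \<ge> l * \<bar>of_int n\<bar> - dist x (u x)"
  using dist_triangle[of x "u (A n)" "u x"] dist_triangle[of "u x" "u (A n)" x] isometry[OF assms, of x "A n"]
    axis_dist_base[of n] by (auto simp: dist_commute)

lemma homoclinic_exists:
  assumes u: "u \<in> \<Gamma>" and gp: "\<forall>\<^sub>F p::nat in sequentially. gp x (A (- int p)) (u (A (int p))) \<le> C"
  shows "\<exists>\<tau>. homoclinic u \<tau>"
proof -
  let ?f = "\<lambda>p::nat. dist (A (- int p)) (u (A (int p))) - 2 * l * real p"
  obtain N where N: "\<And>p. p \<ge> N \<Longrightarrow> gp x (A (- int p)) (u (A (int p))) \<le> C"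
    using gp by (auto simp: eventually_sequentially)
  have lb: "- dist x (u x) - 2 * C \<le> ?f p" for p
  proof -
    let ?m = "max p N"
    have "2 * gp x (A (- int ?m)) (u (A (int ?m))) = l * real ?m + dist x (u (A (int ?m)))
        - dist (A (- int ?m)) (u (A (int ?m)))"
      by (simp add: gromov_product_def axis_dist_base)
    then have "- dist x (u x) - 2 * C \<le> ?f ?m"
      using N[of ?m] dist_orbit_axis(2)[OF u, of "int ?m"] by simp
    also have "\<dots> \<le> ?f p" by (rule decseqD[OF homoclinic_decseq[OF u]]) simp
    finally show ?thesis .
  qed
  obtain \<tau> where "?f \<longlonglongrightarrow> \<tau>"
    by (rule decseq_convergent[OF homoclinic_decseq[OF u], of "- dist x (u x) - 2 * C"]) (use lb in auto)
  then show ?thesis using u unfolding homoclinic_def by blast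
qed

lemma homoclinic_mem: "homoclinic u \<tau> \<Longrightarrow> u \<in> \<Gamma>"
  by (simp add: homoclinic_def)

lemma homoclinic_le: "homoclinic u \<tau> \<Longrightarrow> 2 * l * real p + \<tau> \<le> dist (A (- int p)) (u (A (int p)))"
  using decseq_ge[OF homoclinic_decseq[OF homoclinic_mem], of u \<tau> \<tau> p] by (simp add: homoclinic_def)

lemma homoclinic_gp:
  assumes "homoclinic u \<tau>"
  shows "gp x (A (- int p)) (u (A (int p))) \<le> (dist x (u x) - \<tau>) / 2"
  using homoclinic_le[OF assms, of p] dist_orbit_axis(1)[OF homoclinic_mem[OF assms], of "int p"]
  by (simp add: gromov_product_def axis_dist_base)

lemma homoclinic_gp_inverse:
  assumes "homoclinic u \<tau>"
  shows "gp x (A (int p)) (iv u (A (- int p))) \<le> (dist x (u x) - \<tau>) / 2 + dist x (u x)"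
proof -
  have u: "u \<in> \<Gamma>" by (rule homoclinic_mem[OF assms])
  have "gp x (A (int p)) (iv u (A (- int p))) = gp (u x) (u (A (int p))) (A (- int p))"
    using gp_isometry[OF u, of x "A (int p)" "iv u (A (- int p))"] u by simp
  also have "\<dots> \<le> gp x (u (A (int p))) (A (- int p)) + dist (u x) x" by (rule gromov_product_base_change)
  also have "gp x (u (A (int p))) (A (- int p)) \<le> (dist x (u x) - \<tau>) / 2"
    using homoclinic_gp[OF assms] unfolding gromov_product_commute[of x "u (A (int p))"] .
  finally show ?thesis by (simp add: dist_commute)
qed

text \<open>A path that follows the axis over \<open>p + p'\<close> periods, between its excursions to translates of \<open>Z\<close> and \<open>Z'\<close>,
is almost straight at the interior point \<open>x\<close> of this block.\<close>

lemma turn_at_axis: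
  fixes p p' :: nat
  assumes Z: "gp x (A (int p)) Z \<le> C" and Z': "gp x (A (- int p')) Z' \<le> C"
    and p: "3 * exp (C - l * real p) + 9 * exp (C - l * real p') \<le> 1 - exp (- \<eta>)"
  shows "gp x (\<alpha> (- int p) Z) (\<alpha> (int p') Z') \<le> \<eta>"
proof -
  have "gp (A (- int p)) x (\<alpha> (- int p) Z) = gp x (A (int p)) Z"
    using gp_isometry[OF \<alpha>_mem, of "int p" "A (- int p)" x "\<alpha> (- int p) Z"] by (simp add: \<alpha>_\<alpha>)
  then have a: "gp x (A (- int p)) (\<alpha> (- int p) Z) \<ge> l * real p - C"
    using gromov_product_swap[of x "A (- int p)" "\<alpha> (- int p) Z"] Z by (simp add: axis_dist_base)
  have "gp (A (int p')) x (\<alpha> (int p') Z') = gp x (A (- int p')) Z'"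
    using gp_isometry[OF \<alpha>_mem, of "- int p'" "A (int p')" x "\<alpha> (int p') Z'"] by (simp add: \<alpha>_\<alpha>)
  then have b: "gp x (A (int p')) (\<alpha> (int p') Z') \<ge> l * real p' - C"
    using gromov_product_swap[of x "A (int p')" "\<alpha> (int p') Z'"] Z' by (simp add: axis_dist_base)
  have "1 \<le> exp (- gp x (A (- int p)) (\<alpha> (int p') Z')) + 3 * exp (- gp x (\<alpha> (int p') Z') (A (int p')))"
    using gp_exp[of x "A (- int p)" "A (int p')" "\<alpha> (int p') Z'"] gp_axis_opposite[of "- int p" "int p'"] by simp
  moreover have "exp (- gp x (\<alpha> (int p') Z') (A (- int p))) \<le> exp (- gp x (\<alpha> (int p') Z') (\<alpha> (- int p) Z))
      + 3 * exp (- gp x (\<alpha> (- int p) Z) (A (- int p)))" by (rule gp_exp)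
  moreover have "exp (- gp x (\<alpha> (int p') Z') (A (int p'))) \<le> exp (C - l * real p')"
    using b unfolding gromov_product_commute[of x "\<alpha> (int p') Z'"] by simp
  moreover have "exp (- gp x (\<alpha> (- int p) Z) (A (- int p))) \<le> exp (C - l * real p)"
    using a unfolding gromov_product_commute[of x "\<alpha> (- int p) Z"] by simp
  moreover have "exp (C - l * real p') > 0" by simp
  ultimately have "exp (- \<eta>) \<le> exp (- gp x (\<alpha> (- int p) Z) (\<alpha> (int p') Z'))"
    using p unfolding gromov_product_commute[of x "\<alpha> (int p') Z'"] by linarith
  then show ?thesis by simp
qed

lemma eventually_axis_long: "\<forall>\<^sub>F p::nat in sequentially. M \<le> l * real p"
  using eventually_ge_at_top[of "nat \<lceil>M / l\<rceil>"]
proof eventually_elim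
  case (elim p)
  then have "M / l \<le> real p" by linarith
  then show ?case using l_pos by (simp add: field_simps)
qed

text \<open>The translate of \<open>x\<close> under \<open>marker w u p i\<close> is the midpoint of the \<open>i\<close>-th axis block of the word
\<open>w a\<^sup>2\<^sup>p u\<^sub>0 a\<^sup>2\<^sup>p u\<^sub>1 \<dots>\<close>.\<close>

primrec marker :: "('a \<Rightarrow> 'a) \<Rightarrow> (nat \<Rightarrow> 'a \<Rightarrow> 'a) \<Rightarrow> nat \<Rightarrow> nat \<Rightarrow> 'a \<Rightarrow> 'a" where
  "marker w u p 0 = w \<circ> \<alpha> (int p)"
| "marker w u p (Suc i) = marker w u p i \<circ> \<alpha> (int p) \<circ> u i \<circ> \<alpha> (int p)"

lemma marker_mem:
  assumes "w \<in> \<Gamma>" "\<And>i. i < k \<Longrightarrow> u i \<in> \<Gamma>"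
  shows "i \<le> k \<Longrightarrow> marker w u p i \<in> \<Gamma>"
proof (induction i)
  case 0 show ?case unfolding marker.simps by (rule comp_mem[OF assms(1) \<alpha>_mem])
next
  case (Suc i) then show ?case unfolding marker.simps using assms(2)[of i] by (intro comp_mem \<alpha>_mem) auto
qed

section \<open>Transit times\<close>

lemma dist_axis_ge: "dist z (w (A n)) \<ge> l * \<bar>of_int n\<bar> - dist z (w x)" if w: "w \<in> \<Gamma>"
  using dist_triangle[of "w x" "w (A n)" z] isometry[OF w, of x "A n"] axis_dist_base[of n]
  by (simp add: dist_commute)

text \<open>The midpoints of the axis blocks form a chain with long steps and small turns between \<open>P\<close> and \<open>\<gamma> Q\<close>,
so the distance is almost the sum of the steps.  The steps are, up to small errors, given by the
Busemann functions at both ends of the chain and by the homoclinic times in between.  The last block is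
longer than the others by \<open>r\<close>; the estimates are uniform in \<open>r\<close>.\<close>

lemma transit:
  assumes u: "\<And>i. i < k \<Longrightarrow> homoclinic (u i) (\<tau> i)" and w: "w0 \<in> \<Gamma>" "w1 \<in> \<Gamma>" and \<epsilon>: "\<epsilon> > 0"
  shows "\<forall>\<^sub>F p in sequentially. \<forall>r::nat. \<exists>\<gamma>\<in>\<Gamma>.
     \<bar>dist P (\<gamma> Q) - (busemann (iv w0 P) + axis.busemann (\<lambda>n. \<alpha> (- n)) x l (w1 Q) + l * real (2 * k + 2) * real p + l * real r + (\<Sum>i<k. \<tau> i))\<bar> \<le> \<epsilon> \<and>
     gp (w0 (A (int p))) P (\<gamma> Q) \<le> \<epsilon> \<and>
     gp (iv w1 (A (- int (p + r)))) (iv \<gamma> P) Q \<le> \<epsilon>"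
proof -
  interpret rev: axis \<Gamma> "\<lambda>n. \<alpha> (- n)" x l by (rule axis_reverse)
  define b0 where "b0 = busemann (iv w0 P)"
  define b1 where "b1 = rev.busemann (w1 Q)"
  \<comment> \<open>Each of the \<open>k + 2\<close> steps contributes \<open>\<eta>\<close> from its own estimate and \<open>4 \<eta>\<close> from the turn.\<close>
  define \<eta> where "\<eta> = \<epsilon> / (5 * real (k + 2))"
  have \<eta>: "\<eta> > 0" using \<epsilon> by (simp add: \<eta>_def)
  have \<eta>\<epsilon>: "5 * \<eta> * real (k + 2) = \<epsilon>" by (simp add: \<eta>_def field_simps)
  have "10 * \<eta> \<le> 5 * \<eta> * real (k + 2)" using \<eta> by (simp add: algebra_simps)
  then have \<eta>2: "2 * \<eta> \<le> \<epsilon>" using \<eta>\<epsilon> \<eta> by linarith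
  define C where "C = Max (insert (dist x (iv w0 P)) (insert (dist x (w1 Q))
     ((\<lambda>i. (dist x (u i x) - \<tau> i) / 2 + dist x (u i x)) ` {..<k})))"
  have C0: "dist x (iv w0 P) \<le> C" "dist x (w1 Q) \<le> C" unfolding C_def by (intro Max_ge; simp)+
  have Cu: "(dist x (u i x) - \<tau> i) / 2 + dist x (u i x) \<le> C" if "i < k" for i
    unfolding C_def using that by (intro Max_ge) auto
  have Cu': "(dist x (u i x) - \<tau> i) / 2 \<le> C" if "i < k" for i
    using Cu[OF that] zero_le_dist[of x "u i x"] by linarith
  \<comment> \<open>The block length \<open>p\<close> has to satisfy finitely many conditions, all true for large \<open>p\<close>.\<close>
  obtain R where R: "exp (- 2 * \<eta>) + 3 * exp (2 * \<eta> - R) \<le> exp (- \<eta>)"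
  proof -
    define q where "q = (exp (- \<eta>) - exp (- 2 * \<eta>)) / 3"
    have "q > 0" using \<eta> by (simp add: q_def)
    moreover have "3 * q = exp (- \<eta>) - exp (- 2 * \<eta>)" by (simp add: q_def)
    ultimately have "exp (- 2 * \<eta>) + 3 * exp (2 * \<eta> - (2 * \<eta> - ln q)) \<le> exp (- \<eta>)" by simp
    then show ?thesis by (rule that)
  qed
  have ev1: "\<forall>\<^sub>F p in sequentially. \<bar>dist (A (- int p)) (u i (A (int p))) - 2 * l * real p - \<tau> i\<bar> \<le> \<eta>"
    if "i < k" for i
    using u[OF that] \<eta> unfolding homoclinic_def
    by (auto simp: tendsto_iff dist_real_def elim!: allE[of _ \<eta>] eventually_mono)
  then have ev1': "\<forall>\<^sub>F p in sequentially. \<forall>i\<in>{..<k}. \<bar>dist (A (- int p)) (u i (A (int p))) - 2 * l * real p - \<tau> i\<bar> \<le> \<eta>"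
    by (intro eventually_ball_finite) auto
  have ev2: "\<forall>\<^sub>F p::nat in sequentially. \<bar>dist (A (int p)) (iv w0 P) - l * real p - b0\<bar> \<le> \<eta>"
    using busemann_tendsto[of "iv w0 P"] \<eta> unfolding b0_def
    by (auto simp: tendsto_iff dist_real_def elim!: allE[of _ \<eta>] eventually_mono)
  have "\<forall>\<^sub>F p::nat in sequentially. \<bar>dist (A (- int p)) (w1 Q) - l * real p - b1\<bar> \<le> \<eta>"
    using rev.busemann_tendsto[of "w1 Q"] \<eta> unfolding b1_def
    by (auto simp: tendsto_iff dist_real_def elim!: allE[of _ \<eta>] eventually_mono)
  then obtain N where N: "\<And>p. p \<ge> N \<Longrightarrow> \<bar>dist (A (- int p)) (w1 Q) - l * real p - b1\<bar> \<le> \<eta>"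
    by (auto simp: eventually_sequentially)
  define M where "M = C - ln ((1 - exp (- \<eta>)) / 12)"
  have ev3: "\<forall>\<^sub>F p::nat in sequentially. M \<le> l * real p" by (rule eventually_axis_long)
  have ev4: "\<forall>\<^sub>F p::nat in sequentially. R + \<eta> + \<bar>b0\<bar> + \<bar>b1\<bar> \<le> l * real p" by (rule eventually_axis_long)
  have ev5: "\<forall>\<^sub>F p in sequentially. \<forall>i\<in>{..<k}. R + \<eta> + \<bar>\<tau> i\<bar> \<le> l * real p"
    by (intro eventually_ball_finite ballI eventually_axis_long) auto
  have "\<forall>\<^sub>F p in sequentially. \<forall>r::nat. \<exists>\<gamma>\<in>\<Gamma>.
     \<bar>dist P (\<gamma> Q) - (b0 + b1 + l * real (2 * k + 2) * real p + l * real r + (\<Sum>i<k. \<tau> i))\<bar> \<le> \<epsilon> \<and>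
     gp (w0 (A (int p))) P (\<gamma> Q) \<le> \<epsilon> \<and>
     gp (iv w1 (A (- int (p + r)))) (iv \<gamma> P) Q \<le> \<epsilon>"
    using ev1' ev2 ev3 ev4 ev5 eventually_ge_at_top[of N]
  proof eventually_elim
    case (elim p)
    show ?case
    proof
    fix r :: nat
    define W where "W = marker w0 u p"
    have W0: "W 0 = w0 \<circ> \<alpha> (int p)" and WS: "\<And>i. W (Suc i) = W i \<circ> \<alpha> (int p) \<circ> u i \<circ> \<alpha> (int p)"
      by (simp_all add: W_def)
    have W: "W i \<in> \<Gamma>" if "i \<le> k" for i
      unfolding W_def using marker_mem[of w0 k u i p] w(1) u homoclinic_mem that by blast
    define \<gamma> where "\<gamma> = W k \<circ> \<alpha> (int (p + r)) \<circ> w1"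
    have \<gamma>: "\<gamma> \<in> \<Gamma>" unfolding \<gamma>_def by (intro comp_mem W \<alpha>_mem w) simp
    define c where "c = (\<lambda>i. if i = 0 then P else if i \<le> Suc k then W (i - 1) x else \<gamma> Q)"
    define m where "m = (\<lambda>i. if i < k then p else p + r)"
    define Z where "Z = (\<lambda>i. if i = 0 then iv w0 P else iv (u (i - 1)) (A (- int p)))"
    define Z' where "Z' = (\<lambda>i. if i < k then u i (A (int p)) else w1 Q)"
    have cm: "c (Suc i) = W i x" if "i \<le> k" for i using that by (simp add: c_def)
    have cn: "c (Suc (Suc i)) = W i (\<alpha> (int (m i)) (Z' i))" if "i \<le> k" for i
    proof (cases "i = k")
      case True
      then show ?thesis by (simp add: c_def m_def Z'_def \<gamma>_def)
    next
      case False
      then show ?thesis using that by (simp add: c_def m_def Z'_def WS)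
    qed
    have cp: "c i = W i (\<alpha> (- int p) (Z i))" if "i \<le> k" for i
    proof (cases i)
      case 0
      then show ?thesis by (simp add: c_def Z_def W0 \<alpha>_\<alpha> w(1))
    next
      case (Suc j)
      then have "u j \<in> \<Gamma>" using u[of j] that homoclinic_mem by auto
      then show ?thesis using Suc that by (simp add: c_def Z_def WS \<alpha>_\<alpha>)
    qed
    have mp: "p \<le> m i" for i by (simp add: m_def)
    have len: "dist (c i) (c (Suc i)) = dist (A (int p)) (Z i)" if "i \<le> k" for i
    proof -
      have "dist (c i) (c (Suc i)) = dist (\<alpha> (- int p) (Z i)) x"
        unfolding cp[OF that] cm[OF that] by (rule isometry[OF W[OF that]])
      also have "\<dots> = dist (\<alpha> (int p) (\<alpha> (- int p) (Z i))) (A (int p))" by (rule isometry[OF \<alpha>_mem, symmetric])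
      finally show ?thesis by (simp add: \<alpha>_\<alpha> dist_commute)
    qed
    have len0: "dist (c 0) (c (Suc 0)) = dist (A (int p)) (iv w0 P)" using len[of 0] by (simp add: Z_def)
    have lenS: "dist (c (Suc i)) (c (Suc (Suc i))) = dist (A (- int p)) (u i (A (int p)))" if "i < k" for i
    proof -
      have ui: "u i \<in> \<Gamma>" using u[OF that] homoclinic_mem by blast
      have "dist (c (Suc i)) (c (Suc (Suc i))) = dist (A (int p)) (iv (u i) (A (- int p)))"
        using len[of "Suc i"] that by (simp add: Z_def)
      also have "\<dots> = dist (u i (A (int p))) (u i (iv (u i) (A (- int p))))" by (rule isometry[OF ui, symmetric])
      finally show ?thesis using ui by (simp add: dist_commute)
    qed
    have lenL: "dist (c (Suc k)) (c (Suc (Suc k))) = dist (A (- int (p + r))) (w1 Q)"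
    proof -
      have "dist (c (Suc k)) (c (Suc (Suc k))) = dist x (\<alpha> (int (p + r)) (w1 Q))"
        unfolding cm[OF order_refl] cn[OF order_refl] isometry[OF W[OF order_refl]] by (simp add: m_def Z'_def)
      also have "\<dots> = dist (A (- int (p + r))) (\<alpha> (- int (p + r)) (\<alpha> (int (p + r)) (w1 Q)))"
        by (rule isometry[OF \<alpha>_mem, symmetric])
      finally show ?thesis by (simp add: \<alpha>_\<alpha>)
    qed
    have gZ: "gp x (A (int p)) (Z i) \<le> C" if "i \<le> k" for i
    proof (cases i)
      case 0
      have "gp x (A (int p)) (iv w0 P) \<le> dist x (iv w0 P)"
        using gromov_product_le_dist[of x "iv w0 P"] unfolding gromov_product_commute[of x "A (int p)"] .
      then show ?thesis using C0 0 by (simp add: Z_def)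
    next
      case (Suc j)
      then show ?thesis using homoclinic_gp_inverse[OF u[of j], of p] Cu[of j] that by (simp add: Z_def)
    qed
    have gZ': "gp x (A (- int (m i))) (Z' i) \<le> C" for i
    proof (cases "i < k")
      case True
      then show ?thesis using order_trans[OF homoclinic_gp[OF u[OF True], of p] Cu'[OF True]] by (simp add: m_def Z'_def)
    next
      case False
      have "gp x (A (- int (m i))) (w1 Q) \<le> dist x (w1 Q)"
        using gromov_product_le_dist[of x "w1 Q"] unfolding gromov_product_commute[of x "A (- int (m i))"] .
      then show ?thesis using C0 False by (simp add: Z'_def)
    qed
    have small: "3 * exp (C - l * real p) + 9 * exp (C - l * real (m i)) \<le> 1 - exp (- \<eta>)" for i
    proof -
      have e: "0 < (1 - exp (- \<eta>)) / 12" using \<eta> by simp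
      have "exp (C - l * real q) \<le> (1 - exp (- \<eta>)) / 12" if "p \<le> q" for q
      proof -
        have "l * real p \<le> l * real q" using that l_pos by simp
        then have "C - l * real q \<le> ln ((1 - exp (- \<eta>)) / 12)" using elim(3) unfolding M_def by linarith
        then have "exp (C - l * real q) \<le> exp (ln ((1 - exp (- \<eta>)) / 12))" by simp
        then show ?thesis unfolding exp_ln[OF e] .
      qed
      from this[of p] this[OF mp[of i]] show ?thesis by simp
    qed
    have turn: "gp (c (Suc i)) (c i) (c (Suc (Suc i))) \<le> \<eta>" if "Suc (Suc i) \<le> Suc (Suc k)" for i
    proof -
      have i: "i \<le> k" using that by simp
      show ?thesis
        unfolding cm[OF i] cn[OF i] cp[OF i] gp_isometry[OF W[OF i]]
        by (rule turn_at_axis[OF gZ[OF i] gZ' small])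
    qed
    have lr: "0 \<le> l * real r" using l_pos by simp
    have lpr: "l * real (p + r) = l * real p + l * real r" by (simp add: algebra_simps)
    have last: "\<bar>dist (c (Suc k)) (c (Suc (Suc k))) - (l * real p + l * real r) - b1\<bar> \<le> \<eta>"
      using N[of "p + r"] elim(6) unfolding lenL lpr by simp
    have mid: "\<bar>dist (c (Suc i)) (c (Suc (Suc i))) - 2 * l * real p - \<tau> i\<bar> \<le> \<eta>" if "i < k" for i
      using elim(1) that unfolding lenS[OF that] by blast
    have lp: "0 \<le> l * real p" using l_pos by simp
    have long: "R \<le> dist (c i) (c (Suc i))" if "Suc i \<le> Suc (Suc k)" for i
    proof -
      have "i = 0 \<or> (\<exists>j. i = Suc j \<and> j < k) \<or> i = Suc k" using that by (cases i) (auto simp: le_less)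
      then consider "i = 0" | j where "i = Suc j" "j < k" | "i = Suc k" by blast
      then show ?thesis
      proof cases
        case 1
        then show ?thesis using elim(2,4) unfolding 1 len0 by linarith
      next
        case (2 j)
        have "R + \<eta> + \<bar>\<tau> j\<bar> \<le> l * real p" using elim(5) 2 by blast
        then show ?thesis using mid[OF 2(2)] lp unfolding 2(1) by linarith
      next
        case 3
        then show ?thesis using last elim(4) lr unfolding 3 by linarith
      qed
    qed
    have ch: "gp (c (Suc i)) (c 0) (c (Suc (Suc i))) \<le> 2 * \<eta>" if "Suc (Suc i) \<le> Suc (Suc k)" for i
      by (rule chain_gp[of \<eta> R "Suc (Suc k)" c i, OF _ R turn long that]) (use \<eta> in auto)
    have "\<bar>dist (c 0) (c (Suc (Suc k))) - (\<Sum>i<Suc (Suc k). dist (c i) (c (Suc i)))\<bar> \<le> 4 * \<eta> * real (Suc (Suc k))"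
      by (rule chain_length[OF _ ch]) (use \<eta> in auto)
    moreover have "\<bar>(\<Sum>i<Suc (Suc k). dist (c i) (c (Suc i))) -
        (b0 + b1 + l * real (2 * k + 2) * real p + l * real r + (\<Sum>i<k. \<tau> i))\<bar> \<le> \<eta> * real (Suc (Suc k))"
    proof -
      have "\<bar>(\<Sum>i<k. dist (c (Suc i)) (c (Suc (Suc i)))) - (\<Sum>i<k. 2 * l * real p + \<tau> i)\<bar>
          \<le> (\<Sum>i<k. \<bar>dist (c (Suc i)) (c (Suc (Suc i))) - (2 * l * real p + \<tau> i)\<bar>)"
        unfolding sum_subtractf[symmetric] by (rule sum_abs)
      also have "\<dots> \<le> (\<Sum>i<k. \<eta>)" by (rule sum_mono) (use mid in \<open>simp add: algebra_simps\<close>)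
      finally have "\<bar>(\<Sum>i<k. dist (c (Suc i)) (c (Suc (Suc i)))) - (real k * (2 * l * real p) + (\<Sum>i<k. \<tau> i))\<bar> \<le> real k * \<eta>"
        by (simp add: sum.distrib)
      moreover have "(\<Sum>i<Suc (Suc k). dist (c i) (c (Suc i))) = dist (c 0) (c (Suc 0)) +
         ((\<Sum>i<k. dist (c (Suc i)) (c (Suc (Suc i)))) + dist (c (Suc k)) (c (Suc (Suc k))))"
        by (subst sum.lessThan_Suc_shift) (simp only: sum.lessThan_Suc)
      moreover have "l * real (2 * k + 2) * real p = real k * (2 * l * real p) + l * real p + l * real p"
        "\<eta> * real (Suc (Suc k)) = real k * \<eta> + \<eta> + \<eta>"
        by (simp_all add: algebra_simps)
      ultimately show ?thesis using elim(2) last unfolding len0 by linarith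
    qed
    moreover have "4 * \<eta> * real (Suc (Suc k)) + \<eta> * real (Suc (Suc k)) = \<epsilon>" using \<eta>\<epsilon> by (simp add: algebra_simps)
    ultimately have "\<bar>dist (c 0) (c (Suc (Suc k))) - (b0 + b1 + l * real (2 * k + 2) * real p + l * real r + (\<Sum>i<k. \<tau> i))\<bar> \<le> \<epsilon>"
      by linarith
    moreover have c0: "c 0 = P" "c (Suc (Suc k)) = \<gamma> Q" by (simp_all add: c_def)
    moreover have "gp (w0 (A (int p))) P (\<gamma> Q) \<le> \<epsilon>"
    proof -
      \<comment> \<open>The turn at the first marker, relative to the end of the chain, is controlled by reversing it.\<close>
      define c' where "c' = (\<lambda>i. c (Suc (Suc k) - i))"
      have "gp (c' (Suc k)) (c' 0) (c' (Suc (Suc k))) \<le> 2 * \<eta>"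
      proof (rule chain_gp[of \<eta> R "Suc (Suc k)" c' k, OF _ R])
        fix i assume i: "Suc (Suc i) \<le> Suc (Suc k)"
        then have "Suc (Suc k) - i = Suc (Suc (k - i))" "Suc (Suc k) - Suc i = Suc (k - i)" "Suc (Suc k) - Suc (Suc i) = k - i"
          by auto
        then show "gp (c' (Suc i)) (c' i) (c' (Suc (Suc i))) \<le> \<eta>"
          using turn[of "k - i"] gromov_product_commute[of "c (Suc (k - i))" "c (k - i)" "c (Suc (Suc (k - i)))"]
          unfolding c'_def by simp
      next
        fix i assume i: "Suc i \<le> Suc (Suc k)"
        then have "Suc (Suc k) - i = Suc (Suc k - i)" "Suc (Suc k) - Suc i = Suc k - i" by auto
        then show "R \<le> dist (c' i) (c' (Suc i))" using long[of "Suc k - i"] unfolding c'_def by (simp add: dist_commute)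
      qed (use \<eta> in auto)
      moreover have "c' (Suc k) = w0 (A (int p))" "c' 0 = \<gamma> Q" "c' (Suc (Suc k)) = P"
        by (simp_all add: c'_def c_def W0)
      ultimately show ?thesis
        using \<eta>2 gromov_product_commute[of "w0 (A (int p))" P "\<gamma> Q"] by simp
    qed
    moreover have "gp (iv w1 (A (- int (p + r)))) (iv \<gamma> P) Q \<le> \<epsilon>"
    proof -
      have "\<gamma> (iv w1 (A (- int (p + r)))) = c (Suc k)"
        unfolding cm[OF order_refl] \<gamma>_def using w(2) by (simp add: \<alpha>_\<alpha>)
      then have "gp (iv w1 (A (- int (p + r)))) (iv \<gamma> P) Q = gp (c (Suc k)) (c 0) (c (Suc (Suc k)))"
        using gp_isometry[OF \<gamma>, of "iv w1 (A (- int (p + r)))" "iv \<gamma> P" Q] \<gamma> by (simp add: c0)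
      then show ?thesis using ch[of k] \<eta>2 by simp
    qed
    ultimately show "\<exists>\<gamma>\<in>\<Gamma>.
     \<bar>dist P (\<gamma> Q) - (b0 + b1 + l * real (2 * k + 2) * real p + l * real r + (\<Sum>i<k. \<tau> i))\<bar> \<le> \<epsilon> \<and>
     gp (w0 (A (int p))) P (\<gamma> Q) \<le> \<epsilon> \<and>
     gp (iv w1 (A (- int (p + r)))) (iv \<gamma> P) Q \<le> \<epsilon>"
      using \<gamma> by (intro bexI[OF _ \<gamma>] conjI) simp_all
    qed
  qed
  then show ?thesis unfolding b0_def b1_def .
qed

section \<open>Small cross-ratios\<close>

text \<open>Every real number \<open>c\<close> is approximately a cross-ratio of the sources \<open>a\<^sup>-\<close>, \<open>v a\<^sup>-\<close> and a translate \<open>y a\<^sup>+\<close>.\<close>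

lemma cross_ratio_attained:
  assumes one: "one_ended G" and v: "v \<in> \<Gamma>"
    "\<And>m n :: nat. gp x (v (A (- int m))) (A (- int n)) \<le> C"
    and v': "v' \<in> \<Gamma>" "\<And>m n :: nat. gp x (v' (A (int m))) (A (int n)) \<le> C'"
    and \<delta>: "\<delta> > 0"
  shows "\<exists>y \<sigma> \<sigma>'. homoclinic y \<sigma> \<and> homoclinic (iv v \<circ> y) \<sigma>' \<and> \<bar>\<sigma> - \<sigma>' - c\<bar> \<le> \<delta>"
proof -
  interpret rev: axis \<Gamma> "\<lambda>n. \<alpha> (- n)" x l by (rule axis_reverse)
  define \<phi> where "\<phi> = (\<lambda>z. rev.busemann z - rev.busemann (iv v z))"
  define \<phi>' where "\<phi>' = (\<lambda>p::nat. \<lambda>z. dist (A (- int p)) z - dist (v (A (- int p))) z)"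
  define dv where "dv = dist x (v x)"
  have vinv: "dist q (iv v z) = dist (v q) z" for q z
    using isometry[OF v(1), of q "iv v z"] v(1) by simp
  have \<phi>_lim: "(\<lambda>p. \<phi>' p z) \<longlonglongrightarrow> \<phi> z" for z
  proof -
    have "(\<lambda>p::nat. (dist (A (- int p)) z - l * real p) - (dist (A (- int p)) (iv v z) - l * real p))
        \<longlonglongrightarrow> \<phi> z"
      unfolding \<phi>_def by (intro tendsto_diff rev.busemann_tendsto)
    then show ?thesis by (simp add: \<phi>'_def vinv)
  qed
  have \<phi>_lip: "\<bar>\<phi> z - \<phi> w\<bar> \<le> 2 * dist z w" for z w
    using rev.busemann_lipschitz[of z w] rev.busemann_lipschitz[of w z]
      rev.busemann_lipschitz[of "iv v z" "iv v w"] rev.busemann_lipschitz[of "iv v w" "iv v z"]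
      isometry[OF inv_mem[OF v(1)], of z w]
    unfolding \<phi>_def by (simp add: dist_commute)
  have far: "dist (A (- int m)) (v (A (- int n))) \<ge> l * real m + l * real n - dv - 2 * C" for m n
  proof -
    have "2 * gp x (v (A (- int n))) (A (- int m)) = dist x (v (A (- int n))) + l * real m
        - dist (A (- int m)) (v (A (- int n)))"
      by (simp add: gromov_product_def axis_dist_base dist_commute)
    then show ?thesis using v(2)[of n m] dist_orbit_axis(2)[OF v(1), of "- int n"] by (simp add: dv_def)
  qed
  have bus_far: "rev.busemann (v (A (- int n))) \<ge> l * real n - dv - 2 * C"
    "rev.busemann (iv v (A (- int n))) \<ge> l * real n - dv - 2 * C" for n :: nat
  proof -
    show "rev.busemann (v (A (- int n))) \<ge> l * real n - dv - 2 * C"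
      by (rule LIMSEQ_le_const[OF rev.busemann_tendsto]) (use far[of _ n] in \<open>auto simp: algebra_simps\<close>)
    show "rev.busemann (iv v (A (- int n))) \<ge> l * real n - dv - 2 * C"
      by (rule LIMSEQ_le_const[OF rev.busemann_tendsto])
        (use far[of n] in \<open>auto simp: vinv dist_commute algebra_simps\<close>)
  qed
  have bus_ax: "rev.busemann (A (- int n)) = - l * real n" for n :: nat
    using rev.busemann_axis[of "int n"] by simp
  have ev_neg: "\<forall>\<^sub>F n in sequentially. \<phi> (A (- int n)) \<le> c"
    using eventually_axis_long[of "dv + 2 * C + \<bar>c\<bar>"]
  proof eventually_elim
    case (elim n)
    have "0 \<le> l * real n" using l_pos by simp
    then show ?case using elim bus_far(2)[of n] unfolding \<phi>_def bus_ax by linarith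
  qed
  have ev_pos: "\<forall>\<^sub>F n in sequentially. \<not> \<phi> ((v \<circ> \<alpha> (- int n)) x) \<le> c"
    using eventually_axis_long[of "dv + 2 * C + \<bar>c\<bar> + 1"]
  proof eventually_elim
    case (elim n)
    have "0 \<le> l * real n" using l_pos by simp
    moreover have "rev.busemann (iv v (v (A (- int n)))) = - l * real n" using v(1) bus_ax by simp
    ultimately show ?case using elim bus_far(1)[of n] unfolding \<phi>_def by simp
  qed
  obtain D where D: "D \<ge> 0" "crossing_bound x D" using one_ended_crossing[OF one] by blast
  obtain D1 where D1: "\<And>p z. \<exists>w\<in>\<Gamma>. dist (w x) z \<le> D1 \<and> (\<forall>m::nat. gp z p (w (A (int m))) \<le> D1)"
    using shadow[OF v'] by blast
  define C2 where "C2 = C + ln 4 + (dv + \<bar>c\<bar> + 1) / 2"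
  define \<theta> where "\<theta> = \<delta> / 8"
  have \<theta>: "\<theta> > 0" using \<delta> by (simp add: \<theta>_def)
  obtain K where K: "3 * exp (- K) \<le> exp (- C2) * (1 - exp (- \<theta>))" using gp_stable_threshold[OF \<theta>] by blast
  \<comment> \<open>The radius leaves room for the jump \<open>D\<close> and for the error \<open>D1\<close> of the shadow.\<close>
  have "\<exists>\<gamma>\<in>\<Gamma>. \<exists>\<beta>\<in>\<Gamma>. \<phi> (\<gamma> x) \<le> c \<and> \<not> \<phi> (\<beta> x) \<le> c \<and> dist (\<gamma> x) (\<beta> x) \<le> D \<and>
      dist x (\<gamma> x) > D + D1 + K \<and> dist x (\<beta> x) > D + D1 + K"
  proof (rule crossing_boundD[OF D(2), of "\<lambda>n. \<alpha> (- int n)" "\<lambda>n. v \<circ> \<alpha> (- int n)" "\<alpha> (- 1)" "\<alpha> (- 1)" "\<lambda>z. \<phi> z \<le> c"])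
    have S: "\<alpha> (- int (Suc n)) = \<alpha> (- int n) \<circ> \<alpha> (- 1)" for n
      using \<alpha>_add[of "- int n" "- 1"] by (simp add: algebra_simps)
    then show "\<alpha> (- int (Suc n)) = \<alpha> (- int n) \<circ> \<alpha> (- 1)" for n .
    show "v \<circ> \<alpha> (- int (Suc n)) = v \<circ> \<alpha> (- int n) \<circ> \<alpha> (- 1)" for n unfolding S by (simp only: o_assoc)
    show i: "inj (\<lambda>n::nat. \<alpha> (- int n))" using inj_\<alpha>[of "- 1"] by simp
    show "inj (\<lambda>n::nat. v \<circ> \<alpha> (- int n))"
    proof (rule injI)
      fix m n :: nat assume "v \<circ> \<alpha> (- int m) = v \<circ> \<alpha> (- int n)"
      then have "\<alpha> (- int m) = \<alpha> (- int n)"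
        by (simp add: fun.inj_map_strong fun_eq_iff) (metis inv_apply(1) v(1))
      then show "m = n" using injD[OF i] by blast
    qed
    show "v \<circ> \<alpha> (- int n) \<in> \<Gamma>" for n by (intro comp_mem v \<alpha>_mem)
  qed (use ev_neg ev_pos \<alpha>_mem in auto)
  then obtain z1 z2 where z12: "\<phi> z1 \<le> c" "c < \<phi> z2" "dist z1 z2 \<le> D" "dist x z1 > D + D1 + K"
    by (auto simp: not_le)
  obtain s where s: "geodesic_segment UNIV dist s z1 z2"
    using cat unfolding CAT_minus_one_def geodesic_space_def by blast
  have s_ends: "s 0 = z1" "s (dist z1 z2) = z2" using s by (auto simp: geodesic_segment_def)
  have s_dist: "dist (s p) (s q) = \<bar>p - q\<bar>" if "p \<in> {0..dist z1 z2}" "q \<in> {0..dist z1 z2}" for p q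
    using s that by (auto simp: geodesic_segment_def)
  have "continuous_on {0..dist z1 z2} (\<lambda>t. \<phi> (s t))"
  proof (rule continuous_on_iff[THEN iffD2], intro ballI allI impI)
    fix p e :: real assume p: "p \<in> {0..dist z1 z2}" and e: "e > 0"
    have "dist (\<phi> (s q)) (\<phi> (s p)) < e" if "q \<in> {0..dist z1 z2}" "dist q p < e / 2" for q
      using \<phi>_lip[of "s q" "s p"] s_dist[OF that(1) p] that(2) by (simp add: dist_real_def)
    then show "\<exists>d>0. \<forall>q\<in>{0..dist z1 z2}. dist q p < d \<longrightarrow> dist (\<phi> (s q)) (\<phi> (s p)) < e"
      using e by (intro exI[of _ "e / 2"]) auto
  qed
  then obtain t where t: "0 \<le> t" "t \<le> dist z1 z2" "\<phi> (s t) = c"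
    using IVT'[of "\<lambda>t. \<phi> (s t)" 0 c "dist z1 z2"] z12 s_ends by auto
  define z where "z = s t"
  have \<phi>z: "\<phi> z = c" using t by (simp add: z_def)
  have "dist z1 z \<le> D" using s_dist[of 0 t] t z12(3) s_ends unfolding z_def by simp
  then have xz: "dist x z > D1 + K" using z12(4) dist_triangle[of x z1 z] by (simp add: dist_commute)
  obtain y where y: "y \<in> \<Gamma>" "\<And>m::nat. gp z x (y (A (int m))) \<le> D1" using D1 by blast
  have shadow: "gp x z (y (A (int m))) \<ge> K" for m :: nat
    using gromov_product_swap[of x z "y (A (int m))"] y(2)[of m] xz by linarith
  have "\<forall>\<^sub>F p in sequentially. \<bar>\<phi>' p z - c\<bar> < min 1 (\<delta> / 2)"
    using \<phi>_lim[of z] \<delta> unfolding \<phi>z tendsto_iff dist_real_def by (auto elim!: allE[of _ "min 1 (\<delta> / 2)"])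
  then have ev: "\<forall>\<^sub>F p in sequentially. gp x (A (- int p)) (y (A (int p))) \<le> C2 + \<theta> \<and>
      gp x (v (A (- int p))) (y (A (int p))) \<le> C2 + \<theta> \<and> \<bar>\<phi>' p (y (A (int p))) - c\<bar> \<le> \<delta>"
  proof eventually_elim
    case (elim p)
    let ?s = "A (- int p)" and ?s' = "v (A (- int p))" and ?y = "y (A (int p))"
    have gp2: "2 * gp x ?s q - 2 * gp x ?s' q = (dist x ?s - dist x ?s') - \<phi>' p q" for q
      by (simp add: gromov_product_def \<phi>'_def field_simps)
    have dd: "\<bar>dist x ?s - dist x ?s'\<bar> \<le> dv"
      using dist_orbit_axis[OF v(1), of "- int p"] by (simp add: axis_dist_base dv_def abs_le_iff)
    have "min (gp x ?s' z) (gp x z ?s) - ln 4 \<le> C" using gp_min[of x ?s' z ?s] v(2)[of p p] by linarith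
    then have "gp x ?s' z \<le> C + ln 4 \<or> gp x ?s z \<le> C + ln 4"
      unfolding gromov_product_commute[of x z] by linarith
    moreover have "\<bar>\<phi>' p z\<bar> \<le> \<bar>c\<bar> + 1" using elim by linarith
    then have "\<bar>2 * gp x ?s z - 2 * gp x ?s' z\<bar> \<le> dv + \<bar>c\<bar> + 1" using gp2[of z] dd by linarith
    moreover have "2 * C2 = 2 * C + 2 * ln 4 + (dv + \<bar>c\<bar> + 1)" by (simp add: C2_def)
    moreover have "0 \<le> dv" by (simp add: dv_def)
    ultimately have g: "gp x ?s z \<le> C2" "gp x ?s' z \<le> C2" by linarith+
    have st: "\<bar>gp x ?s z - gp x ?s ?y\<bar> \<le> \<theta>" "\<bar>gp x ?s' z - gp x ?s' ?y\<bar> \<le> \<theta>"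
      using gp_stable[OF g(1) shadow K] gp_stable[OF g(2) shadow K] by auto
    have "\<bar>\<phi>' p ?y - \<phi>' p z\<bar> \<le> \<delta> / 2"
      using gp2[of z] gp2[of ?y] st unfolding \<theta>_def by linarith
    then have "\<bar>\<phi>' p ?y - c\<bar> \<le> \<delta>" using elim by linarith
    then show ?case using st g by (simp add: abs_le_iff)
  qed
  have "\<forall>\<^sub>F p::nat in sequentially. gp x (A (- int p)) (y (A (int p))) \<le> C2 + \<theta>"
    using ev by eventually_elim simp
  then obtain \<sigma> where \<sigma>: "homoclinic y \<sigma>" using homoclinic_exists[OF y(1)] by blast
  have "\<forall>\<^sub>F p::nat in sequentially. gp x (A (- int p)) ((iv v \<circ> y) (A (int p))) \<le> C2 + \<theta> + dv"
    using ev
  proof eventually_elim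
    case (elim p)
    have "gp x (A (- int p)) (iv v (y (A (int p)))) = gp (v x) (v (A (- int p))) (y (A (int p)))"
      using gp_isometry[OF v(1), of x "A (- int p)" "iv v (y (A (int p)))"] v(1) by simp
    then show ?case
      using gromov_product_base_change[of "v x" "v (A (- int p))" "y (A (int p))" x] elim
      by (simp add: dv_def dist_commute)
  qed
  then obtain \<sigma>' where \<sigma>': "homoclinic (iv v \<circ> y) \<sigma>'"
    using homoclinic_exists[OF comp_mem[OF inv_mem[OF v(1)] y(1)]] by blast
  have "(\<lambda>p::nat. (dist (A (- int p)) (y (A (int p))) - 2 * l * real p)
      - (dist (A (- int p)) ((iv v \<circ> y) (A (int p))) - 2 * l * real p)) \<longlonglongrightarrow> \<sigma> - \<sigma>'"
    using \<sigma> \<sigma>' unfolding homoclinic_def by (intro tendsto_diff) auto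
  then have "(\<lambda>p::nat. \<phi>' p (y (A (int p)))) \<longlonglongrightarrow> \<sigma> - \<sigma>'" by (simp add: \<phi>'_def vinv)
  then have "(\<lambda>p::nat. \<bar>\<phi>' p (y (A (int p))) - c\<bar>) \<longlonglongrightarrow> \<bar>\<sigma> - \<sigma>' - c\<bar>" by (intro tendsto_intros)
  moreover have "\<forall>\<^sub>F p in sequentially. \<bar>\<phi>' p (y (A (int p))) - c\<bar> \<le> \<delta>" using ev by eventually_elim simp
  ultimately have "\<bar>\<sigma> - \<sigma>' - c\<bar> \<le> \<delta>" by (rule tendsto_upperbound) simp
  then show ?thesis using \<sigma> \<sigma>' by blast
qed

text \<open>The difference of two cross-ratios close to \<open>\<epsilon> / 2\<close> and to \<open>0\<close>.\<close>

lemma small_cross_ratio: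
  assumes one: "one_ended G" and \<epsilon>: "\<epsilon> > 0"
  shows "\<exists>u1 u2 u3 u4 \<tau>1 \<tau>2 \<tau>3 \<tau>4. homoclinic u1 \<tau>1 \<and> homoclinic u2 \<tau>2 \<and> homoclinic u3 \<tau>3 \<and> homoclinic u4 \<tau>4 \<and>
     0 < \<tau>1 + \<tau>2 - \<tau>3 - \<tau>4 \<and> \<tau>1 + \<tau>2 - \<tau>3 - \<tau>4 < \<epsilon>"
proof -
  obtain v C where v: "v \<in> \<Gamma>" "\<And>m n :: nat. gp x (v (A (int m))) (A (int n)) \<le> C"
    "\<And>m n :: nat. gp x (v (A (- int m))) (A (- int n)) \<le> C"
    using both_ends_moved[OF one] by blast
  have e8: "\<epsilon> / 8 > 0" using \<epsilon> by simp
  obtain y \<sigma> \<sigma>' where 1: "homoclinic y \<sigma>" "homoclinic (iv v \<circ> y) \<sigma>'" "\<bar>\<sigma> - \<sigma>' - \<epsilon> / 2\<bar> \<le> \<epsilon> / 8"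
    using cross_ratio_attained[OF one v(1,3) v(1,2) e8] by blast
  obtain z \<rho> \<rho>' where 2: "homoclinic z \<rho>" "homoclinic (iv v \<circ> z) \<rho>'" "\<bar>\<rho> - \<rho>' - 0\<bar> \<le> \<epsilon> / 8"
    using cross_ratio_attained[OF one v(1,3) v(1,2) e8] by blast
  have "0 < \<sigma> + \<rho>' - \<sigma>' - \<rho>" "\<sigma> + \<rho>' - \<sigma>' - \<rho> < \<epsilon>" using 1(3) 2(3) \<epsilon> by linarith+
  then show ?thesis using 1(1,2) 2(1,2) by blast
qed

section \<open>Density of transit times\<close>

lemma sum_pairs:
  fixes f :: "nat \<Rightarrow> real"
  shows "(\<Sum>i<2 * k. f i) = (\<Sum>i<k. f (2 * i) + f (Suc (2 * i)))"
  by (induction k) (auto simp: sum.distrib)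

lemma sum_threshold:
  fixes j k :: nat
  shows "j \<le> k \<Longrightarrow> (\<Sum>i<k. if i < j then a else b) = real j * a + (real k - real j) * (b :: real)"
proof (induction k)
  case (Suc k)
  then show ?case by (cases "j = Suc k") (auto simp: algebra_simps)
qed simp

text \<open>The words \<open>w\<^sub>0\<close> and \<open>w\<^sub>1\<close> are chosen such that the axis blocks lie behind \<open>g R\<close> and before \<open>\<gamma> h(-R)\<close>; the
small Gromov products say that the geodesic follows \<open>g\<close> at its beginning and \<open>\<gamma> h\<close> at its end.\<close>

lemma transit_times_dense:
  assumes one: "one_ended G" and g: "g \<in> GX" and h: "h \<in> GX" and R: "R \<ge> 0" and \<epsilon>: "\<epsilon> > 0"
  shows "\<exists>t0\<ge>0. \<forall>t\<ge>t0. \<exists>\<gamma>\<in>\<Gamma>. \<bar>dist (g (- R)) (\<gamma> (h R)) - 2 * R - t\<bar> \<le> \<epsilon> \<and>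
     gp (g R) (g (- R)) (\<gamma> (h R)) \<le> \<epsilon> \<and> gp (\<gamma> (h (- R))) (g (- R)) (\<gamma> (h R)) \<le> \<epsilon>"
proof -
  interpret rev: axis \<Gamma> "\<lambda>n. \<alpha> (- n)" x l by (rule axis_reverse)
  define P Q where "P = g (- R)" and "Q = h R"
  obtain v C where v: "v \<in> \<Gamma>" "\<And>m n :: nat. gp x (v (A (int m))) (A (int n)) \<le> C"
    "\<And>m n :: nat. gp x (v (A (- int m))) (A (- int n)) \<le> C"
    using both_ends_moved[OF one] by blast
  define \<eta> where "\<eta> = \<epsilon> / 4"
  have \<eta>: "\<eta> > 0" using \<epsilon> by (simp add: \<eta>_def)
  obtain w0 where w0: "w0 \<in> \<Gamma>" "\<And>m::nat. gp (g R) P (w0 (A (int m))) \<le> \<eta>"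
    using shadow_line[OF v(1,2) g R \<eta>] unfolding P_def by blast
  have h': "(\<lambda>s. h (- s)) \<in> GX" using h by (auto simp: geodesic_lines_def)
  obtain w where w: "w \<in> \<Gamma>" "\<And>m::nat. gp (h (- R)) Q (w (A (- int m))) \<le> \<eta>"
    using rev.shadow_line[OF v(1,3) h' R \<eta>] unfolding Q_def by auto
  define w1 where "w1 = iv w"
  have w1: "w1 \<in> \<Gamma>" "iv w1 = w" using w(1) inv_mem bij_mem by (auto simp: w1_def inv_inv_eq)
  obtain u1 u2 u3 u4 \<tau>1 \<tau>2 \<tau>3 \<tau>4 where u: "homoclinic u1 \<tau>1" "homoclinic u2 \<tau>2" "homoclinic u3 \<tau>3" "homoclinic u4 \<tau>4"
    and \<delta>: "0 < \<tau>1 + \<tau>2 - \<tau>3 - \<tau>4" "\<tau>1 + \<tau>2 - \<tau>3 - \<tau>4 < \<epsilon> / 2"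
    using small_cross_ratio[OF one, of "\<epsilon> / 2"] \<epsilon> by auto
  define \<delta> where "\<delta> = \<tau>1 + \<tau>2 - \<tau>3 - \<tau>4"
  have \<delta>0: "\<delta> > 0" "\<delta> < \<epsilon> / 2" using \<delta> by (auto simp: \<delta>_def)
  obtain k :: nat where "real k \<ge> l / \<delta>" using real_arch_simple by blast
  then have k: "l \<le> real k * \<delta>" using \<delta>0 by (simp add: field_simps)
  define U where "U = (\<lambda>j i::nat. if i < 2 * j then (if even i then u1 else u2) else (if even i then u3 else u4))"
  define T where "T = (\<lambda>j i::nat. if i < 2 * j then (if even i then \<tau>1 else \<tau>2) else (if even i then \<tau>3 else \<tau>4))"
  have UT: "homoclinic (U j i) (T j i)" for j i using u by (simp add: U_def T_def)
  have sumT: "(\<Sum>i<2 * k. T j i) = real k * (\<tau>3 + \<tau>4) + real j * \<delta>" if "j \<le> k" for j :: nat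
  proof -
    have "(\<Sum>i<2 * k. T j i) = (\<Sum>i<k. T j (2 * i) + T j (Suc (2 * i)))" by (rule sum_pairs)
    also have "\<dots> = (\<Sum>i<k. if i < j then \<tau>1 + \<tau>2 else \<tau>3 + \<tau>4)"
      by (intro sum.cong) (auto simp: T_def)
    also have "\<dots> = real j * (\<tau>1 + \<tau>2) + (real k - real j) * (\<tau>3 + \<tau>4)" by (rule sum_threshold[OF that])
    finally show ?thesis by (simp add: \<delta>_def algebra_simps)
  qed
  define b where "b = busemann (iv w0 P) + rev.busemann (w1 Q)"
  have ev: "\<forall>\<^sub>F p in sequentially. \<forall>r::nat. \<exists>\<gamma>\<in>\<Gamma>.
     \<bar>dist P (\<gamma> Q) - (b + l * real (2 * (2 * k) + 2) * real p + l * real r + (\<Sum>i<2 * k. T j i))\<bar> \<le> \<eta> \<and>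
     gp (w0 (A (int p))) P (\<gamma> Q) \<le> \<eta> \<and>
     gp (w (A (- int (p + r)))) (iv \<gamma> P) Q \<le> \<eta>" for j
    using transit[where k = "2 * k" and u = "U j" and \<tau> = "T j" and P = P and Q = Q, OF UT w0(1) w1(1) \<eta>]
    unfolding w1(2) b_def .
  obtain K where K: "3 * exp (- K) \<le> exp (- \<eta>) * (1 - exp (- \<eta>))" using gp_stable_threshold[OF \<eta>] by blast
  have ev_all: "\<forall>\<^sub>F p in sequentially. \<forall>j\<in>{..k}. \<forall>r::nat. \<exists>\<gamma>\<in>\<Gamma>.
     \<bar>dist P (\<gamma> Q) - (b + l * real (2 * (2 * k) + 2) * real p + l * real r + (\<Sum>i<2 * k. T j i))\<bar> \<le> \<eta> \<and>
     gp (w0 (A (int p))) P (\<gamma> Q) \<le> \<eta> \<and>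
     gp (w (A (- int (p + r)))) (iv \<gamma> P) Q \<le> \<eta>"
    by (intro eventually_ball_finite ballI ev) simp
  obtain p where p: "\<And>j r. j \<le> k \<Longrightarrow> \<exists>\<gamma>\<in>\<Gamma>.
     \<bar>dist P (\<gamma> Q) - (b + l * real (2 * (2 * k) + 2) * real p + l * real r + (\<Sum>i<2 * k. T j i))\<bar> \<le> \<eta> \<and>
     gp (w0 (A (int p))) P (\<gamma> Q) \<le> \<eta> \<and>
     gp (w (A (- int (p + r)))) (iv \<gamma> P) Q \<le> \<eta>"
    and p1: "dist (g R) (w0 x) + K + \<eta> + dist (g R) P \<le> l * real p"
    and p2: "dist (h (- R)) (w x) + K + \<eta> + dist (h (- R)) Q \<le> l * real p"
  proof -
    have "\<forall>\<^sub>F p in sequentially. (\<forall>j\<in>{..k}. \<forall>r::nat. \<exists>\<gamma>\<in>\<Gamma>.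
       \<bar>dist P (\<gamma> Q) - (b + l * real (2 * (2 * k) + 2) * real p + l * real r + (\<Sum>i<2 * k. T j i))\<bar> \<le> \<eta> \<and>
       gp (w0 (A (int p))) P (\<gamma> Q) \<le> \<eta> \<and>
       gp (w (A (- int (p + r)))) (iv \<gamma> P) Q \<le> \<eta>) \<and>
       dist (g R) (w0 x) + K + \<eta> + dist (g R) P \<le> l * real p \<and>
       dist (h (- R)) (w x) + K + \<eta> + dist (h (- R)) Q \<le> l * real p"
      by (intro eventually_conj ev_all eventually_axis_long)
    then obtain p where "(\<forall>j\<in>{..k}. \<forall>r::nat. \<exists>\<gamma>\<in>\<Gamma>.
       \<bar>dist P (\<gamma> Q) - (b + l * real (2 * (2 * k) + 2) * real p + l * real r + (\<Sum>i<2 * k. T j i))\<bar> \<le> \<eta> \<and>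
       gp (w0 (A (int p))) P (\<gamma> Q) \<le> \<eta> \<and>
       gp (w (A (- int (p + r)))) (iv \<gamma> P) Q \<le> \<eta>) \<and>
       dist (g R) (w0 x) + K + \<eta> + dist (g R) P \<le> l * real p \<and>
       dist (h (- R)) (w x) + K + \<eta> + dist (h (- R)) Q \<le> l * real p"
      unfolding eventually_sequentially by blast
    then show ?thesis by (intro that[of p]) auto
  qed
  define S where "S = b + l * real (2 * (2 * k) + 2) * real p + real k * (\<tau>3 + \<tau>4) - 2 * R"
  have "\<exists>\<gamma>\<in>\<Gamma>. \<bar>dist P (\<gamma> Q) - 2 * R - t\<bar> \<le> \<epsilon> \<and> gp (g R) P (\<gamma> Q) \<le> \<epsilon> \<and> gp (\<gamma> (h (- R))) P (\<gamma> Q) \<le> \<epsilon>"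
    if t: "t \<ge> max 0 S" for t
  proof -
    \<comment> \<open>Division with remainder, first by the translation length and then by the cross-ratio \<open>\<delta>\<close>.\<close>
    define r where "r = nat \<lfloor>(t - S) / l\<rfloor>"
    define \<rho> where "\<rho> = t - S - l * real r"
    have "0 \<le> (t - S) / l" using t l_pos by simp
    then have "real r \<le> (t - S) / l" "(t - S) / l < real r + 1" unfolding r_def by linarith+
    then have \<rho>: "0 \<le> \<rho>" "\<rho> < l" using l_pos by (simp_all add: \<rho>_def field_simps)
    define j where "j = nat \<lfloor>\<rho> / \<delta>\<rfloor>"
    have "0 \<le> \<rho> / \<delta>" using \<rho> \<delta>0 by simp
    then have j: "real j \<le> \<rho> / \<delta>" "\<rho> / \<delta> < real j + 1" unfolding j_def by linarith+
    then have j\<rho>: "real j * \<delta> \<le> \<rho>" "\<rho> < real j * \<delta> + \<delta>" using \<delta>0 by (simp_all add: field_simps)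
    have "real j * \<delta> < real k * \<delta>" using j\<rho>(1) \<rho>(2) k by linarith
    then have jk: "j \<le> k" using \<delta>0 by simp
    obtain \<gamma> where \<gamma>: "\<gamma> \<in> \<Gamma>"
      "\<bar>dist P (\<gamma> Q) - (b + l * real (2 * (2 * k) + 2) * real p + l * real r + (\<Sum>i<2 * k. T j i))\<bar> \<le> \<eta>"
      "gp (w0 (A (int p))) P (\<gamma> Q) \<le> \<eta>" "gp (w (A (- int (p + r)))) (iv \<gamma> P) Q \<le> \<eta>"
      using p[OF jk] by blast
    have "\<bar>dist P (\<gamma> Q) - 2 * R - t\<bar> \<le> \<epsilon>"
      using \<gamma>(2) j\<rho> \<delta>0 \<epsilon> unfolding sumT[OF jk] S_def \<rho>_def \<eta>_def by linarith
    moreover have "gp (g R) P (\<gamma> Q) \<le> \<eta> + \<eta>"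
    proof (rule gp_transfer[OF w0(2) \<gamma>(3) K])
      show "K + \<eta> + dist (g R) P \<le> dist (g R) (w0 (A (int p)))"
        using dist_axis_ge[OF w0(1), of "int p" "g R"] p1 by simp
    qed
    then have "gp (g R) P (\<gamma> Q) \<le> \<epsilon>" using \<epsilon> by (simp add: \<eta>_def)
    moreover have "gp (h (- R)) Q (iv \<gamma> P) \<le> \<eta> + \<eta>"
    proof (rule gp_transfer[OF w(2) _ K])
      show "gp (w (A (- int (p + r)))) Q (iv \<gamma> P) \<le> \<eta>"
        using \<gamma>(4) unfolding gromov_product_commute[of _ Q] .
      have "l * real p \<le> l * real (p + r)" using l_pos by simp
      moreover have "l * real (p + r) - dist (h (- R)) (w x) \<le> dist (h (- R)) (w (A (- int (p + r))))"
        using dist_axis_ge[OF w(1), of "- int (p + r)" "h (- R)"] by (simp add: add.commute)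
      ultimately show "K + \<eta> + dist (h (- R)) Q \<le> dist (h (- R)) (w (A (- int (p + r))))"
        using p2 by linarith
    qed
    then have "gp (\<gamma> (h (- R))) (\<gamma> Q) (\<gamma> (iv \<gamma> P)) \<le> \<epsilon>"
      unfolding gp_isometry[OF \<gamma>(1)] using \<epsilon> by (simp add: \<eta>_def)
    then have "gp (\<gamma> (h (- R))) P (\<gamma> Q) \<le> \<epsilon>"
      using \<gamma>(1) by (simp add: gromov_product_commute[of _ P])
    ultimately show ?thesis using \<gamma>(1) by blast
  qed
  then show ?thesis unfolding P_def Q_def by (intro exI[of _ "max 0 S"]) auto
qed

end

context geometric_action
begin

section \<open>Mixing\<close>

text \<open>The line is an extension of the segment from \<open>g(-R)\<close> to \<open>\<gamma> h(R)\<close>.\<close>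

lemma line_with_prescribed_transit:
  assumes one: "one_ended G" and g: "g \<in> GX" and h: "h \<in> GX" and R: "R \<ge> 0" and \<epsilon>: "\<epsilon> > 0"
  shows "\<exists>t0. \<forall>t\<ge>t0. \<exists>\<gamma>\<in>\<Gamma>. \<exists>k\<in>GX. \<forall>s. \<bar>s\<bar> \<le> R \<longrightarrow>
     dist (k s) (g s) < \<epsilon> \<and> dist (k (s + t)) (\<gamma> (h s)) < \<epsilon>"
proof -
  obtain \<alpha> x l where ax: "l > 0" "\<And>n::int. \<alpha> n \<in> \<Gamma>" "\<And>m n. \<alpha> (m + n) = \<alpha> m \<circ> \<alpha> n"
     "\<And>m n. dist (\<alpha> m x) (\<alpha> n x) = l * \<bar>of_int (m - n)\<bar>"
    using axis_exists by blast
  interpret axis \<Gamma> \<alpha> x l by unfold_locales (use ax in auto)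
  define \<eta> where "\<eta> = min (\<epsilon> / 4) (ln (cosh (\<epsilon> / 2)) / 4)"
  have "cosh (\<epsilon> / 2) > cosh 0" using \<epsilon> by (subst cosh_real_nonneg_less_iff) auto
  then have ch: "ln (cosh (\<epsilon> / 2)) > 0" by simp
  then have \<eta>: "\<eta> > 0" "\<eta> \<le> \<epsilon> / 4" using \<epsilon> by (auto simp: \<eta>_def)
  have "\<eta> \<le> ln (cosh (\<epsilon> / 2)) / 4" by (simp add: \<eta>_def)
  then have \<eta>3: "2 * \<eta> < ln (cosh (\<epsilon> / 2))" using ch by linarith
  have near: "dist p q < \<epsilon> / 2" if "cosh (dist p q) \<le> exp (2 * \<eta>)" for p q :: 'a
  proof -
    have "exp (2 * \<eta>) < exp (ln (cosh (\<epsilon> / 2)))" using \<eta>3 by (simp only: exp_less_cancel_iff)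
    then have "cosh (dist p q) < cosh (\<epsilon> / 2)" using that by simp
    then show ?thesis using \<epsilon> by (subst (asm) cosh_real_nonneg_less_iff) auto
  qed
  obtain t0 where t0: "t0 \<ge> 0" "\<And>t. t \<ge> t0 \<Longrightarrow> \<exists>\<gamma>\<in>\<Gamma>. \<bar>dist (g (- R)) (\<gamma> (h R)) - 2 * R - t\<bar> \<le> \<eta> \<and>
     gp (g R) (g (- R)) (\<gamma> (h R)) \<le> \<eta> \<and> gp (\<gamma> (h (- R))) (g (- R)) (\<gamma> (h R)) \<le> \<eta>"
    using transit_times_dense[OF one g h R \<eta>(1)] by blast
  have "\<exists>\<gamma>\<in>\<Gamma>. \<exists>k\<in>GX. \<forall>s. \<bar>s\<bar> \<le> R \<longrightarrow> dist (k s) (g s) < \<epsilon> \<and> dist (k (s + t)) (\<gamma> (h s)) < \<epsilon>"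
    if t: "t \<ge> t0 + \<epsilon>" for t
  proof -
    have "t \<ge> t0" using t \<epsilon> by simp
    from t0(2)[OF this] obtain \<gamma> where \<gamma>: "\<gamma> \<in> \<Gamma>" "\<bar>dist (g (- R)) (\<gamma> (h R)) - 2 * R - t\<bar> \<le> \<eta>"
     "gp (g R) (g (- R)) (\<gamma> (h R)) \<le> \<eta>" "gp (\<gamma> (h (- R))) (g (- R)) (\<gamma> (h R)) \<le> \<eta>"
      by blast
    define P Y a where "P = g (- R)" and "Y = \<gamma> (h R)" and "a = dist P Y"
    have gt: "\<bar>a - 2 * R - t\<bar> \<le> \<eta>" using \<gamma>(2) by (simp add: P_def Y_def a_def)
    have a: "a > 0" "2 * R \<le> a" using gt t t0(1) \<eta> R \<epsilon> by linarith+
    obtain c where c: "geodesic_segment UNIV dist c P Y"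
      using cat unfolding CAT_minus_one_def geodesic_space_def by blast
    have c': "geodesic_segment UNIV dist (\<lambda>s. c (a - s)) Y P"
      using c unfolding geodesic_segment_def by (auto simp: a_def dist_commute)
    obtain k0 where k0: "k0 \<in> GX" "\<And>s. s \<in> {0..a} \<Longrightarrow> k0 s = c s"
      using complete c unfolding geodesically_complete_def a_def by blast
    define k where "k = (\<lambda>s. k0 (s + R))"
    have k: "k \<in> GX" using k0(1) by (auto simp: geodesic_lines_def k_def)
    have gd: "dist (g s) (g s') = \<bar>s - s'\<bar>" for s s' by (rule GX_dist[OF g])
    have hd: "dist (\<gamma> (h s)) (\<gamma> (h s')) = \<bar>s - s'\<bar>" for s s'
      using isometry[OF \<gamma>(1)] GX_dist[OF h] by simp
    have "dist (k s) (g s) < \<epsilon> \<and> dist (k (s + t)) (\<gamma> (h s)) < \<epsilon>" if s: "\<bar>s\<bar> \<le> R" for s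
    proof
      have ds: "dist P (g s) = R + s" using s by (simp add: P_def gd)
      have "2 * gp (g s) P Y \<le> 2 * gp (g R) P Y"
        using dist_triangle[of "g s" Y "g R"] s
        by (simp add: gromov_product_def P_def gd)
      then have "gp (g s) P Y \<le> \<eta>" using \<gamma>(3) by (simp add: P_def Y_def)
      then have "cosh (dist (g s) (c (dist P (g s)))) \<le> exp (2 * \<eta>)"
        by (intro segment_near[OF c]) (use ds s a in \<open>auto simp: a_def\<close>)
      then have "dist (g s) (c (R + s)) < \<epsilon> / 2" unfolding ds by (rule near)
      moreover have "s + R \<in> {0..a}" using s a by auto
      then have "k s = c (R + s)" using k0(2)[of "s + R"] by (simp add: k_def add.commute)
      ultimately show "dist (k s) (g s) < \<epsilon>" using \<epsilon> by (simp add: dist_commute)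
    next
      let ?q = "\<gamma> (h s)"
      have ds: "dist Y ?q = R - s" using s by (simp add: Y_def hd)
      have "2 * gp ?q P Y \<le> 2 * gp (\<gamma> (h (- R))) P Y"
        using dist_triangle[of ?q P "\<gamma> (h (- R))"] s
        by (simp add: gromov_product_def Y_def hd dist_commute)
      then have "gp ?q Y P \<le> \<eta>" using \<gamma>(4) by (simp add: P_def Y_def gromov_product_commute)
      then have "cosh (dist ?q (c (a - dist Y ?q))) \<le> exp (2 * \<eta>)"
        by (intro segment_near[OF c']) (use ds s a in \<open>auto simp: a_def dist_commute\<close>)
      then have "dist ?q (c (a - (R - s))) < \<epsilon> / 2" unfolding ds by (rule near)
      moreover have "a - (R - s) \<in> {0..a}" using s a by auto
      then have "k0 (a - (R - s)) = c (a - (R - s))" by (rule k0(2))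
      ultimately have 1: "dist (k0 (a - (R - s))) ?q < \<epsilon> / 2" by (simp add: dist_commute)
      have "dist (k (s + t)) (k0 (a - (R - s))) = \<bar>(s + t + R) - (a - (R - s))\<bar>"
        unfolding k_def by (rule GX_dist[OF k0(1)])
      then have 2: "dist (k (s + t)) (k0 (a - (R - s))) \<le> \<epsilon> / 4" using gt \<eta>(2) by linarith
      show "dist (k (s + t)) ?q < \<epsilon>"
        using dist_triangle[of "k (s + t)" ?q "k0 (a - (R - s))"] 1 2 \<epsilon> by linarith
    qed
    then show ?thesis using \<gamma>(1) k by blast
  qed
  then show ?thesis by blast
qed

lemma proj_GY_eq: "proj_GY \<Gamma> g = (\<lambda>\<gamma>. \<gamma> \<circ> g) ` \<Gamma>"
  by (auto simp: proj_GY_def orbit_def)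

lemma proj_GY_translate:
  assumes "\<gamma> \<in> \<Gamma>" shows "proj_GY \<Gamma> (\<gamma> \<circ> g) = proj_GY \<Gamma> g"
proof -
  have "\<delta> \<circ> (\<gamma> \<circ> g) \<in> proj_GY \<Gamma> g" if "\<delta> \<in> \<Gamma>" for \<delta>
    unfolding proj_GY_eq by (rule image_eqI[OF _ comp_mem[OF that assms]]) (simp add: o_assoc)
  moreover have "\<delta> \<circ> g \<in> proj_GY \<Gamma> (\<gamma> \<circ> g)" if "\<delta> \<in> \<Gamma>" for \<delta>
    unfolding proj_GY_eq
    by (rule image_eqI[OF _ comp_mem[OF that inv_mem[OF assms]]]) (simp add: fun_eq_iff assms)
  ultimately show ?thesis unfolding proj_GY_eq by blast
qed

lemma GX_translate: "\<gamma> \<in> \<Gamma> \<Longrightarrow> g \<in> GX \<Longrightarrow> \<gamma> \<circ> g \<in> GX"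
  by (simp add: geodesic_lines_def isometry)

lemma GX_flow_GX: "g \<in> GX \<Longrightarrow> GX_flow t g \<in> GX"
  by (auto simp: geodesic_lines_def GX_flow_def)

lemma GY_open_nbhd:
  assumes "openin (GY_topology \<Gamma>) U" "U \<noteq> {}"
  obtains g R \<epsilon> where "g \<in> GX" "R \<ge> 0" "\<epsilon> > 0"
    "\<And>k. k \<in> GX \<Longrightarrow> (\<And>s. \<bar>s\<bar> \<le> R \<Longrightarrow> dist (k s) (g s) < \<epsilon>) \<Longrightarrow> proj_GY \<Gamma> k \<in> U"
proof -
  have "openin GX_topology (GX :: (real \<Rightarrow> 'a) set)"
    unfolding openin_GX_topology
  proof (intro conjI subset_refl ballI)
    fix g :: "real \<Rightarrow> 'a"
    show "\<exists>K \<epsilon>. compact K \<and> \<epsilon> > 0 \<and> {h \<in> GX. \<forall>t\<in>K. dist (h t) (g t) < \<epsilon>} \<subseteq> GX"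
      by (intro exI[of _ "{}"] exI[of _ 1]) auto
  qed
  then have "(GX :: (real \<Rightarrow> 'a) set) \<subseteq> topspace GX_topology" by (rule openin_subset)
  moreover have "topspace GX_topology \<subseteq> (GX :: (real \<Rightarrow> 'a) set)"
    using openin_topspace[of "GX_topology :: (real \<Rightarrow> 'a) topology"] unfolding openin_GX_topology by (rule conjunct1)
  ultimately have top: "topspace GX_topology = (GX :: (real \<Rightarrow> 'a) set)" by (rule subset_antisym[rotated])
  have U: "U \<subseteq> proj_GY \<Gamma> ` GX" "openin GX_topology {g \<in> GX. proj_GY \<Gamma> g \<in> U}"
    using assms(1) unfolding GY_topology_def openin_quotient_topology top by (rule conjunct1, rule conjunct2)
  obtain g where g: "g \<in> GX" "proj_GY \<Gamma> g \<in> U" using U(1) assms(2) by blast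
  then obtain K \<epsilon> where K: "compact K" "\<epsilon> > 0" "{k \<in> GX. \<forall>t\<in>K. dist (k t) (g t) < \<epsilon>} \<subseteq> {g \<in> GX. proj_GY \<Gamma> g \<in> U}"
    using U(2) unfolding openin_GX_topology by blast
  obtain R where R: "R > 0" "\<And>s. s \<in> K \<Longrightarrow> \<bar>s\<bar> \<le> R"
    using compact_imp_bounded[OF K(1)] unfolding bounded_pos by (auto simp: real_norm_def)
  show ?thesis
  proof (rule that[of g R \<epsilon>])
    fix k assume k: "k \<in> GX" "\<And>s. \<bar>s\<bar> \<le> R \<Longrightarrow> dist (k s) (g s) < \<epsilon>"
    then have "k \<in> {k \<in> GX. \<forall>t\<in>K. dist (k t) (g t) < \<epsilon>}" using R by blast
    then show "proj_GY \<Gamma> k \<in> U" using K(3) by blast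
  qed (use g R K in auto)
qed

text \<open>Negative times are reduced to positive ones by exchanging the two open sets.\<close>

theorem geodesic_flow_mixing:
  assumes one: "one_ended G"
  shows "topologically_mixing (GY_topology \<Gamma>) (GY_flow \<Gamma>)"
  unfolding topologically_mixing_def
proof (intro allI impI, elim conjE)
  fix A B assume A: "openin (GY_topology \<Gamma>) A" "A \<noteq> {}" and B: "openin (GY_topology \<Gamma>) B" "B \<noteq> {}"
  obtain g R1 e1 where g: "g \<in> GX" "R1 \<ge> 0" "e1 > 0"
    "\<And>k. k \<in> GX \<Longrightarrow> (\<And>s. \<bar>s\<bar> \<le> R1 \<Longrightarrow> dist (k s) (g s) < e1) \<Longrightarrow> proj_GY \<Gamma> k \<in> A"
    using GY_open_nbhd[OF A] by blast
  obtain h R2 e2 where h: "h \<in> GX" "R2 \<ge> 0" "e2 > 0"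
    "\<And>k. k \<in> GX \<Longrightarrow> (\<And>s. \<bar>s\<bar> \<le> R2 \<Longrightarrow> dist (k s) (h s) < e2) \<Longrightarrow> proj_GY \<Gamma> k \<in> B"
    using GY_open_nbhd[OF B] by blast
  define R where "R = max R1 R2"
  define e where "e = min e1 e2"
  have R: "R \<ge> 0" and e: "e > 0" using g(2,3) h(2,3) by (auto simp: R_def e_def)
  have gA: "proj_GY \<Gamma> k \<in> A" if "k \<in> GX" "\<And>s. \<bar>s\<bar> \<le> R \<Longrightarrow> dist (k s) (g s) < e" for k
    using that by (intro g(4)) (auto simp: R_def e_def)
  have hB: "proj_GY \<Gamma> k \<in> B" if "k \<in> GX" "\<And>s. \<bar>s\<bar> \<le> R \<Longrightarrow> dist (k s) (h s) < e" for k
    using that by (intro h(4)) (auto simp: R_def e_def)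
  have land: "dist ((iv \<gamma> \<circ> GX_flow t k) s) q < e" if "\<gamma> \<in> \<Gamma>" "dist (k (s + t)) (\<gamma> q) < e" for \<gamma> t k s q
    using isometry[OF that(1), of "iv \<gamma> (k (s + t))" q] that by (simp add: GX_flow_def)
  obtain t1 where t1: "\<And>t. t \<ge> t1 \<Longrightarrow> \<exists>\<gamma>\<in>\<Gamma>. \<exists>k\<in>GX. \<forall>s. \<bar>s\<bar> \<le> R \<longrightarrow>
     dist (k s) (g s) < e \<and> dist (k (s + t)) (\<gamma> (h s)) < e"
    using line_with_prescribed_transit[OF one g(1) h(1) R e] by blast
  obtain t2 where t2: "\<And>t. t \<ge> t2 \<Longrightarrow> \<exists>\<gamma>\<in>\<Gamma>. \<exists>k\<in>GX. \<forall>s. \<bar>s\<bar> \<le> R \<longrightarrow>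
     dist (k s) (h s) < e \<and> dist (k (s + t)) (\<gamma> (g s)) < e"
    using line_with_prescribed_transit[OF one h(1) g(1) R e] by blast
  have "GY_flow \<Gamma> t ` A \<inter> B \<noteq> {}" if t: "\<bar>t\<bar> \<ge> max 1 (max t1 t2)" for t
  proof (cases "t \<ge> 0")
    case True
    then have "t \<ge> t1" using t by simp
    from t1[OF this] obtain \<gamma> k where k: "\<gamma> \<in> \<Gamma>" "k \<in> GX"
      "\<And>s. \<bar>s\<bar> \<le> R \<Longrightarrow> dist (k s) (g s) < e" "\<And>s. \<bar>s\<bar> \<le> R \<Longrightarrow> dist (k (s + t)) (\<gamma> (h s)) < e"
      by blast
    have "proj_GY \<Gamma> k \<in> A" by (rule gA[OF k(2,3)])
    moreover have "proj_GY \<Gamma> (iv \<gamma> \<circ> GX_flow t k) \<in> B"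
      by (rule hB[OF GX_translate[OF inv_mem[OF k(1)] GX_flow_GX[OF k(2)]]]) (rule land[OF k(1)], rule k(4))
    then have "GY_flow \<Gamma> t (proj_GY \<Gamma> k) \<in> B"
      unfolding GY_flow_proj[OF subgroup_\<Gamma> k(2)] proj_GY_translate[OF inv_mem[OF k(1)]] .
    ultimately show ?thesis by blast
  next
    case False
    then have "- t \<ge> t2" using t by simp
    from t2[OF this] obtain \<gamma> k where k: "\<gamma> \<in> \<Gamma>" "k \<in> GX"
      "\<And>s. \<bar>s\<bar> \<le> R \<Longrightarrow> dist (k s) (h s) < e" "\<And>s. \<bar>s\<bar> \<le> R \<Longrightarrow> dist (k (s + - t)) (\<gamma> (g s)) < e"
      by blast
    define m where "m = iv \<gamma> \<circ> GX_flow (- t) k"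
    have m: "m \<in> GX" unfolding m_def by (rule GX_translate[OF inv_mem[OF k(1)] GX_flow_GX[OF k(2)]])
    have "proj_GY \<Gamma> m \<in> A" by (rule gA[OF m]) (unfold m_def, rule land[OF k(1)], rule k(4))
    moreover have "GX_flow t m = iv \<gamma> \<circ> k" by (simp add: m_def GX_flow_def fun_eq_iff)
    then have "GY_flow \<Gamma> t (proj_GY \<Gamma> m) = proj_GY \<Gamma> k"
      unfolding GY_flow_proj[OF subgroup_\<Gamma> m] by (simp only: proj_GY_translate[OF inv_mem[OF k(1)]])
    moreover have "proj_GY \<Gamma> k \<in> B" by (rule hB[OF k(2,3)])
    ultimately show ?thesis by (metis disjoint_iff imageI)
  qed
  then show "\<exists>t0>0. \<forall>t. \<bar>t\<bar> \<ge> t0 \<longrightarrow> GY_flow \<Gamma> t ` A \<inter> B \<noteq> {}"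
    by (intro exI[of _ "max 1 (max t1 t2)"]) auto
qed

end

theorem corollary5p1:
  fixes \<Gamma> :: "('a::metric_space \<Rightarrow> 'a) set"
  assumes "CAT_minus_one (UNIV :: 'a set) dist"
    and "\<And>(x::'a) r. compact (cball x r)"
    and "geodesically_complete (UNIV :: 'a set) dist"
    and "discrete_isometry_group \<Gamma>"
    and "one_ended (isometry_group\<lparr>carrier := \<Gamma>\<rparr>)"
    and "compact_space (quotient_space \<Gamma>)"
  shows "topologically_mixing (GY_topology \<Gamma>) (GY_flow \<Gamma>)"
proof -
  interpret geometric_action \<Gamma> by unfold_locales (use assms in auto)
  show ?thesis by (rule geodesic_flow_mixing[OF assms(5)])
qed

end
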